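(* Let $\mathrm D:=\mathrm D_{[0,1],[0,1]}$ and $\mathrm D_{\mathbb N,[0,1]}$ be the disintegration operators and let $\mathrm{Lim}=\mathrm{Lim}_{2^\omega}$ be the limit operator on Cantor space. Then $$\mathrm D\ \equiv_{\mathrm{sW}}\ \mathrm D_{\mathbb N,[0,1]}\ \equiv_{\mathrm{sW}}\ \mathrm{Lim}.$$
   Context: **Represented spaces.** A represented space is a set $X$ with a partial surjection $\delta_X:\subseteq\mathbb N^{\mathbb N}\to X$; $p$ is a name of $\delta_X(p)$. A realizer of a partial multi-valued function $f:\subseteq X\rightrightarrows Y$ between represented spaces is a partial function $F:\subseteq\mathbb N^{\mathbb N}\to\mathbb N^{\mathbb N}$ with $\delta_Y(F(p))\in f(\delta_X(p))$ for all $p$ in the domain of $f\circ\delta_X$; write $F\vdash f$. $f$ is continuous (computable) if it has a continuous (computable) realizer. Subsets carry the restricted representation and products the product representation. $\mathcal C(X,Y)$ is the represented space of continuous maps $X\to Y$ (in the sense of realizers): $0^n1p$ is a name of $f$ iff the $n$-th oracle Turing machine with oracle $p$ computes a realizer of $f$. $\mathbb N$ is represented by $0^n10^\omega\mapsto n$; Sierpinski space $\mathbb S=\{0,1\}$ by $\delta(0^\omega)=0$ and $\delta(p)=1$ for $p\ne 0^\omega$; $\mathcal O(X)$, the space of open sets, is $\mathcal C(X,\mathbb S)$ with $f$ representing $f^{-1}(1)$; $\mathbb R$ has its standard (Cauchy) representation. **Computable metric spaces.** A represented space $X$ is admissible if, for every represented space $Y$, the map $f\mapsto f^{-1}$ from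 $\mathcal C(Y,X)$ to $\mathcal C(\mathcal O(X),\mathcal O(Y))$ has a well-defined continuous partial inverse. A computable metric space is a complete separable metric space $(S,d_S)$ with an admissible representation and a computable dense sequence $s\in\mathcal C(\mathbb N,S)$ such that the following are computable: $d_S:S\times S\to\mathbb R$; the limit map on sequences $(r_n)\in\mathcal C(\mathbb N,S)$ with $d_S(r_n,r_{n+1})<2^{-n}$ for all $n$; and the map taking a sequence $(m_n,q_n)_n\in\mathcal C(\mathbb N,\mathbb N\times\mathbb Q)$ to $\bigcup_n\{x: d_S(x,s(m_n))<q_n\}\in\mathcal O(S)$, the last also having a computable multi-valued inverse. $\mathbb N$ (discrete), $[0,1]$, Cantor space $2^\omega$ (usual ultrametric; dense set the eventually zero sequences) and finite products of computable metric spaces are regarded as computable metric spaces in the standard way. $\mathcal M_1(S)$ denotes the Borel probability measures on $S$ with the weak topology; for a computable metric space $S$ it is a computable metric space under the Prokhorov metric, with dense set the finite convex combinations with positive rational weights of Dirac measures at points of the dense sequence. **Disintegration operator.** For measurable $g:S\to T$ and $\mu\in\mathcal M_1(S)$, let $g[\mu]=\mu\circ g^{-1}$. A disintegration of $\mu$ along $g$ is a measurable map $\kappa:T\to\mathcal M_1(S)$ with $\mu(g^{-1}(B)\cap A)=\int_B\kappa(x)(A)\,g[\mu](dx)$ for all Borel $A\subseteq S$, $B\subseteq T$. Let $\pi_2:S\times T\to T$ be the projection. $\mathcal C_{S,T}\subseteq\mathcal M_1(S\times T)$ is the set of $\mu$ such that $\pi_2[\mu]$ has support all of $T$ and $\mu$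 admits a (necessarily unique) continuous disintegration $\kappa:T\to\mathcal M_1(S\times T)$ along $\pi_2$. The operator $\mathrm D_{S,T}:\mathcal C_{S,T}\to\mathcal C(T,\mathcal M_1(S))$ sends $\mu$ to the map $t\mapsto \kappa(t)(\,\cdot\times T)$. **Lim.** For a metric space $S$, $\mathrm{Lim}_S:\subseteq\mathcal C(\mathbb N,S)\to S$ is the partial map taking convergent Cauchy sequences (with no rate of convergence given) to their limits. **Strong Weihrauch reducibility.** $f\le_{\mathrm{sW}}g$ means there are computable partial $H,K:\subseteq\mathbb N^{\mathbb N}\to\mathbb N^{\mathbb N}$ such that for every $G\vdash g$, $H\circ G\circ K\vdash f$. $f\equiv_{\mathrm{sW}}g$ means $f\le_{\mathrm{sW}}g$ and $g\le_{\mathrm{sW}}f$. *)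

theory Defs
  imports "HOL-Probability.Probability"
begin

section \<open>Oracle computability on Baire space\<close>

type_synonym baire = "nat \<Rightarrow> nat"

text \<open>Programs for the unary functions that are partial recursive relative to an oracle
  (equivalently, computed by oracle Turing machines); several arguments are coded by
  \<^const>\<open>prod_encode\<close>.\<close>

datatype prog =
    Zero | Succ | Left | Right | Query
  | Tuple prog prog | Comp prog prog | PrimRec prog prog | Search prog

inductive run :: "baire \<Rightarrow> prog \<Rightarrow> nat \<Rightarrow> nat \<Rightarrow> bool" for p :: baire where
  run_Zero: "run p Zero x 0"
| run_Succ: "run p Succ x (Suc x)"
| run_Left: "run p Left (prod_encode (x, y)) x"
| run_Right: "run p Right (prod_encode (x, y)) y"
| run_Query: "run p Query x (p x)"
| run_Tuple: "\<lbrakk>run p f x a; run p g x b\<rbrakk> \<Longrightarrow> run p (Tuple f g) x (prod_encode (a, b))"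
| run_Comp: "\<lbrakk>run p g x y; run p f y z\<rbrakk> \<Longrightarrow> run p (Comp f g) x z"
| run_PrimRec_0: "run p f x y \<Longrightarrow> run p (PrimRec f g) (prod_encode (x, 0)) y"
| run_PrimRec_Suc:
    "\<lbrakk>run p (PrimRec f g) (prod_encode (x, n)) y;
      run p g (prod_encode (x, prod_encode (n, y))) z\<rbrakk>
     \<Longrightarrow> run p (PrimRec f g) (prod_encode (x, Suc n)) z"
| run_Search:
    "\<lbrakk>run p f (prod_encode (x, n)) 0;
      \<And>m. m < n \<Longrightarrow> run p f (prod_encode (x, m)) (Suc (h m))\<rbrakk>
     \<Longrightarrow> run p (Search f) x n"

inductive_cases run_elims:
  "run p Zero x y" "run p Succ x y" "run p Left x y" "run p Right x y" "run p Query x y"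
  "run p (Tuple f g) x y" "run p (Comp f g) x y" "run p (PrimRec f g) x y" "run p (Search f) x y"

lemma run_deterministic: "run p c x y \<Longrightarrow> run p c x y' \<Longrightarrow> y = y'"
proof (induction arbitrary: y' rule: run.induct)
  case (run_Search f x n h)
  have 0: "run p f (prod_encode (x, y')) 0"
    using run_Search.prems by (rule run_elims(9))
  have below: "\<exists>k. run p f (prod_encode (x, m)) (Suc k)" if "m < y'" for m
    using run_Search.prems that by (blast elim: run_elims(9))
  show ?case
  proof (cases n y' rule: linorder_cases)
    case less
    then show ?thesis using run_Search.IH(1) below[OF less] by fastforce
  next
    case greater
    then show ?thesis using run_Search.IH(2)[OF greater 0] by simp
  qed simp
next
  case (run_Tuple f x a g b)
  from run_Tuple.prems show ?case by (rule run_elims(6)) (metis run_Tuple.IH)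
next
  case (run_Comp g x y f z)
  from run_Comp.prems show ?case by (rule run_elims(7)) (metis run_Comp.IH)
next
  case (run_PrimRec_0 f x y g)
  from run_PrimRec_0.prems show ?case
    by (rule run_elims(8)) (simp_all add: run_PrimRec_0.IH)
next
  case (run_PrimRec_Suc f g x n y z)
  from run_PrimRec_Suc.prems show ?case
  proof (rule run_elims(8))
    fix x1 n1 y1
    assume "prod_encode (x, Suc n) = prod_encode (x1, Suc n1)"
      and 1: "run p (PrimRec f g) (prod_encode (x1, n1)) y1"
      and 2: "run p g (prod_encode (x1, prod_encode (n1, y1))) y'"
    then have "x1 = x" "n1 = n" by simp_all
    then show ?thesis using 1 2 run_PrimRec_Suc.IH by metis
  qed simp
qed (auto elim: run_elims(1-5))

text \<open>The Goedel numbering of programs.\<close>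

function prog_of :: "nat \<Rightarrow> prog" where
  "prog_of n =
    (if n = 0 then Zero else if n = 1 then Succ else if n = 2 then Left
     else if n = 3 then Right else if n = 4 then Query
     else let m = (n - 5) div 4; a = fst (prod_decode m); b = snd (prod_decode m) in
       if n mod 4 = 0 then Tuple (prog_of a) (prog_of b)
       else if n mod 4 = 1 then Comp (prog_of a) (prog_of b)
       else if n mod 4 = 2 then PrimRec (prog_of a) (prog_of b)
       else Search (prog_of m))"
  by auto
termination
proof (relation "Wellfounded.measure id", unfold in_measure id_apply, goal_cases)
  have less: "(n - 5) div 4 < n" if "n \<noteq> 0" for n :: nat
    using that by presburger
  have le: "fst (prod_decode m) \<le> m" "snd (prod_decode m) \<le> m" for m
    by (metis le_prod_encode_1 le_prod_encode_2 prod.collapse prod_decode_inverse)+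
  note lt = le_less_trans[OF le(1) less] le_less_trans[OF le(2) less] less
  {
    case 1 show ?case by (rule wf_measure)
  next
    case 2 then show ?case using lt by blast
  next
    case 3 then show ?case using lt by blast
  next
    case 4 then show ?case using lt by blast
  next
    case 5 then show ?case using lt by blast
  next
    case 6 then show ?case using lt by blast
  next
    case 7 then show ?case using lt by blast
  next
    case 8 then show ?case using lt by blast
  }
qed

declare prog_of.simps [simp del]

lemma surj_prog_of: "surj prog_of"
proof -
  have m: "(4 * k + 8) mod 4 = 0" "(4 * k + 5) mod 4 = 1" "(4 * k + 6) mod 4 = 2"
    "(4 * k + 7) mod 4 = 3" "(4 * k + 5 - 5) div 4 = k" "(4 * k + 6 - 5) div 4 = k"
    "(4 * k + 7 - 5) div 4 = k" "(4 * k + 8 - 5) div 4 = k"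
    "Suc (4 * k) div 4 = k" "Suc (Suc (4 * k)) div 4 = k" "Suc (Suc (Suc (4 * k))) div 4 = k" for k :: nat
    by presburger+
  have "\<exists>n. prog_of n = c" for c
  proof (induction c)
    case Zero
    show ?case by (rule exI[of _ 0]) (simp add: prog_of.simps)
  next
    case Succ
    show ?case by (rule exI[of _ 1]) (simp add: prog_of.simps)
  next
    case Left
    show ?case by (rule exI[of _ 2]) (simp add: prog_of.simps)
  next
    case Right
    show ?case by (rule exI[of _ 3]) (simp add: prog_of.simps)
  next
    case Query
    show ?case by (rule exI[of _ 4]) (simp add: prog_of.simps)
  next
    case (Tuple c1 c2)
    then obtain a b where "prog_of a = c1" "prog_of b = c2" by auto
    then show ?case
      by (intro exI[of _ "4 * prod_encode (a, b) + 8"], subst prog_of.simps) (simp add: m Let_def)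
  next
    case (Comp c1 c2)
    then obtain a b where "prog_of a = c1" "prog_of b = c2" by auto
    then show ?case
      by (intro exI[of _ "4 * prod_encode (a, b) + 5"], subst prog_of.simps)
        (simp add: m Let_def)
  next
    case (PrimRec c1 c2)
    then obtain a b where "prog_of a = c1" "prog_of b = c2" by auto
    then show ?case
      by (intro exI[of _ "4 * prod_encode (a, b) + 6"], subst prog_of.simps)
        (simp add: m Let_def)
  next
    case (Search c)
    then obtain a where "prog_of a = c" by auto
    then show ?case
      by (intro exI[of _ "4 * a + 7"], subst prog_of.simps) (simp add: m Let_def)
  qed
  then show ?thesis by (metis surjI)
qed

text \<open>The partial function whose graph is \<open>R\<close>; used below only for right-unique \<open>R\<close>.\<close>

definition pfun :: "('a \<Rightarrow> 'b \<Rightarrow> bool) \<Rightarrow> 'a \<rightharpoonup> 'b" where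
  "pfun R x = (if \<exists>!y. R x y then Some (THE y. R x y) else None)"

definition machine :: "nat \<Rightarrow> baire \<rightharpoonup> baire" where
  "machine n = pfun (\<lambda>p q. \<forall>k. run p (prog_of n) k (q k))"

lemma machine_eq_Some_iff: "machine n p = Some q \<longleftrightarrow> (\<forall>k. run p (prog_of n) k (q k))"
proof
  assume "machine n p = Some q"
  then have ex: "\<exists>!q. \<forall>k. run p (prog_of n) k (q k)"
    and q: "q = (THE q. \<forall>k. run p (prog_of n) k (q k))"
    by (auto simp: machine_def pfun_def split: if_splits)
  from theI'[OF ex] show "\<forall>k. run p (prog_of n) k (q k)" unfolding q .
next
  assume *: "\<forall>k. run p (prog_of n) k (q k)"
  have uniq: "q' = q" if "\<forall>k. run p (prog_of n) k (q' k)" for q'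
    using that * by (intro ext) (metis run_deterministic)
  have "\<exists>!q. \<forall>k. run p (prog_of n) k (q k)"
    by (rule ex1I[of _ q], rule *, rule uniq)
  moreover have "(THE q. \<forall>k. run p (prog_of n) k (q k)) = q"
    by (rule the_equality, rule *, rule uniq)
  ultimately show "machine n p = Some q" by (simp add: machine_def pfun_def)
qed

definition computable :: "(baire \<rightharpoonup> baire) \<Rightarrow> bool" where
  "computable F \<longleftrightarrow> (\<exists>n. F \<subseteq>\<^sub>m machine n)"

definition interleave :: "baire \<Rightarrow> baire \<Rightarrow> baire" where
  "interleave p q k = (if even k then p (k div 2) else q (k div 2))"

text \<open>The sequence $0^n 1 p$.\<close>

definition tagged :: "nat \<Rightarrow> baire \<Rightarrow> baire" where
  "tagged n p k = (if k < n then 0 else if k = n then 1 else p (k - Suc n))"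


section \<open>Represented spaces and strong Weihrauch reducibility\<close>

text \<open>A represented space is given by its representation; the underlying set is
  \<^term>\<open>ran \<delta>\<close>.\<close>

type_synonym 'a rep = "baire \<rightharpoonup> 'a"

text \<open>A partial multi-valued function between represented spaces; it is defined at \<open>x\<close>
  iff \<open>val f x\<close> is nonempty.\<close>

record ('a, 'b) multifun =
  src :: "'a rep"
  tgt :: "'b rep"
  val :: "'a \<Rightarrow> 'b set"

definition realizer :: "(baire \<rightharpoonup> baire) \<Rightarrow> ('a, 'b) multifun \<Rightarrow> bool"  (infix \<open>\<turnstile>\<^sub>r\<close> 50) where
  "F \<turnstile>\<^sub>r f \<longleftrightarrow>
    (\<forall>p x. src f p = Some x \<and> val f x \<noteq> {} \<longrightarrow>
      (\<exists>q y. F p = Some q \<and> tgt f q = Some y \<and> y \<in> val f x))"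

definition sW_reducible ::
    "('a, 'b) multifun \<Rightarrow> ('c, 'd) multifun \<Rightarrow> bool"  (infix \<open>\<le>\<^sub>s\<^sub>W\<close> 50) where
  "f \<le>\<^sub>s\<^sub>W g \<longleftrightarrow>
    (\<exists>H K. computable H \<and> computable K \<and> (\<forall>G. G \<turnstile>\<^sub>r g \<longrightarrow> (H \<circ>\<^sub>m G \<circ>\<^sub>m K) \<turnstile>\<^sub>r f))"

definition sW_equivalent ::
    "('a, 'b) multifun \<Rightarrow> ('c, 'd) multifun \<Rightarrow> bool"  (infix \<open>\<equiv>\<^sub>s\<^sub>W\<close> 50) where
  "f \<equiv>\<^sub>s\<^sub>W g \<longleftrightarrow> f \<le>\<^sub>s\<^sub>W g \<and> g \<le>\<^sub>s\<^sub>W f"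

definition nat_rep :: "nat rep" where
  "nat_rep = pfun (\<lambda>p n. p = tagged n (\<lambda>_. 0))"

text \<open>The space of continuous maps: $0^n 1 p$ names \<open>\<phi>\<close> iff the machine number \<open>n\<close>, given
  access to \<open>p\<close> and to its input, computes a realizer of \<open>\<phi>\<close>. Every partial continuous map
  on Baire space has an extension of the form \<open>\<lambda>q. machine n (interleave p q)\<close>, so the set
  represented consists of all maps with a continuous realizer. To make \<open>\<phi>\<close> unique, it is
  \<^const>\<open>undefined\<close> outside the underlying set of \<open>X\<close>.\<close>

definition fun_rep :: "'a rep \<Rightarrow> 'b rep \<Rightarrow> ('a \<Rightarrow> 'b) rep" where
  "fun_rep X Y = pfun (\<lambda>r \<phi>. \<phi> \<in> ran X \<rightarrow>\<^sub>E ran Y \<and>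
    (\<exists>n p. r = tagged n p \<and>
      (\<lambda>q. machine n (interleave p q)) \<turnstile>\<^sub>r \<lparr>src = X, tgt = Y, val = (\<lambda>x. {\<phi> x})\<rparr>))"


section \<open>Metric spaces presented by a dense sequence\<close>

record 'a cms =
  points :: "'a set"
  metr :: "'a \<Rightarrow> 'a \<Rightarrow> real"
  dense :: "nat \<Rightarrow> 'a"

definition topology_cms :: "'a cms \<Rightarrow> 'a topology" where
  "topology_cms S = Metric_space.mtopology (points S) (metr S)"

definition borel_cms :: "'a cms \<Rightarrow> 'a measure" where
  "borel_cms S = sigma (points S) {U. openin (topology_cms S) U}"

text \<open>The Cauchy representation. Up to computable equivalence it is the only representation
  turning the presented space into a computable metric space.\<close>

definition cauchy_rep :: "'a cms \<Rightarrow> 'a rep" where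
  "cauchy_rep S = pfun (\<lambda>p x.
    (\<forall>n. metr S (dense S (p n)) (dense S (p (Suc n))) < (1/2) ^ n) \<and>
    limitin (topology_cms S) (\<lambda>n. dense S (p n)) x sequentially)"

definition nat_cms :: "nat cms" where
  "nat_cms = \<lparr>points = UNIV, metr = (\<lambda>m n. if m = n then 0 else 1), dense = id\<rparr>"

definition unit_interval_cms :: "real cms" where
  "unit_interval_cms = \<lparr>points = {0..1}, metr = dist,
     dense = (\<lambda>n. case prod_decode n of (a, b) \<Rightarrow> min 1 (real a / real (Suc b)))\<rparr>"

text \<open>The binary digits of the natural numbers are exactly the eventually zero sequences.\<close>

definition cantor_cms :: "(nat \<Rightarrow> bool) cms" where
  "cantor_cms = \<lparr>points = UNIV,
     metr = (\<lambda>x y. if x = y then 0 else (1/2) ^ (LEAST n. x n \<noteq> y n)),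
     dense = bit\<rparr>"

definition prod_cms :: "'a cms \<Rightarrow> 'b cms \<Rightarrow> ('a \<times> 'b) cms"  (infixr \<open>\<times>\<^sub>m\<close> 80) where
  "S \<times>\<^sub>m T = \<lparr>points = points S \<times> points T, metr = prod_dist (metr S) (metr T),
     dense = map_prod (dense S) (dense T) \<circ> prod_decode\<rparr>"


section \<open>Spaces of probability measures\<close>

definition prob_measures :: "'a cms \<Rightarrow> 'a measure set" where
  "prob_measures S = {\<mu>. prob_space \<mu> \<and> sets \<mu> = sets (borel_cms S)}"

definition neighbourhood :: "'a cms \<Rightarrow> real \<Rightarrow> 'a set \<Rightarrow> 'a set" where
  "neighbourhood S e A = {y \<in> points S. \<exists>x\<in>A. metr S x y < e}"

definition prokhorov :: "'a cms \<Rightarrow> 'a measure \<Rightarrow> 'a measure \<Rightarrow> real" where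
  "prokhorov S \<mu> \<nu> = Inf {e. e > 0 \<and> (\<forall>A \<in> sets (borel_cms S).
     measure \<mu> A \<le> measure \<nu> (neighbourhood S e A) + e \<and>
     measure \<nu> A \<le> measure \<mu> (neighbourhood S e A) + e)}"

text \<open>The mean of the Dirac measures at the points of the dense sequence whose indices are
  listed in \<open>is\<close>. As indices may be repeated, the means over all nonempty lists are exactly
  the convex combinations, with positive rational weights, of finitely many such Dirac
  measures.\<close>

definition dirac_mean :: "'a cms \<Rightarrow> nat list \<Rightarrow> 'a measure" where
  "dirac_mean S is =
    distr (uniform_count_measure {..<length is}) (borel_cms S) (\<lambda>j. dense S (is ! j))"

text \<open>\<^const>\<open>Metric_space\<close> asks for nonnegative distances also outside the underlying set,
  where the infimum in \<^const>\<open>prokhorov\<close> may be taken over the empty set.\<close>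

definition prob_cms :: "'a cms \<Rightarrow> 'a measure cms" where
  "prob_cms S = \<lparr>points = prob_measures S,
     metr = (\<lambda>\<mu> \<nu>. if \<mu> \<in> prob_measures S \<and> \<nu> \<in> prob_measures S then prokhorov S \<mu> \<nu> else 0),
     dense = (\<lambda>n. case prod_decode n of (i, l) \<Rightarrow> dirac_mean S (i # list_decode l))\<rparr>"


section \<open>The operators\<close>

definition disintegration ::
    "'a cms \<Rightarrow> 'b cms \<Rightarrow> ('a \<Rightarrow> 'b) \<Rightarrow> 'a measure \<Rightarrow> ('b \<Rightarrow> 'a measure) \<Rightarrow> bool" where
  "disintegration S T g \<mu> \<kappa> \<longleftrightarrow>
    \<kappa> \<in> borel_cms T \<rightarrow>\<^sub>M borel_cms (prob_cms S) \<and>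
    (\<forall>A \<in> sets (borel_cms S). \<forall>B \<in> sets (borel_cms T).
      emeasure \<mu> (g -` B \<inter> A) = (\<integral>\<^sup>+x\<in>B. emeasure (\<kappa> x) A \<partial>distr \<mu> (borel_cms T) g))"

definition measure_support :: "'a cms \<Rightarrow> 'a measure \<Rightarrow> 'a set" where
  "measure_support S \<mu> =
    {x \<in> points S. \<forall>U. openin (topology_cms S) U \<and> x \<in> U \<longrightarrow> emeasure \<mu> U > 0}"

text \<open>The values are sets only because \<^typ>\<open>('a, 'b) multifun\<close> asks for it: under the support
  condition a continuous disintegration is unique on \<^term>\<open>points T\<close>, so they have at most
  one element.\<close>

definition disintegration_op ::
    "'a cms \<Rightarrow> 'b cms \<Rightarrow> (('a \<times> 'b) measure, 'b \<Rightarrow> 'a measure) multifun" where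
  "disintegration_op S T = \<lparr>
     src = cauchy_rep (prob_cms (S \<times>\<^sub>m T)),
     tgt = fun_rep (cauchy_rep T) (cauchy_rep (prob_cms S)),
     val = (\<lambda>\<mu>. {\<lambda>t\<in>points T. distr (\<kappa> t) (borel_cms S) fst | \<kappa>.
       \<mu> \<in> prob_measures (S \<times>\<^sub>m T) \<and>
       measure_support T (distr \<mu> (borel_cms T) snd) = points T \<and>
       disintegration (S \<times>\<^sub>m T) T snd \<mu> \<kappa> \<and>
       continuous_map (topology_cms T) (topology_cms (prob_cms (S \<times>\<^sub>m T))) \<kappa>})\<rparr>"

definition lim_op :: "'a cms \<Rightarrow> (nat \<Rightarrow> 'a, 'a) multifun" where
  "lim_op S = \<lparr>
     src = fun_rep nat_rep (cauchy_rep S),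
     tgt = cauchy_rep S,
     val = (\<lambda>r. {x. limitin (topology_cms S) r x sequentially})\<rparr>"

end

theory Submission
  imports Defs
begin

text \<open>
Both reductions go through the limit of a convergent sequence in Cantor space. A continuous
disintegration is determined by the averages of \<open>\<mu>\<close> over small balls of the base space. That all
values of the disintegration on a ball are close to a given mean of Dirac measures is, up to a
factor two, equivalent to a family of inequalities between averages, each of which can be tested
on all sufficiently good approximations to \<open>\<mu>\<close>; it is thus a universal statement about a name of
\<open>\<mu>\<close>. The truth values of universal statements are obtained by a single limit, and from them the
disintegration is computed by searching for a ball around the given point.

Conversely, a convergent sequence in Cantor space is turned into real numbers \<open>r k\<close> converging to a
real number that encodes the limit. Interpolating them at the points \<open>1/k\<close> gives a continuous function
\<open>h\<close> on the unit interval whose value at \<open>0\<close> is the limit. Consider the measure on the product whose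
second marginal is discrete with dense support in \<open>(0,1]\<close> and whose fibre over \<open>t\<close> has weights
\<open>h t\<close> and \<open>1 - h t\<close> at two fixed points. It is computable from the \<open>r k\<close> because \<open>0\<close> is not an atom,
while the fibre over \<open>0\<close> gives back the limit.
\<close>

section \<open>Functions recursive in an oracle\<close>

text \<open>Strong reducibility hides the original input from the decoding map, so a single answer
  of the oracle must carry everything. Hence the truth values of all tests are collected in one
  point of Cantor space, and the name returned for the disintegration consults only that point. A
  name of \<open>\<mu>\<close> controls masses only up to enlarging sets, and boundaries may carry
  mass, so no test is exact. Completeness at error \<open>(1/2) ^ (n + 4)\<close> and soundness at
  \<open>(1/2) ^ (n + 3)\<close> suffice, since any accepted candidate will do.

  Conversely, a limit in Cantor space is packed into one real number. With digits 0 and 1 in base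
  four the tail after \<open>n\<close> digits is at most \<open>(1/4) ^ n / 3\<close>, so
  approximations determine digits; binary expansions would be ambiguous. At positive rational points
  the interpolation uses finitely many rational terms, so the joint measure is found by exact
  arithmetic. The two disintegration operators are compared only with Lim, and with each other by
  transitivity.\<close>

definition recf :: "(baire \<Rightarrow> nat \<Rightarrow> nat) \<Rightarrow> bool" where
  "recf F \<longleftrightarrow> (\<exists>c. \<forall>p x. run p c x (F p x))"

named_theorems recf_intros

abbreviation pfst :: "nat \<Rightarrow> nat" where "pfst x \<equiv> fst (prod_decode x)"
abbreviation psnd :: "nat \<Rightarrow> nat" where "psnd x \<equiv> snd (prod_decode x)"

lemma recfI: "(\<And>p x. run p c x (F p x)) \<Longrightarrow> recf F"
  by (auto simp: recf_def)

lemma run_Left': "run p Left x (pfst x)"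
  using run_Left[of p "pfst x" "psnd x"] by simp

lemma run_Right': "run p Right x (psnd x)"
  using run_Right[of p "pfst x" "psnd x"] by simp

lemma run_id: "run p (Tuple Left Right) x x"
  using run_Tuple[OF run_Left' run_Right', of p x] by simp

lemma recf_id [recf_intros]: "recf (\<lambda>p x. x)"
  by (rule recfI, rule run_id)

lemma recf_comp:
  assumes "recf F" "recf G"
  shows "recf (\<lambda>p x. F p (G p x))"
  using assms unfolding recf_def by (blast intro: run_Comp)

lemma recf_pfst [recf_intros]: "recf F \<Longrightarrow> recf (\<lambda>p x. pfst (F p x))"
  using recf_comp[OF recfI[OF run_Left']] .

lemma recf_psnd [recf_intros]: "recf F \<Longrightarrow> recf (\<lambda>p x. psnd (F p x))"
  using recf_comp[OF recfI[OF run_Right']] .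

lemma recf_Suc [recf_intros]: "recf F \<Longrightarrow> recf (\<lambda>p x. Suc (F p x))"
  using recf_comp[OF recfI[OF run_Succ]] .

lemma recf_query [recf_intros]: "recf F \<Longrightarrow> recf (\<lambda>p x. p (F p x))"
  using recf_comp[OF recfI[OF run_Query]] .

lemma recf_pair [recf_intros]:
  "recf F \<Longrightarrow> recf G \<Longrightarrow> recf (\<lambda>p x. prod_encode (F p x, G p x))"
  unfolding recf_def by (blast intro: run_Tuple)

lemma recf_const [recf_intros]: "recf (\<lambda>p x. k)"
proof (induction k)
  case 0
  show ?case by (rule recfI, rule run_Zero)
qed (rule recf_Suc)

text \<open>Functions of several arguments count as recursive when they are so in the pair code. The
  closure rules for terms with bound variables have hypotheses of this shape.\<close>

lemma recf_comp2:
  assumes "recf (\<lambda>p z. H p (pfst z) (psnd z))" "recf F" "recf G"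
  shows "recf (\<lambda>p x. H p (F p x) (G p x))"
  using recf_comp[OF assms(1) recf_pair[OF assms(2,3)]] by simp

text \<open>The gateway from HOL terms to programs: arithmetic, finite sums and coded lists are
  rewritten as such recursions, so that no program is written by hand for them.\<close>

lemma recf_rec_nat [recf_intros]:
  assumes "recf A"
    and "recf (\<lambda>p z. G p (pfst z) (pfst (psnd z)) (psnd (psnd z)))"
    and "recf N"
  shows "recf (\<lambda>p x. rec_nat (A p x) (\<lambda>n y. G p x n y) (N p x))"
proof -
  obtain a where a: "\<And>p x. run p a x (A p x)" using assms(1) by (auto simp: recf_def)
  obtain g where g: "\<And>p z. run p g z (G p (pfst z) (pfst (psnd z)) (psnd (psnd z)))"
    using assms(2) by (auto simp: recf_def)
  have "run p (PrimRec a g) (prod_encode (x, n)) (rec_nat (A p x) (\<lambda>n y. G p x n y) n)" for p x n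
  proof (induction n)
    case 0
    show ?case by (simp add: run_PrimRec_0 a)
  next
    case (Suc n)
    show ?case
      using run_PrimRec_Suc[OF Suc g] by simp
  qed
  then have "run p (PrimRec a g) z (rec_nat (A p (pfst z)) (\<lambda>n y. G p (pfst z) n y) (psnd z))" for p z
    by (metis prod.collapse prod_decode_inverse)
  then have "recf (\<lambda>p z. rec_nat (A p (pfst z)) (\<lambda>n y. G p (pfst z) n y) (psnd z))"
    by (rule recfI)
  from recf_comp2[OF this recf_id assms(3)] show ?thesis .
qed

lemma recf_add [recf_intros]:
  assumes "recf F" "recf G" shows "recf (\<lambda>p x. F p x + G p x)"
proof -
  have "rec_nat a (\<lambda>n y. Suc y) b = a + b" for a b by (induction b) auto
  moreover have "recf (\<lambda>p x. rec_nat (F p x) (\<lambda>n y. Suc y) (G p x))"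
    by (intro recf_intros assms)
  ultimately show ?thesis by simp
qed

lemma recf_diff [recf_intros]:
  assumes "recf F" "recf G" shows "recf (\<lambda>p x. F p x - G p x)"
proof -
  have pred: "rec_nat 0 (\<lambda>n y. n) b = b - 1" for b by (cases b) auto
  have "rec_nat a (\<lambda>n y. rec_nat 0 (\<lambda>n y. n) y) b = a - b" for a b
    by (induction b) (auto simp: pred)
  moreover have "recf (\<lambda>p x. rec_nat (F p x) (\<lambda>n y. rec_nat 0 (\<lambda>n y. n) y) (G p x))"
    by (intro recf_intros assms)
  ultimately show ?thesis by simp
qed

lemma recf_mult [recf_intros]:
  assumes "recf F" "recf G" shows "recf (\<lambda>p x. F p x * G p x)"
proof -
  have "rec_nat 0 (\<lambda>n y. y + a) b = a * b" for a b :: nat by (induction b) auto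
  moreover have "recf (\<lambda>p x. rec_nat 0 (\<lambda>n y. y + F p x) (G p x))"
    by (intro recf_intros assms recf_comp[OF assms(1)])
  ultimately show ?thesis by simp
qed

lemma recf_power [recf_intros]:
  assumes "recf F" "recf G" shows "recf (\<lambda>p x. F p x ^ G p x)"
proof -
  have "rec_nat 1 (\<lambda>n y. y * a) b = a ^ b" for a b :: nat by (induction b) auto
  moreover have "recf (\<lambda>p x. rec_nat 1 (\<lambda>n y. y * F p x) (G p x))"
    by (intro recf_intros assms recf_comp[OF assms(1)])
  ultimately show ?thesis by simp
qed

lemma recf_sum [recf_intros]:
  assumes "recf (\<lambda>p z. F p (pfst z) (psnd z))" "recf N"
  shows "recf (\<lambda>p x. \<Sum>j<N p x. F p x j)"
proof -
  have "rec_nat 0 (\<lambda>n y. y + f n) b = (\<Sum>j<b. f j)" for b and f :: "nat \<Rightarrow> nat"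
    by (induction b) auto
  moreover have "recf (\<lambda>p x. rec_nat 0 (\<lambda>n y. y + F p x n) (N p x))"
    by (intro recf_intros assms recf_comp2[OF assms(1)])
  ultimately show ?thesis by simp
qed

subsection \<open>Decidable predicates\<close>

definition recp :: "(baire \<Rightarrow> nat \<Rightarrow> bool) \<Rightarrow> bool" where
  "recp P \<longleftrightarrow> recf (\<lambda>p x. of_bool (P p x))"

lemma recp_comp2:
  assumes "recp (\<lambda>p z. H p (pfst z) (psnd z))" "recf F" "recf G"
  shows "recp (\<lambda>p x. H p (F p x) (G p x))"
  using assms unfolding recp_def by (rule recf_comp2)

lemma recp_const [recf_intros]: "recp (\<lambda>p x. b)"
  unfolding recp_def by (rule recf_const)

lemma recf_of_bool [recf_intros]: "recp P \<Longrightarrow> recf (\<lambda>p x. of_bool (P p x))"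
  by (simp add: recp_def)

text \<open>Both branches are total, so a case distinction can be the sum of the branches weighted
  by truth values.\<close>

lemma recf_if [recf_intros]:
  assumes "recp P" "recf F" "recf G"
  shows "recf (\<lambda>p x. if P p x then F p x else G p x)"
proof -
  have "(if b then x else y) = of_bool b * x + (1 - of_bool b) * y" for b and x y :: nat by simp
  moreover have "recf (\<lambda>p x. of_bool (P p x) * F p x + (1 - of_bool (P p x)) * G p x)"
    by (intro recf_intros assms)
  ultimately show ?thesis by simp
qed

lemma recp_less [recf_intros]:
  assumes "recf F" "recf G" shows "recp (\<lambda>p x. F p x < G p x)"
proof -
  have "of_bool (a < b) = 1 - (Suc a - b)" for a b :: nat by simp
  moreover have "recf (\<lambda>p x. 1 - (Suc (F p x) - G p x))" by (intro recf_intros assms)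
  ultimately show ?thesis by (simp only: recp_def)
qed

lemma recp_not [recf_intros]:
  assumes "recp P" shows "recp (\<lambda>p x. \<not> P p x)"
proof -
  have "recf (\<lambda>p x. 1 - of_bool (P p x))" by (intro recf_intros assms)
  moreover have "of_bool (\<not> b) = (1::nat) - of_bool b" for b by simp
  ultimately show ?thesis by (simp only: recp_def)
qed

lemma recp_conj [recf_intros]:
  assumes "recp P" "recp Q" shows "recp (\<lambda>p x. P p x \<and> Q p x)"
proof -
  have "recf (\<lambda>p x. of_bool (P p x) * of_bool (Q p x))" by (intro recf_intros assms)
  then show ?thesis by (simp only: recp_def of_bool_conj)
qed

lemma recp_disj [recf_intros]:
  assumes "recp P" "recp Q" shows "recp (\<lambda>p x. P p x \<or> Q p x)"
proof -
  have "recp (\<lambda>p x. \<not> (\<not> P p x \<and> \<not> Q p x))" by (intro recf_intros assms)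
  then show ?thesis by simp
qed

lemma recp_imp [recf_intros]:
  assumes "recp P" "recp Q" shows "recp (\<lambda>p x. P p x \<longrightarrow> Q p x)"
proof -
  have "recp (\<lambda>p x. \<not> P p x \<or> Q p x)" by (intro recf_intros assms)
  then show ?thesis by (simp only: imp_conv_disj)
qed

lemma recp_le [recf_intros]:
  assumes "recf F" "recf G" shows "recp (\<lambda>p x. F p x \<le> G p x)"
  using recp_not[OF recp_less[OF assms(2,1)]] by (simp add: not_less)

lemma recp_eq [recf_intros]:
  assumes "recf F" "recf G" shows "recp (\<lambda>p x. F p x = G p x)"
proof -
  have "recp (\<lambda>p x. F p x \<le> G p x \<and> G p x \<le> F p x)" by (intro recf_intros assms)
  then show ?thesis by (simp add: eq_iff)
qed

lemma recp_all_less [recf_intros]: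
  assumes "recp (\<lambda>p z. P p (pfst z) (psnd z))" "recf N"
  shows "recp (\<lambda>p x. \<forall>j<N p x. P p x j)"
proof -
  have "recp (\<lambda>p x. (\<Sum>j<N p x. of_bool (\<not> P p x j) :: nat) = 0)"
    by (intro recf_intros assms recp_comp2[OF assms(1)])
  moreover have "(\<Sum>j<n. of_bool (\<not> Q j) :: nat) = 0 \<longleftrightarrow> (\<forall>j<n. Q j)" for n :: nat and Q
    by (simp only: sum_eq_0_iff finite_lessThan) auto
  ultimately show ?thesis by (simp only:)
qed

lemma recp_ex_less [recf_intros]:
  assumes "recp (\<lambda>p z. P p (pfst z) (psnd z))" "recf N"
  shows "recp (\<lambda>p x. \<exists>j<N p x. P p x j)"
proof -
  have "recp (\<lambda>p x. \<not> (\<forall>j<N p x. \<not> P p x j))"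
    by (intro recf_intros assms recp_comp2[OF assms(1)])
  then show ?thesis by simp
qed

text \<open>\<open>Search\<close> stops at the first zero, so the program has to decide the negation
  of \<open>P\<close>.\<close>

lemma run_Search_Least:
  assumes c: "\<And>n. run p c (prod_encode (x, n)) (of_bool (\<not> P n))" and ex: "P m"
  shows "run p (Search c) x (LEAST n. P n)"
proof (rule run_Search)
  have "P (LEAST n. P n)" using ex by (rule LeastI)
  then show "run p c (prod_encode (x, LEAST n. P n)) 0" using c[of "LEAST n. P n"] by simp
next
  fix m assume "m < (LEAST n. P n)"
  then have "\<not> P m" by (rule not_less_Least)
  then show "run p c (prod_encode (x, m)) (Suc 0)" using c[of m] by simp
qed

lemma recf_Least [recf_intros]:
  assumes "recp (\<lambda>p z. P p (pfst z) (psnd z))" and "\<And>p x. \<exists>n. P p x n"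
  shows "recf (\<lambda>p x. LEAST n. P p x n)"
proof -
  obtain c where c: "\<And>p z. run p c z (of_bool (\<not> P p (pfst z) (psnd z)))"
    using recp_not[OF assms(1)] by (auto simp: recp_def recf_def)
  have "run p (Search c) x (LEAST n. P p x n)" for p x
  proof -
    obtain m where "P p x m" using assms(2) by blast
    from run_Search_Least[of p c x "P p x", OF _ this] c[of p "prod_encode (x, _)"]
    show ?thesis by simp
  qed
  then show ?thesis by (rule recfI)
qed

lemma recf_div [recf_intros]:
  assumes "recf F" "recf G" shows "recf (\<lambda>p x. F p x div G p x)"
proof -
  \<comment> \<open>The disjunct \<open>b = 0\<close> keeps the search total and yields
    \<open>0\<close>, the value of \<open>a div 0\<close>.\<close>
  have *: "(LEAST n. b = 0 \<or> a < Suc n * b) = a div b" for a b :: nat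
  proof (cases "b = 0")
    case False
    then have "a < Suc n * b \<longleftrightarrow> a div b \<le> n" for n
      by (metis div_less_iff_less_mult less_Suc_eq_le not_gr_zero)
    then show ?thesis using False by (simp add: Least_equality)
  qed simp
  have ex: "\<exists>n. G p x = 0 \<or> F p x < Suc n * G p x" for p x
    by (rule exI[of _ "F p x"]) (cases "G p x"; simp)
  have "recf (\<lambda>p x. LEAST n. G p x = 0 \<or> F p x < Suc n * G p x)"
    by (intro recf_intros ex recf_comp[OF assms(1)] recf_comp[OF assms(2)])
  then show ?thesis by (simp only: *)
qed

lemma recf_mod [recf_intros]:
  assumes "recf F" "recf G" shows "recf (\<lambda>p x. F p x mod G p x)"
proof -
  have "recf (\<lambda>p x. F p x - F p x div G p x * G p x)" by (intro recf_intros assms)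
  then show ?thesis by (simp add: minus_div_mult_eq_mod)
qed

lemma recp_dvd_2 [recf_intros]:
  assumes "recf F" shows "recp (\<lambda>p x. even (F p x))"
  using recp_eq[OF recf_mod[OF assms recf_const[of 2]] recf_const[of 0]]
  by (simp only: even_iff_mod_2_eq_zero)

lemma recp_bit [recf_intros]:
  assumes "recf F" "recf G" shows "recp (\<lambda>p x. bit (F p x) (G p x))"
  unfolding bit_iff_odd by (intro recf_intros assms)


subsection \<open>Rational-valued functions\<close>

text \<open>Exact rational values, unlike names of reals, can be compared by a program. Integers
  enter as differences of naturals, and \<open>Suc\<close> keeps the denominator positive.\<close>

definition rrec :: "(baire \<Rightarrow> nat \<Rightarrow> real) \<Rightarrow> bool" where
  "rrec f \<longleftrightarrow> (\<exists>a b c. recf a \<and> recf b \<and> recf c \<and>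
    (\<forall>p x. f p x = (real (a p x) - real (b p x)) / real (Suc (c p x))))"

lemma rrecI:
  assumes "recf a" "recf b" "recf c"
    and "\<And>p x. f p x = (real (a p x) - real (b p x)) / real (Suc (c p x))"
  shows "rrec f"
  using assms unfolding rrec_def by blast

lemma rrecE:
  assumes "rrec f"
  obtains a b c where "recf a" "recf b" "recf c"
    "f = (\<lambda>p x. (real (a p x) - real (b p x)) / real (Suc (c p x)))"
proof -
  from assms obtain a b c where "recf a" "recf b" "recf c"
    "\<forall>p x. f p x = (real (a p x) - real (b p x)) / real (Suc (c p x))"
    unfolding rrec_def by blast
  then show thesis by (intro that[of a b c] ext) auto
qed

lemma rrec_comp:
  assumes "rrec H" "recf F"
  shows "rrec (\<lambda>p x. H p (F p x))"
proof -
  obtain a b c where abc: "recf a" "recf b" "recf c" and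
    H: "\<And>p x. H p x = (real (a p x) - real (b p x)) / real (Suc (c p x))"
    using assms(1) unfolding rrec_def by blast
  show ?thesis
    by (rule rrecI[OF recf_comp[OF abc(1) assms(2)] recf_comp[OF abc(2) assms(2)]
      recf_comp[OF abc(3) assms(2)] H])
qed

lemma rrec_of_nat [recf_intros]:
  assumes "recf F" shows "rrec (\<lambda>p x. real (F p x))"
  by (rule rrecI[OF assms recf_const[of 0] recf_const[of 0]]) simp

lemma rrec_0 [recf_intros]: "rrec (\<lambda>p x. 0)"
  and rrec_1 [recf_intros]: "rrec (\<lambda>p x. 1)"
  and rrec_numeral [recf_intros]: "rrec (\<lambda>p x. numeral w)"
  using rrec_of_nat[OF recf_const[of 0]] rrec_of_nat[OF recf_const[of 1]]
    rrec_of_nat[OF recf_const[of "numeral w"]] by simp_all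

lemma rrec_diff [recf_intros]:
  assumes "rrec f" "rrec g" shows "rrec (\<lambda>p x. f p x - g p x)"
proof -
  from assms(1) obtain a b c where 1: "recf a" "recf b" "recf c"
    "f = (\<lambda>p x. (real (a p x) - real (b p x)) / real (Suc (c p x)))" by (rule rrecE)
  from assms(2) obtain a' b' c' where 2: "recf a'" "recf b'" "recf c'"
    "g = (\<lambda>p x. (real (a' p x) - real (b' p x)) / real (Suc (c' p x)))" by (rule rrecE)
  show ?thesis
    by (rule rrecI[of "\<lambda>p x. a p x * Suc (c' p x) + b' p x * Suc (c p x)"
          "\<lambda>p x. b p x * Suc (c' p x) + a' p x * Suc (c p x)"
          "\<lambda>p x. Suc (c p x) * Suc (c' p x) - 1"])
      (intro recf_intros 1 2, intro recf_intros 1 2, intro recf_intros 1 2,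
       simp add: 1(4) 2(4) field_simps)
qed

lemma rrec_add [recf_intros]:
  assumes "rrec f" "rrec g" shows "rrec (\<lambda>p x. f p x + g p x)"
proof -
  have "rrec (\<lambda>p x. f p x - (0 - g p x))" by (intro recf_intros assms)
  then show ?thesis by simp
qed

lemma rrec_mult [recf_intros]:
  assumes "rrec f" "rrec g" shows "rrec (\<lambda>p x. f p x * g p x)"
proof -
  from assms(1) obtain a b c where 1: "recf a" "recf b" "recf c"
    "f = (\<lambda>p x. (real (a p x) - real (b p x)) / real (Suc (c p x)))" by (rule rrecE)
  from assms(2) obtain a' b' c' where 2: "recf a'" "recf b'" "recf c'"
    "g = (\<lambda>p x. (real (a' p x) - real (b' p x)) / real (Suc (c' p x)))" by (rule rrecE)
  show ?thesis
    by (rule rrecI[of "\<lambda>p x. a p x * a' p x + b p x * b' p x"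
          "\<lambda>p x. b p x * a' p x + a p x * b' p x"
          "\<lambda>p x. Suc (c p x) * Suc (c' p x) - 1"])
      (intro recf_intros 1 2, intro recf_intros 1 2, intro recf_intros 1 2,
       simp add: 1(4) 2(4) field_simps)
qed

lemma rrec_divide_nat [recf_intros]:
  assumes "rrec f" "recf N" shows "rrec (\<lambda>p x. f p x / real (N p x))"
proof -
  from assms(1) obtain a b c where 1: "recf a" "recf b" "recf c"
    "f = (\<lambda>p x. (real (a p x) - real (b p x)) / real (Suc (c p x)))" by (rule rrecE)
  \<comment> \<open>For \<open>n = 0\<close> the quotient is \<open>0\<close>, so both numerators
    are reset, and the denominator becomes \<open>1\<close>.\<close>
  have *: "(real a - real b) / real (Suc c) / real n =
    (real (if n = 0 then 0 else a) - real (if n = 0 then 0 else b)) / real (Suc (Suc c * n - 1))" for a b c n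
    by (cases n) (auto simp: field_simps)
  show ?thesis
    by (rule rrecI[of "\<lambda>p x. if N p x = 0 then 0 else a p x"
          "\<lambda>p x. if N p x = 0 then 0 else b p x" "\<lambda>p x. Suc (c p x) * N p x - 1"])
      (intro recf_intros 1 assms, intro recf_intros 1 assms, intro recf_intros 1 assms,
       simp only: 1(4) *)
qed

lemma rrec_inverse_power [recf_intros]:
  assumes "recf N" shows "rrec (\<lambda>p x. (1 / numeral w) ^ N p x)"
proof -
  have "rrec (\<lambda>p x. 1 / real (numeral w ^ N p x))" by (intro recf_intros assms)
  then show ?thesis by (simp add: power_one_over)
qed

lemma rrec_if [recf_intros]:
  assumes "recp P" "rrec f" "rrec g" shows "rrec (\<lambda>p x. if P p x then f p x else g p x)"
proof -
  have "rrec (\<lambda>p x. real (of_bool (P p x)) * f p x + real (of_bool (\<not> P p x)) * g p x)"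
    by (intro recf_intros assms)
  moreover have "real (of_bool Q) * y + real (of_bool (\<not> Q)) * z = (if Q then y else z)" for Q y z
    by simp
  ultimately show ?thesis by (simp only:)
qed

lemma recp_rat_le [recf_intros]:
  assumes "rrec f" "rrec g" shows "recp (\<lambda>p x. f p x \<le> g p x)"
proof -
  from assms(1) obtain a b c where 1: "recf a" "recf b" "recf c"
    "f = (\<lambda>p x. (real (a p x) - real (b p x)) / real (Suc (c p x)))" by (rule rrecE)
  from assms(2) obtain a' b' c' where 2: "recf a'" "recf b'" "recf c'"
    "g = (\<lambda>p x. (real (a' p x) - real (b' p x)) / real (Suc (c' p x)))" by (rule rrecE)
  \<comment> \<open>Subtracted terms change sides, which leaves a comparison of naturals.\<close>
  have *: "(real a - real b) / real (Suc c) \<le> (real a' - real b') / real (Suc c') \<longleftrightarrow>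
    a * Suc c' + b' * Suc c \<le> a' * Suc c + b * Suc c'" (is "?l \<longleftrightarrow> ?r") for a b c a' b' c'
  proof -
    have "?l \<longleftrightarrow> (real a - real b) * real (Suc c') \<le> (real a' - real b') * real (Suc c)"
      by (simp add: divide_simps del: of_nat_Suc)
    also have "\<dots> \<longleftrightarrow> real (a * Suc c' + b' * Suc c) \<le> real (a' * Suc c + b * Suc c')"
      by (simp add: algebra_simps)
    finally show ?thesis by (simp only: of_nat_le_iff)
  qed
  show ?thesis unfolding 1(4) 2(4) * by (intro recf_intros 1 2)
qed

lemma recp_rat_less [recf_intros]:
  assumes "rrec f" "rrec g" shows "recp (\<lambda>p x. f p x < g p x)"
  using recp_not[OF recp_rat_le[OF assms(2,1)]] by (simp only: not_le)

lemma rrec_max [recf_intros]: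
  "rrec f \<Longrightarrow> rrec g \<Longrightarrow> rrec (\<lambda>p x. max (f p x) (g p x))"
  unfolding max_def by (intro recf_intros)

lemma rrec_min [recf_intros]:
  "rrec f \<Longrightarrow> rrec g \<Longrightarrow> rrec (\<lambda>p x. min (f p x) (g p x))"
  unfolding min_def by (intro recf_intros)

lemma rrec_abs [recf_intros]:
  assumes "rrec f" shows "rrec (\<lambda>p x. \<bar>f p x\<bar>)"
proof -
  have "rrec (\<lambda>p x. max (f p x) (0 - f p x))" by (intro recf_intros assms)
  moreover have "max y (0 - y) = \<bar>y\<bar>" for y :: real by simp
  ultimately show ?thesis by (simp only:)
qed

lemma recf_prod [recf_intros]:
  assumes "recf (\<lambda>p z. F p (pfst z) (psnd z))" "recf N"
  shows "recf (\<lambda>p x. \<Prod>j<N p x. F p x j)"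
proof -
  have "rec_nat 1 (\<lambda>n y. y * f n) b = (\<Prod>j<b. f j)" for b and f :: "nat \<Rightarrow> nat"
    by (induction b) auto
  moreover have "recf (\<lambda>p x. rec_nat 1 (\<lambda>n y. y * F p x n) (N p x))"
    by (intro recf_intros assms recf_comp2[OF assms(1)])
  ultimately show ?thesis by simp
qed

text \<open>The recursion scheme yields only naturals, so rationals are not added one by one: the
  product \<open>D\<close> of all denominators serves as common denominator, with cofactors
  \<open>E\<close>, and the numerators are summed as naturals.\<close>

lemma rrec_sum [recf_intros]:
  assumes "rrec (\<lambda>p z. f p (pfst z) (psnd z))" "recf N"
  shows "rrec (\<lambda>p x. \<Sum>j<N p x. f p x j)"
proof -
  obtain a b c where abc: "recf a" "recf b" "recf c" and
    "\<forall>p x. f p (pfst x) (psnd x) = (real (a p x) - real (b p x)) / real (Suc (c p x))"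
    using assms(1) unfolding rrec_def by blast
  from spec[OF spec[OF this(4)], of _ "prod_encode (_, _)"]
  have f: "f p x j = (real (a p (prod_encode (x, j))) - real (b p (prod_encode (x, j))))
      / real (Suc (c p (prod_encode (x, j))))" for p x j by simp
  define D where "D p x = (\<Prod>j<N p x. Suc (c p (prod_encode (x, j))))" for p x
  define E where "E p x j = D p x div Suc (c p (prod_encode (x, j)))" for p x j
  have D: "recf D" unfolding D_def by (intro recf_intros assms recf_comp[OF abc(3)])
  have Dvd: "Suc (c p (prod_encode (x, j))) * E p x j = D p x" if "j < N p x" for p x j
  proof -
    have "Suc (c p (prod_encode (x, j))) dvd D p x"
      unfolding D_def using that by (intro dvd_prodI) auto
    then show ?thesis unfolding E_def by (rule dvd_mult_div_cancel)
  qed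
  have E: "recf (\<lambda>p z. E p (pfst z) (psnd z))"
    unfolding E_def by (intro recf_intros recf_comp[OF D] recf_comp[OF abc(3)])
  have Dpos: "D p x > 0" for p x unfolding D_def by (intro prod_pos) simp
  have "f p x j = (real (a p (prod_encode (x, j)) * E p x j) - real (b p (prod_encode (x, j)) * E p x j))
      / real (D p x)" if "j < N p x" for p x j
  proof -
    have "E p x j > 0" using Dvd[OF that] Dpos[of p x] by (cases "E p x j") auto
    then show ?thesis
      unfolding f Dvd[OF that, symmetric]
      by (simp only: of_nat_mult left_diff_distrib[symmetric] mult.commute[of "real (Suc _)"])
        (simp add: mult_divide_mult_cancel_right del: of_nat_Suc)
  qed
  then have *: "(\<Sum>j<N p x. f p x j) =
    (real (\<Sum>j<N p x. a p (prod_encode (x, j)) * E p x j)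
      - real (\<Sum>j<N p x. b p (prod_encode (x, j)) * E p x j)) / real (Suc (D p x - 1))" for p x
    using Dpos[of p x] by (simp add: sum_divide_distrib sum_subtractf diff_divide_distrib)
  show ?thesis
    by (rule rrecI[of "\<lambda>p x. \<Sum>j<N p x. a p (prod_encode (x, j)) * E p x j"
          "\<lambda>p x. \<Sum>j<N p x. b p (prod_encode (x, j)) * E p x j" "\<lambda>p x. D p x - 1"])
      (intro recf_intros assms recf_comp[OF abc(1)] recf_comp2[OF E],
       intro recf_intros assms recf_comp[OF abc(2)] recf_comp2[OF E], intro recf_intros D, rule *)
qed

subsection \<open>Coded lists\<close>

text \<open>A nonempty list has the code \<open>Suc (prod_encode (x, c))\<close> with
  \<open>c\<close> the code of its tail, so \<open>psnd (y - 1)\<close> is the tail. The code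
  \<open>0\<close> of the empty list is a fixed point because
  \<open>prod_decode 0 = (0, 0)\<close>.\<close>

definition drop_code :: "nat \<Rightarrow> nat \<Rightarrow> nat" where
  "drop_code c j = rec_nat c (\<lambda>n y. psnd (y - 1)) j"

definition nth_code :: "nat \<Rightarrow> nat \<Rightarrow> nat" where
  "nth_code c j = pfst (drop_code c j - 1)"

lemma prod_decode_0 [simp]: "prod_decode 0 = (0, 0)"
  by (simp add: prod_decode_def prod_decode_aux.simps)

lemma list_decode_eq_Nil_iff: "list_decode c = [] \<longleftrightarrow> c = 0"
  by (metis list_decode_inverse list_encode.simps(1) list_decode.simps(1))

lemma list_decode_Suc_neq_Nil: "list_decode (Suc n) \<noteq> []"
  by (simp split: prod.split)

lemma list_decode_drop_code: "list_decode (drop_code c j) = drop j (list_decode c)"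
proof (induction j)
  case (Suc j)
  have tl: "list_decode (psnd (c - 1)) = tl (list_decode c)" for c
    by (cases c) (auto split: prod.split)
  have "drop_code c (Suc j) = psnd (drop_code c j - 1)" by (simp add: drop_code_def)
  then show ?case using Suc by (simp only: tl drop_Suc tl_drop)
qed (simp add: drop_code_def)

lemma nth_code: "j < length (list_decode c) \<Longrightarrow> nth_code c j = list_decode c ! j"
  unfolding nth_code_def
proof -
  assume j: "j < length (list_decode c)"
  have hd: "pfst (c - 1) = hd (list_decode c)" if "c \<noteq> 0" for c
    using that by (cases c) (auto split: prod.split)
  have "drop_code c j \<noteq> 0"
    using j by (metis drop_eq_Nil linorder_not_less list_decode.simps(1) list_decode_drop_code)
  then show "pfst (drop_code c j - 1) = list_decode c ! j"
    using j by (simp only: hd[OF \<open>drop_code c j \<noteq> 0\<close>] list_decode_drop_code hd_drop_conv_nth)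
qed

lemma recf_drop_code [recf_intros]:
  "recf F \<Longrightarrow> recf G \<Longrightarrow> recf (\<lambda>p x. drop_code (F p x) (G p x))"
  unfolding drop_code_def by (intro recf_intros)

lemma recf_nth_code [recf_intros]:
  "recf F \<Longrightarrow> recf G \<Longrightarrow> recf (\<lambda>p x. nth_code (F p x) (G p x))"
  unfolding nth_code_def by (intro recf_intros)

lemma recf_length [recf_intros]:
  assumes "recf F" shows "recf (\<lambda>p x. length (list_decode (F p x)))"
proof -
  have iff: "drop_code c j = 0 \<longleftrightarrow> length (list_decode c) \<le> j" for c j
    by (metis drop_eq_Nil list_decode_drop_code list_decode_eq_Nil_iff)
  have "recf (\<lambda>p x. LEAST j. drop_code (F p x) j = 0)"
    by (intro recf_intros recf_comp[OF assms]) (auto simp: iff)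
  moreover have "(LEAST j. drop_code c j = 0) = length (list_decode c)" for c
    by (rule Least_equality) (auto simp: iff)
  ultimately show ?thesis by simp
qed

lemma recf_list_encode_map_upt [recf_intros]:
  assumes "recf (\<lambda>p z. F p (pfst z) (psnd z))" "recf N"
  shows "recf (\<lambda>p x. list_encode (map (F p x) [0..<N p x]))"
proof -
  \<comment> \<open>Codes grow at the head, so the recursion runs through the indices backwards:
    after \<open>m\<close> rounds it holds the last \<open>m\<close> entries.\<close>
  have "rec_nat 0 (\<lambda>n y. Suc (prod_encode (f (b - Suc n), y))) m = list_encode (map f [b - m..<b])"
    if "m \<le> b" for b m f using that
  proof (induction m)
    case (Suc m)
    have "[b - Suc m..<b] = (b - Suc m) # [b - m..<b]"
      using Suc.prems by (subst upt_conv_Cons) (auto simp: Suc_diff_Suc)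
    then show ?case using Suc by simp
  qed simp
  from this[OF order_refl]
  have "rec_nat 0 (\<lambda>n y. Suc (prod_encode (f (b - Suc n), y))) b = list_encode (map f [0..<b])" for b f
    by simp
  moreover have "recf (\<lambda>p x. rec_nat 0 (\<lambda>n y. Suc (prod_encode (F p x (N p x - Suc n), y))) (N p x))"
    by (intro recf_intros recf_comp2[OF assms(1)] recf_comp[OF assms(2)] assms(2))
  ultimately show ?thesis by (simp only:)
qed

subsection \<open>Relative computations\<close>

text \<open>Replacing each query by the program \<open>d\<close> simulates oracle \<open>p'\<close>
  with oracle \<open>p\<close>. The parameter \<open>k\<close> lets one program serve a family of
  oracles; it travels with the input, which forces a regrouping of pairs in recursion and
  search.\<close>

lemma run_oracle_subst:
  "\<exists>c'. \<forall>p p' k x y. (\<forall>j. run p d (prod_encode (k, j)) (p' j)) \<longrightarrow>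
     run p' c x y \<longrightarrow> run p c' (prod_encode (k, x)) y"
proof (induction c)
  case Zero
  show ?case by (rule exI[of _ Zero]) (auto elim: run_elims intro: run_Zero)
next
  case Succ
  show ?case by (rule exI[of _ "Comp Succ Right"])
      (auto elim!: run_elims(2) intro!: run_Comp[OF run_Right run_Succ])
next
  case Left
  show ?case by (rule exI[of _ "Comp Left Right"])
      (auto elim!: run_elims(3) intro!: run_Comp[OF run_Right run_Left])
next
  case Right
  show ?case by (rule exI[of _ "Comp Right Right"])
      (auto elim!: run_elims(4) intro!: run_Comp[OF run_Right run_Right])
next
  case Query
  show ?case by (rule exI[of _ d]) (auto elim!: run_elims(5))
next
  case (Tuple f g)
  then obtain f' g' where
    "\<And>p p' k x y. (\<forall>j. run p d (prod_encode (k, j)) (p' j)) \<Longrightarrow> run p' f x y \<Longrightarrow> run p f' (prod_encode (k, x)) y"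
    "\<And>p p' k x y. (\<forall>j. run p d (prod_encode (k, j)) (p' j)) \<Longrightarrow> run p' g x y \<Longrightarrow> run p g' (prod_encode (k, x)) y"
    by blast
  then show ?case
    by (intro exI[of _ "Tuple f' g'"]) (auto elim!: run_elims(6) intro!: run_Tuple)
next
  case (Comp f g)
  then obtain f' g' where
    "\<And>p p' k x y. (\<forall>j. run p d (prod_encode (k, j)) (p' j)) \<Longrightarrow> run p' f x y \<Longrightarrow> run p f' (prod_encode (k, x)) y"
    "\<And>p p' k x y. (\<forall>j. run p d (prod_encode (k, j)) (p' j)) \<Longrightarrow> run p' g x y \<Longrightarrow> run p g' (prod_encode (k, x)) y"
    by blast
  then show ?case
    by (intro exI[of _ "Comp f' (Tuple Left g')"])
      (blast elim: run_elims(7) intro: run_Comp run_Tuple run_Left)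
next
  case (PrimRec f g)
  then obtain f' g' where
    f': "\<And>p p' k x y. (\<forall>j. run p d (prod_encode (k, j)) (p' j)) \<Longrightarrow> run p' f x y \<Longrightarrow> run p f' (prod_encode (k, x)) y" and
    g': "\<And>p p' k x y. (\<forall>j. run p d (prod_encode (k, j)) (p' j)) \<Longrightarrow> run p' g x y \<Longrightarrow> run p g' (prod_encode (k, x)) y"
    by blast
  \<comment> \<open>\<open>PrimRec\<close> needs the counter alone on the right, whereas
    \<open>f'\<close> and \<open>g'\<close> expect \<open>k\<close> alone on the left.\<close>
  define shift where "shift = Tuple (Comp Left Left) (Tuple (Comp Right Left) Right)"
  define unshift where "unshift = Tuple (Tuple Left (Comp Left Right)) (Comp Right Right)"
  have shift: "run p shift (prod_encode (prod_encode (k, x), n)) (prod_encode (k, prod_encode (x, n)))"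
    and unshift: "run p unshift (prod_encode (k, prod_encode (x, n))) (prod_encode (prod_encode (k, x), n))"
    for p k x n unfolding shift_def unshift_def by (blast intro: run_Tuple run_Comp run_Left run_Right)+
  have "run p (PrimRec f' (Comp g' shift)) (prod_encode (prod_encode (k, x), n)) y"
    if d: "\<forall>j. run p d (prod_encode (k, j)) (p' j)" and "run p' (PrimRec f g) (prod_encode (x, n)) y"
    for p p' k x n y
    using that(2)
  proof (induction n arbitrary: y)
    case 0
    then have "run p' f x y" by (rule run_elims(8)) auto
    then show ?case using f'[OF d] by (intro run_PrimRec_0)
  next
    case (Suc n)
    from Suc.prems obtain z where z: "run p' (PrimRec f g) (prod_encode (x, n)) z"
      "run p' g (prod_encode (x, prod_encode (n, z))) y"
      by (rule run_elims(8)) auto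
    show ?case
      by (rule run_PrimRec_Suc[OF Suc.IH[OF z(1)]], rule run_Comp[OF shift], rule g'[OF d z(2)])
  qed
  then show ?case
    by (intro exI[of _ "Comp (PrimRec f' (Comp g' shift)) unshift"])
      (metis prod.collapse prod_decode_inverse run_Comp unshift)
next
  case (Search f)
  then obtain f' where
    f': "\<And>p p' k x y. (\<forall>j. run p d (prod_encode (k, j)) (p' j)) \<Longrightarrow> run p' f x y \<Longrightarrow> run p f' (prod_encode (k, x)) y"
    by blast
  define shift where "shift = Tuple (Comp Left Left) (Tuple (Comp Right Left) Right)"
  have shift: "run p shift (prod_encode (prod_encode (k, x), n)) (prod_encode (k, prod_encode (x, n)))"
    for p k x n unfolding shift_def by (blast intro: run_Tuple run_Comp run_Left run_Right)
  show ?case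
    by (intro exI[of _ "Search (Comp f' shift)"])
      (auto elim!: run_elims(9) intro!: run_Search run_Comp[OF shift] f')
qed

section \<open>Computable maps, composition and unbounded search\<close>

lemma computableI: "(\<And>p q k. F p = Some q \<Longrightarrow> run p c k (q k)) \<Longrightarrow> computable F"
  using surj_prog_of unfolding computable_def map_le_def
  by (metis domIff machine_eq_Some_iff option.exhaust surjD)

lemma computableE:
  assumes "computable F"
  obtains c where "\<And>p q k. F p = Some q \<Longrightarrow> run p c k (q k)"
  using assms unfolding computable_def map_le_def by (metis domI machine_eq_Some_iff)

lemma computable_comp:
  assumes "computable F" "computable G"
  shows "computable (F \<circ>\<^sub>m G)"
proof -
  obtain f where f: "\<And>p q k. F p = Some q \<Longrightarrow> run p f k (q k)"
    using computableE[OF assms(1)] by blast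
  obtain g where g: "\<And>p q k. G p = Some q \<Longrightarrow> run p g k (q k)"
    using computableE[OF assms(2)] by blast
  obtain c where c: "\<And>p p' k x y. (\<forall>j. run p (Comp g Right) (prod_encode (k, j)) (p' j)) \<Longrightarrow>
     run p' f x y \<Longrightarrow> run p c (prod_encode (k, x)) y"
    using run_oracle_subst[of "Comp g Right" f] by blast
  show ?thesis
  proof (rule computableI[of _ "Comp c (Tuple Zero (Tuple Left Right))"])
    fix p q k assume "(F \<circ>\<^sub>m G) p = Some q"
    then obtain r where r: "G p = Some r" "F r = Some q"
      by (auto simp: map_comp_Some_iff)
    show "run p (Comp c (Tuple Zero (Tuple Left Right))) k (q k)"
      by (intro run_Comp[OF run_Tuple[OF run_Zero run_id]] c[of p 0 r] allI run_Comp[OF run_Right] f g r)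
  qed
qed

lemma sW_reducible_trans:
  assumes "f \<le>\<^sub>s\<^sub>W g" "g \<le>\<^sub>s\<^sub>W h"
  shows "f \<le>\<^sub>s\<^sub>W h"
proof -
  obtain H K where 1: "computable H" "computable K" "\<And>G. G \<turnstile>\<^sub>r g \<Longrightarrow> (H \<circ>\<^sub>m G \<circ>\<^sub>m K) \<turnstile>\<^sub>r f"
    using assms(1) unfolding sW_reducible_def by blast
  obtain H' K' where 2: "computable H'" "computable K'" "\<And>G. G \<turnstile>\<^sub>r h \<Longrightarrow> (H' \<circ>\<^sub>m G \<circ>\<^sub>m K') \<turnstile>\<^sub>r g"
    using assms(2) unfolding sW_reducible_def by blast
  have "((H \<circ>\<^sub>m H') \<circ>\<^sub>m G \<circ>\<^sub>m (K' \<circ>\<^sub>m K)) \<turnstile>\<^sub>r f" if "G \<turnstile>\<^sub>r h" for G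
  proof -
    have "(H \<circ>\<^sub>m H') \<circ>\<^sub>m G \<circ>\<^sub>m (K' \<circ>\<^sub>m K) = H \<circ>\<^sub>m (H' \<circ>\<^sub>m G \<circ>\<^sub>m K') \<circ>\<^sub>m K"
      by (auto simp: map_comp_def fun_eq_iff split: option.split)
    then show ?thesis using 1(3)[OF 2(3)[OF that]] by simp
  qed
  then show ?thesis
    unfolding sW_reducible_def using computable_comp[OF 1(1) 2(1)] computable_comp[OF 2(2) 1(2)] by blast
qed

lemma computable_recf:
  assumes "recf F" shows "computable (\<lambda>p. Some (F p))"
  using assms unfolding recf_def by (metis computableI option.inject)

text \<open>In contrast to \<open>recf_Least\<close>, witnesses need to exist only for the oracle at
  hand, so the result is a partial machine. All names that come from an unbounded search are
  produced in this form.\<close>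

lemma machine_search:
  assumes "recp (\<lambda>p z. P p (pfst z) (psnd z))" "recf (\<lambda>p z. F p (pfst z) (psnd z))"
  shows "\<exists>n. \<forall>p. (\<forall>k. \<exists>m. P p k m) \<longrightarrow> machine n p = Some (\<lambda>k. F p k (LEAST m. P p k m))"
proof -
  obtain c where c: "\<And>p z. run p c z (of_bool (\<not> P p (pfst z) (psnd z)))"
    using recp_not[OF assms(1)] by (auto simp: recp_def recf_def)
  obtain d where d: "\<And>p z. run p d z (F p (pfst z) (psnd z))"
    using assms(2) by (auto simp: recf_def)
  obtain n where n: "prog_of n = Comp d (Tuple (Tuple Left Right) (Search c))"
    using surj_prog_of by (metis surjD)
  have "run p (prog_of n) k (F p k (LEAST m. P p k m))" if ex: "\<exists>m. P p k m" for p k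
    unfolding n
  proof (rule run_Comp[OF run_Tuple[OF run_id]])
    obtain m where "P p k m" using ex by blast
    from run_Search_Least[of p c k "P p k", OF _ this] c[of p "prod_encode (k, _)"]
    show "run p (Search c) k (LEAST m. P p k m)" by simp
    show "run p d (prod_encode (k, LEAST m. P p k m)) (F p k (LEAST m. P p k m))"
      using d[of p "prod_encode (k, LEAST m. P p k m)"] by simp
  qed
  then show ?thesis unfolding machine_eq_Some_iff by blast
qed

section \<open>A universal program\<close>

definition state :: "nat \<Rightarrow> nat \<Rightarrow> nat \<Rightarrow> nat" where
  "state t v K = prod_encode (t, prod_encode (v, K))"

text \<open>\<open>Suc\<close> reserves \<open>0\<close> for the empty stack. Tag \<open>0\<close>
  waits for the first half of a \<open>Tuple\<close> (\<open>d\<close> holds the second program and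
  the argument), \<open>1\<close> for the second half (\<open>d\<close> is the first value),
  \<open>2\<close> for the inner part of a \<open>Comp\<close> (\<open>d\<close> is the outer
  program), \<open>3\<close> for the previous value of a \<open>PrimRec\<close> (\<open>d\<close>
  holds step program, parameter and counter), \<open>4\<close> for a \<open>Search\<close> test
  (\<open>d\<close> holds program, argument and candidate).\<close>

definition push :: "nat \<Rightarrow> nat \<Rightarrow> nat \<Rightarrow> nat" where
  "push tag d K = Suc (prod_encode (prod_encode (tag, d), K))"

text \<open>The configuration \<^term>\<open>state 0 v K\<close> passes the value \<open>v\<close> to the stack \<open>K\<close> of pending
  contexts, and \<^term>\<open>state (Suc n) v K\<close> starts program number \<open>n\<close> on the argument \<open>v\<close>.\<close>

definition return_step :: "nat \<Rightarrow> nat \<Rightarrow> nat" where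
  "return_step v K =
    (if K = 0 then state 0 v 0
     else let tag = pfst (pfst (K - 1)); d = psnd (pfst (K - 1)); L = psnd (K - 1) in
       if tag = 0 then state (Suc (pfst d)) (psnd d) (push 1 v L)
       else if tag = 1 then state 0 (prod_encode (d, v)) L
       else if tag = 2 then state (Suc d) v L
       else if tag = 3 then
         state (Suc (pfst d)) (prod_encode (pfst (psnd d), prod_encode (psnd (psnd d), v))) L
       else if v = 0 then state 0 (psnd (psnd d)) L
       else state (Suc (pfst d)) (prod_encode (pfst (psnd d), Suc (psnd (psnd d))))
         (push 4 (prod_encode (pfst d, prod_encode (pfst (psnd d), Suc (psnd (psnd d))))) L))"

definition eval_step :: "baire \<Rightarrow> nat \<Rightarrow> nat \<Rightarrow> nat \<Rightarrow> nat" where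
  "eval_step p n v K =
    (if n = 0 then state 0 0 K else if n = 1 then state 0 (Suc v) K
     else if n = 2 then state 0 (pfst v) K else if n = 3 then state 0 (psnd v) K
     else if n = 4 then state 0 (p v) K
     else let m = (n - 5) div 4; a = pfst m; b = psnd m in
       if n mod 4 = 0 then state (Suc a) v (push 0 (prod_encode (b, v)) K)
       else if n mod 4 = 1 then state (Suc b) v (push 2 a K)
       else if n mod 4 = 2 then
         (if psnd v = 0 then state (Suc a) (pfst v) K
          else state (Suc n) (prod_encode (pfst v, psnd v - 1))
            (push 3 (prod_encode (b, prod_encode (pfst v, psnd v - 1))) K))
       else state (Suc m) (prod_encode (v, 0)) (push 4 (prod_encode (m, prod_encode (v, 0))) K))"

definition step :: "baire \<Rightarrow> nat \<Rightarrow> nat" where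
  "step p s = (let t = pfst s; v = pfst (psnd s); K = psnd (psnd s) in
     if t = 0 then return_step v K else eval_step p (t - 1) v K)"

definition steps :: "baire \<Rightarrow> nat \<Rightarrow> nat \<Rightarrow> nat" where
  "steps p s N = rec_nat s (\<lambda>_ y. step p y) N"

lemma recf_step: "recf step"
  unfolding step_def return_step_def eval_step_def Let_def state_def push_def
  by (intro recf_intros)

lemma recf_steps: "recf F \<Longrightarrow> recf G \<Longrightarrow> recf (\<lambda>p x. steps p (F p x) (G p x))"
  unfolding steps_def by (intro recf_intros recf_comp[OF recf_step])

lemma step_state: "step p (state t v K) = (if t = 0 then return_step v K else eval_step p (t - 1) v K)"
  by (simp add: step_def state_def)

lemma step_eval_ge_5:
  assumes "n \<ge> 5" and m: "m = (n - 5) div 4"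
  shows "step p (state (Suc n) v K) =
      (if n mod 4 = 0 then state (Suc (pfst m)) v (push 0 (prod_encode (psnd m, v)) K)
       else if n mod 4 = 1 then state (Suc (psnd m)) v (push 2 (pfst m) K)
       else if n mod 4 = 2 then
         (if psnd v = 0 then state (Suc (pfst m)) (pfst v) K
          else state (Suc n) (prod_encode (pfst v, psnd v - 1))
            (push 3 (prod_encode (psnd m, prod_encode (pfst v, psnd v - 1))) K))
       else state (Suc m) (prod_encode (v, 0)) (push 4 (prod_encode (m, prod_encode (v, 0))) K))"
proof -
  have "n \<noteq> 0" "n \<noteq> 1" "n \<noteq> 2" "n \<noteq> 3" "n \<noteq> 4" using assms(1) by auto
  then show ?thesis
    unfolding step_state eval_step_def Let_def m by (simp only: nat.simps if_False diff_Suc_1)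
qed

lemma step_eval:
  assumes "n \<ge> 5" and "m = (n - 5) div 4"
  shows "n mod 4 = 0 \<Longrightarrow> step p (state (Suc n) v K) = state (Suc (pfst m)) v (push 0 (prod_encode (psnd m, v)) K)"
    "n mod 4 = 1 \<Longrightarrow> step p (state (Suc n) v K) = state (Suc (psnd m)) v (push 2 (pfst m) K)"
    "n mod 4 = 2 \<Longrightarrow> step p (state (Suc n) (prod_encode (x, 0)) K) = state (Suc (pfst m)) x K"
    "n mod 4 = 2 \<Longrightarrow> step p (state (Suc n) (prod_encode (x, Suc j)) K) =
      state (Suc n) (prod_encode (x, j)) (push 3 (prod_encode (psnd m, prod_encode (x, j))) K)"
    "n mod 4 = 3 \<Longrightarrow> step p (state (Suc n) v K) =
      state (Suc m) (prod_encode (v, 0)) (push 4 (prod_encode (m, prod_encode (v, 0))) K)"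
  by (simp_all add: step_eval_ge_5[OF assms])

lemma step_return_push:
  "step p (state 0 v (push 0 d K)) = state (Suc (pfst d)) (psnd d) (push 1 v K)"
  "step p (state 0 v (push 1 d K)) = state 0 (prod_encode (d, v)) K"
  "step p (state 0 v (push 2 d K)) = state (Suc d) v K"
  "step p (state 0 v (push 3 d K)) =
    state (Suc (pfst d)) (prod_encode (pfst (psnd d), prod_encode (psnd (psnd d), v))) K"
  "step p (state 0 0 (push 4 d K)) = state 0 (psnd (psnd d)) K"
  "step p (state 0 (Suc v) (push 4 d K)) =
    state (Suc (pfst d)) (prod_encode (pfst (psnd d), Suc (psnd (psnd d))))
      (push 4 (prod_encode (pfst d, prod_encode (pfst (psnd d), Suc (psnd (psnd d))))) K)"
  by (simp_all add: step_state return_step_def push_def)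

lemma steps_0: "steps p s 0 = s" and steps_Suc: "steps p s (Suc N) = step p (steps p s N)"
  by (simp_all add: steps_def)

lemma steps_add: "steps p s (M + N) = steps p (steps p s M) N"
  by (induction N) (simp_all add: steps_0 steps_Suc)

definition reaches :: "baire \<Rightarrow> nat \<Rightarrow> nat \<Rightarrow> bool" where
  "reaches p s s' \<longleftrightarrow> (\<exists>N. steps p s N = s')"

lemma reaches_step: "step p s = s' \<Longrightarrow> reaches p s s'"
  unfolding reaches_def by (rule exI[of _ 1]) (simp add: steps_def)

lemma reaches_trans: "reaches p s s' \<Longrightarrow> reaches p s' s'' \<Longrightarrow> reaches p s s''"
  unfolding reaches_def by (metis steps_add)

lemma prog_of_case:
  "case prog_of n of Zero \<Rightarrow> n = 0 | Succ \<Rightarrow> n = 1 | Left \<Rightarrow> n = 2 | Right \<Rightarrow> n = 3 | Query \<Rightarrow> n = 4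
    | Tuple f g \<Rightarrow> n \<ge> 5 \<and> n mod 4 = 0 \<and> prog_of (pfst ((n - 5) div 4)) = f \<and> prog_of (psnd ((n - 5) div 4)) = g
    | Comp f g \<Rightarrow> n \<ge> 5 \<and> n mod 4 = 1 \<and> prog_of (pfst ((n - 5) div 4)) = f \<and> prog_of (psnd ((n - 5) div 4)) = g
    | PrimRec f g \<Rightarrow> n \<ge> 5 \<and> n mod 4 = 2 \<and> prog_of (pfst ((n - 5) div 4)) = f \<and> prog_of (psnd ((n - 5) div 4)) = g
    | Search f \<Rightarrow> n \<ge> 5 \<and> n mod 4 = 3 \<and> prog_of ((n - 5) div 4) = f"
proof -
  have big: "prog_of n = (let m = (n - 5) div 4 in
       if n mod 4 = 0 then Tuple (prog_of (pfst m)) (prog_of (psnd m))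
       else if n mod 4 = 1 then Comp (prog_of (pfst m)) (prog_of (psnd m))
       else if n mod 4 = 2 then PrimRec (prog_of (pfst m)) (prog_of (psnd m))
       else Search (prog_of m))" if "n \<ge> 5"
    using that by (subst prog_of.simps) (simp add: Let_def)
  have small: "prog_of 0 = Zero" "prog_of 1 = Succ" "prog_of 2 = Left" "prog_of 3 = Right"
    "prog_of 4 = Query" "prog_of (Suc 0) = Succ"
    by (subst prog_of.simps, simp)+
  have "n = 0 \<or> n = 1 \<or> n = 2 \<or> n = 3 \<or> n = 4 \<or> n \<ge> 5"
    and "n mod 4 = 0 \<or> n mod 4 = 1 \<or> n mod 4 = 2 \<or> n mod 4 = 3"
    by presburger+
  then consider "n = 0" | "n = 1" | "n = 2" | "n = 3" | "n = 4" | "n \<ge> 5" "n mod 4 = 0"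
    | "n \<ge> 5" "n mod 4 = 1" | "n \<ge> 5" "n mod 4 = 2" | "n \<ge> 5" "n mod 4 = 3"
    by metis
  then show ?thesis
    by cases (simp_all add: small, simp_all add: big Let_def)
qed

text \<open>Subcomputations run on top of pushed contexts, so the induction has to cover all stacks
  \<open>K\<close>; it covers all codes \<open>n\<close> because subprograms are given by their
  numbers.\<close>

lemma reaches_run:
  assumes "run p c x y" "prog_of n = c"
  shows "reaches p (state (Suc n) x K) (state 0 y K)"
  using assms
proof (induction arbitrary: n K rule: run.induct)
  case (run_Zero x)
  have "n = 0" using prog_of_case[of n] unfolding run_Zero by simp
  then show ?case by (intro reaches_step) (simp add: step_state eval_step_def)
next
  case (run_Succ x)
  have "n = 1" using prog_of_case[of n] unfolding run_Succ by simp
  then show ?case by (intro reaches_step) (simp add: step_state eval_step_def)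
next
  case (run_Left x y)
  have "n = 2" using prog_of_case[of n] unfolding run_Left by simp
  then show ?case by (intro reaches_step) (simp add: step_state eval_step_def)
next
  case (run_Right x y)
  have "n = 3" using prog_of_case[of n] unfolding run_Right by simp
  then show ?case by (intro reaches_step) (simp add: step_state eval_step_def)
next
  case (run_Query x)
  have "n = 4" using prog_of_case[of n] unfolding run_Query by simp
  then show ?case by (intro reaches_step) (simp add: step_state eval_step_def)
next
  case (run_Tuple f x a g b)
  define m where "m = (n - 5) div 4"
  have n: "n \<ge> 5" "n mod 4 = 0" "prog_of (pfst m) = f" "prog_of (psnd m) = g"
    using prog_of_case[of n] unfolding run_Tuple.prems by (auto simp: m_def)
  have s1: "step p (state (Suc n) x K) = state (Suc (pfst m)) x (push 0 (prod_encode (psnd m, x)) K)"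
    by (rule step_eval(1)[OF n(1) m_def n(2)])
  have s2: "step p (state 0 a (push 0 (prod_encode (psnd m, x)) K)) =
      state (Suc (psnd m)) x (push 1 a K)"
    by (simp add: step_return_push)
  have s3: "step p (state 0 b (push 1 a K)) = state 0 (prod_encode (a, b)) K"
    by (rule step_return_push)
  show ?case
    using reaches_trans[OF reaches_step[OF s1] reaches_trans[OF run_Tuple.IH(1)[OF n(3)]
      reaches_trans[OF reaches_step[OF s2] reaches_trans[OF run_Tuple.IH(2)[OF n(4)] reaches_step[OF s3]]]]] .
next
  case (run_Comp g x y f z)
  define m where "m = (n - 5) div 4"
  have n: "n \<ge> 5" "n mod 4 = 1" "prog_of (pfst m) = f" "prog_of (psnd m) = g"
    using prog_of_case[of n] unfolding run_Comp.prems by (auto simp: m_def)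
  have s1: "step p (state (Suc n) x K) = state (Suc (psnd m)) x (push 2 (pfst m) K)"
    by (rule step_eval(2)[OF n(1) m_def n(2)])
  have s2: "step p (state 0 y (push 2 (pfst m) K)) = state (Suc (pfst m)) y K"
    by (simp add: step_return_push)
  show ?case
    using reaches_trans[OF reaches_step[OF s1] reaches_trans[OF run_Comp.IH(1)[OF n(4)]
      reaches_trans[OF reaches_step[OF s2] run_Comp.IH(2)[OF n(3)]]]] .
next
  case (run_PrimRec_0 f x y g)
  define m where "m = (n - 5) div 4"
  have n: "n \<ge> 5" "n mod 4 = 2" "prog_of (pfst m) = f"
    using prog_of_case[of n] unfolding run_PrimRec_0.prems by (auto simp: m_def)
  have s1: "step p (state (Suc n) (prod_encode (x, 0)) K) = state (Suc (pfst m)) x K"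
    by (rule step_eval(3)[OF n(1) m_def n(2)])
  show ?case
    using reaches_trans[OF reaches_step[OF s1] run_PrimRec_0.IH[OF n(3)]] .
next
  case (run_PrimRec_Suc f g x j y z)
  define m where "m = (n - 5) div 4"
  have n: "n \<ge> 5" "n mod 4 = 2" "prog_of (psnd m) = g"
    using prog_of_case[of n] unfolding run_PrimRec_Suc.prems by (auto simp: m_def)
  have s1: "step p (state (Suc n) (prod_encode (x, Suc j)) K) =
      state (Suc n) (prod_encode (x, j)) (push 3 (prod_encode (psnd m, prod_encode (x, j))) K)"
    by (rule step_eval(4)[OF n(1) m_def n(2)])
  have s2: "step p (state 0 y (push 3 (prod_encode (psnd m, prod_encode (x, j))) K)) =
      state (Suc (psnd m)) (prod_encode (x, prod_encode (j, y))) K"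
    by (simp add: step_return_push)
  show ?case
    using reaches_trans[OF reaches_step[OF s1] reaches_trans[OF run_PrimRec_Suc.IH(1)[OF run_PrimRec_Suc.prems]
      reaches_trans[OF reaches_step[OF s2] run_PrimRec_Suc.IH(2)[OF n(3)]]]] .
next
  case (run_Search f x i h)
  define m where "m = (n - 5) div 4"
  have n: "n \<ge> 5" "n mod 4 = 3" "prog_of m = f"
    using prog_of_case[of n] unfolding run_Search.prems by (auto simp: m_def)
  define S where "S j = state (Suc m) (prod_encode (x, j)) (push 4 (prod_encode (m, prod_encode (x, j))) K)" for j
  have "step p (state (Suc n) x K) = S 0"
    unfolding S_def by (rule step_eval(5)[OF n(1) m_def n(2)])
  then have start: "reaches p (state (Suc n) x K) (S 0)" by (rule reaches_step)
  have loop: "reaches p (S 0) (S j)" if "j \<le> i" for j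
    using that
  proof (induction j)
    case 0
    show ?case by (auto simp: reaches_def intro: exI[of _ 0] steps_0)
  next
    case (Suc j)
    have run_j: "reaches p (S j) (state 0 (Suc (h j)) (push 4 (prod_encode (m, prod_encode (x, j))) K))"
      unfolding S_def using Suc.prems by (intro run_Search.IH n) auto
    have "step p (state 0 (Suc (h j)) (push 4 (prod_encode (m, prod_encode (x, j))) K)) = S (Suc j)"
      by (simp add: step_return_push S_def)
    from reaches_trans[OF Suc.IH[OF Suc_leD[OF Suc.prems]] reaches_trans[OF run_j reaches_step[OF this]]]
    show ?case .
  qed
  have last: "reaches p (S i) (state 0 0 (push 4 (prod_encode (m, prod_encode (x, i))) K))"
    unfolding S_def by (intro run_Search.IH n)
  have "step p (state 0 0 (push 4 (prod_encode (m, prod_encode (x, i))) K)) = state 0 i K"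
    by (simp add: step_return_push)
  from reaches_trans[OF start reaches_trans[OF loop[OF order_refl] reaches_trans[OF last reaches_step[OF this]]]]
  show ?case .
qed

text \<open>Names of functions contain machine numbers as data, so evaluating them takes one program
  that accepts \<open>n\<close> as input. It searches for a halting time of the abstract machine and
  reads off the value.\<close>

lemma universal_program:
  obtains u where "\<And>p n x y. run p (prog_of n) x y \<Longrightarrow> run p u (prod_encode (n, x)) y"
proof -
  define halted where "halted s \<longleftrightarrow> pfst s = 0 \<and> psnd (psnd s) = 0" for s
  define st where "st p z N = steps p (state (Suc (pfst z)) (psnd z) 0) N" for p z N
  have st: "recf (\<lambda>p x. st p (F p x) (G p x))" if "recf F" "recf G" for F G
    unfolding st_def state_def by (intro recf_intros recf_steps that)
  have "recp (\<lambda>p z. halted (st p (pfst z) (psnd z)))"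
    unfolding halted_def by (intro recf_intros st)
  then obtain c where c: "\<And>p z. run p c z (of_bool (\<not> halted (st p (pfst z) (psnd z))))"
    using recp_not[of "\<lambda>p z. halted (st p (pfst z) (psnd z))"] by (auto simp: recp_def recf_def)
  have "recf (\<lambda>p z. pfst (psnd (st p (pfst z) (psnd z))))" by (intro recf_intros st)
  then obtain d where d: "\<And>p z. run p d z (pfst (psnd (st p (pfst z) (psnd z))))"
    by (auto simp: recf_def)
  have "run p (Comp d (Tuple (Tuple Left Right) (Search c))) (prod_encode (n, x)) y"
    if r: "run p (prog_of n) x y" for p n x y
  proof (rule run_Comp[OF run_Tuple[OF run_id]])
    let ?st = "st p (prod_encode (n, x))"
    obtain N where N: "?st N = state 0 y 0"
      using reaches_run[OF r refl] unfolding reaches_def st_def by auto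
    have ex: "halted (?st N)" by (simp add: N halted_def state_def)
    \<comment> \<open>A halted configuration is a fixed point of \<open>step\<close>, so the least
      halting time shows the same value as the time \<open>N\<close>.\<close>
    have stay: "?st (M + k) = ?st M" if "halted (?st M)" for M k
    proof (induction k)
      case (Suc k)
      have "step p s = s" if "halted s" for s
        using that by (auto simp: halted_def step_def Let_def return_step_def state_def)
          (metis prod.collapse prod_decode_inverse)
      then show ?case using Suc that by (simp add: st_def steps_Suc)
    qed simp
    define M where "M = (LEAST N. halted (?st N))"
    have "halted (?st M)" "M \<le> N" unfolding M_def using ex by (auto intro: LeastI Least_le)
    then have M: "?st M = state 0 y 0" using stay[of M "N - M"] N by simp
    show "run p (Search c) (prod_encode (n, x)) M"
      unfolding M_def
      by (rule run_Search_Least[of _ _ _ "\<lambda>N. halted (?st N)" N])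
        (use c[of p "prod_encode (prod_encode (n, x), _)"] ex in simp_all)
    show "run p d (prod_encode (prod_encode (n, x), M)) y"
      using d[of p "prod_encode (prod_encode (n, x), M)"] by (simp add: M) (simp add: state_def)
  qed
  then show thesis by (rule that)
qed

text \<open>Evaluates the function named by \<open>tagged n p\<close> at the points with names
  \<open>Q k\<close>, uniformly in \<open>k\<close>. The number \<open>n\<close> is found as the
  position of the first nonzero entry of the name.\<close>

lemma run_evaluation:
  assumes Q: "recf (\<lambda>_ z. Q (pfst z) (psnd z))"
  obtains c where "\<And>n p k q x. machine n (interleave p (Q k)) = Some q \<Longrightarrow>
    run (tagged n p) c (prod_encode (k, x)) (q x)"
proof -
  obtain u where u: "\<And>p n x y. run p (prog_of n) x y \<Longrightarrow> run p u (prod_encode (n, x)) y"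
    using universal_program by blast
  \<comment> \<open>The oracle \<open>interleave p (Q k)\<close> rebuilt from the name, in which
    \<open>p\<close> starts at position \<open>Suc n\<close>. The parameter \<open>l\<close> codes
    the pair of \<open>n\<close> and \<open>k\<close>.\<close>
  define R where "R r l j = (if even j then r (j div 2 + Suc (pfst l)) else Q (psnd l) (j div 2))"
    for r :: baire and l j
  have "recf (\<lambda>p z. R p (pfst z) (psnd z))"
    unfolding R_def by (intro recf_intros recf_comp2[OF Q])
  then obtain d where d: "\<And>p z. run p d z (R p (pfst z) (psnd z))" by (auto simp: recf_def)
  obtain c' where c': "\<And>p p' k x y. (\<forall>j. run p d (prod_encode (k, j)) (p' j)) \<Longrightarrow>
     run p' u x y \<Longrightarrow> run p c' (prod_encode (k, x)) y"
    using run_oracle_subst[of d u] by blast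
  have "recp (\<lambda>p z. p (psnd z) = 0)" by (intro recf_intros)
  then obtain e where e: "\<And>p z. run p e z (of_bool (p (psnd z) = 0))"
    unfolding recp_def recf_def by blast
  have "recf (\<lambda>p w. prod_encode (prod_encode (psnd w, pfst (pfst w)), prod_encode (psnd w, psnd (pfst w))))"
    by (intro recf_intros)
  then obtain g where g: "\<And>p w. run p g w
      (prod_encode (prod_encode (psnd w, pfst (pfst w)), prod_encode (psnd w, psnd (pfst w))))"
    by (auto simp: recf_def)
  have "run (tagged n p) (Comp c' (Comp g (Tuple (Tuple Left Right) (Search e)))) (prod_encode (k, x)) (q x)"
    if m: "machine n (interleave p (Q k)) = Some q" for n p k q x
  proof -
    have "(LEAST j. tagged n p j \<noteq> 0) = n"
      by (rule Least_equality) (auto simp: tagged_def not_less[symmetric])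
    then have search: "run (tagged n p) (Search e) z n" for z
      using run_Search_Least[of "tagged n p" e z "\<lambda>j. tagged n p j \<noteq> 0" n]
        e[of "tagged n p" "prod_encode (z, _)"] by (simp add: tagged_def)
    have "R (tagged n p) (prod_encode (n, k)) = interleave p (Q k)"
      by (auto simp: R_def tagged_def interleave_def fun_eq_iff)
    then have "run (tagged n p) d (prod_encode (prod_encode (n, k), j)) (interleave p (Q k) j)" for j
      using d[of "tagged n p" "prod_encode (prod_encode (n, k), j)"] by simp
    moreover have "run (interleave p (Q k)) u (prod_encode (n, x)) (q x)"
      using m by (intro u) (simp add: machine_eq_Some_iff)
    ultimately have "run (tagged n p) c' (prod_encode (prod_encode (n, k), prod_encode (n, x))) (q x)"
      by (intro c') auto
    moreover have "run (tagged n p) (Comp g (Tuple (Tuple Left Right) (Search e))) (prod_encode (k, x))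
        (prod_encode (prod_encode (n, k), prod_encode (n, x)))"
      by (rule run_Comp[OF run_Tuple[OF run_id search]])
        (use g[of "tagged n p" "prod_encode (prod_encode (k, x), n)"] in simp)
    ultimately show ?thesis by (rule run_Comp[rotated])
  qed
  then show thesis by (rule that)
qed

section \<open>Presented metric spaces\<close>

lemma pfun_eq_Some_iff:
  assumes "\<And>x y. R p x \<Longrightarrow> R p y \<Longrightarrow> x = y"
  shows "pfun R p = Some x \<longleftrightarrow> R p x"
  unfolding pfun_def using assms by (auto intro!: the_equality intro: theI2)

locale separable_cms =
  fixes S :: "'a cms"
  assumes metric: "Metric_space (points S) (metr S)"
    and dense_points [simp]: "dense S i \<in> points S"
    and ex_dense: "x \<in> points S \<Longrightarrow> e > 0 \<Longrightarrow> \<exists>i. metr S x (dense S i) < e"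
begin

sublocale Metric_space "points S" "metr S"
  by (rule metric)

lemma topology_cms: "topology_cms S = mtopology"
  by (simp add: topology_cms_def)

lemma openin_subset_points: "openin mtopology U \<Longrightarrow> U \<subseteq> points S"
  using openin_subset by fastforce

lemma space_borel_cms [simp]: "space (borel_cms S) = points S"
  unfolding borel_cms_def
  by (rule space_measure_of) (use openin_subset_points in \<open>auto simp: topology_cms\<close>)

lemma sets_borel_cms: "sets (borel_cms S) = sigma_sets (points S) {U. openin (topology_cms S) U}"
  unfolding borel_cms_def
  by (rule sets_measure_of) (use openin_subset_points in \<open>auto simp: topology_cms\<close>)

lemma sets_borel_cms_subset: "A \<in> sets (borel_cms S) \<Longrightarrow> A \<subseteq> points S"
  using sets.sets_into_space by fastforce

lemma open_in_borel: "openin mtopology U \<Longrightarrow> U \<in> sets (borel_cms S)"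
  unfolding sets_borel_cms topology_cms by (rule sigma_sets.Basic) simp

lemma measurable_borel_cms:
  assumes "f \<in> space M \<rightarrow> points S" and "\<And>U. openin mtopology U \<Longrightarrow> f -` U \<inter> space M \<in> sets M"
  shows "f \<in> M \<rightarrow>\<^sub>M borel_cms S"
  unfolding borel_cms_def
  using assms openin_subset_points
  by (intro measurable_sigma_sets[OF sets_measure_of]) (auto simp: topology_cms)

lemma openin_neighbourhood: "A \<subseteq> points S \<Longrightarrow> openin mtopology (neighbourhood S e A)"
proof -
  assume A: "A \<subseteq> points S"
  have "neighbourhood S e A = (\<Union>x\<in>A. mball x e)"
    using A by (fastforce simp: neighbourhood_def)
  then show ?thesis by auto
qed

lemma neighbourhood_borel [simp]: "A \<in> sets (borel_cms S) \<Longrightarrow> neighbourhood S e A \<in> sets (borel_cms S)"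
  using open_in_borel[OF openin_neighbourhood[OF sets_borel_cms_subset]] .

lemma subset_neighbourhood: "A \<subseteq> points S \<Longrightarrow> e > 0 \<Longrightarrow> A \<subseteq> neighbourhood S e A"
  by (auto simp: neighbourhood_def intro!: bexI)

lemma neighbourhood_mono: "d \<le> e \<Longrightarrow> neighbourhood S d A \<subseteq> neighbourhood S e A"
  by (force simp: neighbourhood_def)

lemma neighbourhood_add:
  assumes "A \<subseteq> points S"
  shows "neighbourhood S d (neighbourhood S e A) \<subseteq> neighbourhood S (e + d) A"
proof
  fix z assume "z \<in> neighbourhood S d (neighbourhood S e A)"
  then obtain x y where "z \<in> points S" "y \<in> points S" "x \<in> A" "metr S x y < e" "metr S y z < d"
    by (auto simp: neighbourhood_def)
  moreover have "metr S x z \<le> metr S x y + metr S y z"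
    using calculation assms by (intro triangle) auto
  ultimately show "z \<in> neighbourhood S (e + d) A" by (force simp: neighbourhood_def)
qed

lemma prob_measuresD:
  assumes "\<mu> \<in> prob_measures S"
  shows "prob_space \<mu>" "sets \<mu> = sets (borel_cms S)" "space \<mu> = points S"
  using assms sets_eq_imp_space_eq[of \<mu> "borel_cms S"] by (auto simp: prob_measures_def)

lemma measure_mono_prob:
  assumes "\<mu> \<in> prob_measures S" "A \<subseteq> B" "B \<in> sets (borel_cms S)"
  shows "measure \<mu> A \<le> measure \<mu> B"
proof -
  interpret prob_space \<mu> using prob_measuresD(1)[OF assms(1)] .
  show ?thesis using assms by (intro finite_measure_mono) (auto simp: prob_measuresD)
qed

subsection \<open>The Prokhorov metric\<close>

text \<open>Half of the Prokhorov condition; between probability measures the other half follows by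
  \<open>close_sym\<close>.\<close>

definition close :: "real \<Rightarrow> 'a measure \<Rightarrow> 'a measure \<Rightarrow> bool" where
  "close e \<mu> \<nu> \<longleftrightarrow> (\<forall>A \<in> sets (borel_cms S). measure \<mu> A \<le> measure \<nu> (neighbourhood S e A) + e)"

lemma close_mono:
  assumes "close d \<mu> \<nu>" "d \<le> e" "\<nu> \<in> prob_measures S"
  shows "close e \<mu> \<nu>"
  unfolding close_def
proof
  fix A assume A: "A \<in> sets (borel_cms S)"
  have "measure \<mu> A \<le> measure \<nu> (neighbourhood S d A) + d" using assms(1) A by (auto simp: close_def)
  also have "measure \<nu> (neighbourhood S d A) \<le> measure \<nu> (neighbourhood S e A)"
    using A assms by (intro measure_mono_prob neighbourhood_mono) auto
  finally show "measure \<mu> A \<le> measure \<nu> (neighbourhood S e A) + e" using assms(2) by simp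
qed

text \<open>Apply the inequality to the complement of the \<open>e\<close>-neighbourhood of
  \<open>A\<close>: no point at distance less than \<open>e\<close> from it lies in
  \<open>A\<close>, and passing to complements turns the inequality around.\<close>

lemma close_sym:
  assumes "close e \<mu> \<nu>" and \<mu>: "\<mu> \<in> prob_measures S" and \<nu>: "\<nu> \<in> prob_measures S"
  shows "close e \<nu> \<mu>"
  unfolding close_def
proof
  interpret M: prob_space \<mu> using prob_measuresD(1)[OF \<mu>] .
  interpret N: prob_space \<nu> using prob_measuresD(1)[OF \<nu>] .
  fix A assume A: "A \<in> sets (borel_cms S)"
  let ?B = "points S - neighbourhood S e A"
  have B: "?B \<in> sets (borel_cms S)"
    using A by (metis neighbourhood_borel sets.compl_sets space_borel_cms)
  have "measure \<mu> ?B \<le> measure \<nu> (neighbourhood S e ?B) + e"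
    using assms(1) B by (auto simp: close_def)
  also have "measure \<nu> (neighbourhood S e ?B) \<le> measure \<nu> (points S - A)"
  proof (intro measure_mono_prob \<nu>)
    show "neighbourhood S e ?B \<subseteq> points S - A"
      using sets_borel_cms_subset[OF A] by (auto simp: neighbourhood_def) (metis commute)
    show "points S - A \<in> sets (borel_cms S)" using A by (metis sets.compl_sets space_borel_cms)
  qed
  also have "measure \<nu> (points S - A) = 1 - measure \<nu> A"
    using N.prob_compl[of A] A by (simp add: prob_measuresD[OF \<nu>])
  also have "measure \<mu> ?B = 1 - measure \<mu> (neighbourhood S e A)"
    using M.prob_compl[of "neighbourhood S e A"] A by (simp add: prob_measuresD[OF \<mu>])
  finally show "measure \<nu> A \<le> measure \<mu> (neighbourhood S e A) + e" by simp
qed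

lemma close_trans:
  assumes "close d \<mu> \<nu>" "close e \<nu> \<rho>" "\<rho> \<in> prob_measures S"
  shows "close (d + e) \<mu> \<rho>"
  unfolding close_def
proof
  fix A assume A: "A \<in> sets (borel_cms S)"
  have "measure \<mu> A \<le> measure \<nu> (neighbourhood S d A) + d" using assms(1) A by (auto simp: close_def)
  also have "measure \<nu> (neighbourhood S d A) \<le> measure \<rho> (neighbourhood S e (neighbourhood S d A)) + e"
    using assms(2) A by (auto simp: close_def)
  also have "measure \<rho> (neighbourhood S e (neighbourhood S d A)) \<le> measure \<rho> (neighbourhood S (d + e) A)"
    using A assms by (intro measure_mono_prob neighbourhood_add sets_borel_cms_subset) auto
  finally show "measure \<mu> A \<le> measure \<rho> (neighbourhood S (d + e) A) + (d + e)" by simp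
qed

lemma prokhorov_eq: "prokhorov S \<mu> \<nu> = Inf {e. e > 0 \<and> close e \<mu> \<nu> \<and> close e \<nu> \<mu>}"
  unfolding prokhorov_def close_def by (rule arg_cong[of _ _ Inf]) auto

lemma close_1: "\<mu> \<in> prob_measures S \<Longrightarrow> close 1 \<mu> \<nu>"
  unfolding close_def by (meson add_increasing measure_nonneg prob_measuresD(1) prob_space.prob_le_1)

lemma prokhorov_le:
  assumes "close e \<mu> \<nu>" "e > 0" "\<mu> \<in> prob_measures S" "\<nu> \<in> prob_measures S"
  shows "prokhorov S \<mu> \<nu> \<le> e"
  unfolding prokhorov_eq
  by (rule cInf_lower) (auto intro!: bdd_belowI[of _ 0] assms close_sym[OF assms(1)])

lemma prokhorov_less_imp_close:
  assumes "prokhorov S \<mu> \<nu> < e" "\<mu> \<in> prob_measures S" "\<nu> \<in> prob_measures S"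
  shows "close e \<mu> \<nu>" "e > 0"
proof -
  have "\<exists>d\<in>{e. e > 0 \<and> close e \<mu> \<nu> \<and> close e \<nu> \<mu>}. d < e"
    using assms(1) unfolding prokhorov_eq
    by (subst (asm) cInf_less_iff) (auto intro!: exI[of _ 1] bdd_belowI[of _ 0] close_1 assms)
  then show "close e \<mu> \<nu>" "e > 0" using close_mono assms(3) by (auto dest: less_imp_le)
qed

text \<open>A closed set is the intersection of its neighbourhoods, so continuity from above removes
  the enlargement in the limit.\<close>

lemma measure_closed_le:
  assumes cl: "\<And>e. e > 0 \<Longrightarrow> close e \<mu> \<nu>" and C: "closedin mtopology C"
    and \<mu>: "\<mu> \<in> prob_measures S" and \<nu>: "\<nu> \<in> prob_measures S"
  shows "measure \<mu> C \<le> measure \<nu> C"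
proof -
  interpret N: prob_space \<nu> using prob_measuresD(1)[OF \<nu>] .
  have CS: "C \<subseteq> points S" using closedin_subset[OF C] by simp
  have Cb: "C \<in> sets (borel_cms S)"
  proof -
    have "points S - (points S - C) \<in> sets (borel_cms S)"
      using C by (metis closedin_def open_in_borel sets.compl_sets space_borel_cms topspace_mtopology)
    then show ?thesis using CS by (simp add: double_diff)
  qed
  define E where "E n = neighbourhood S (inverse (real (Suc n))) C" for n
  have "(\<Inter>n. E n) = C"
  proof
    show "C \<subseteq> (\<Inter>n. E n)" unfolding E_def using subset_neighbourhood[OF CS] by (simp add: INT_greatest)
    show "(\<Inter>n. E n) \<subseteq> C"
    proof
      fix y assume y: "y \<in> (\<Inter>n. E n)"
      then have yS: "y \<in> points S" by (auto simp: E_def neighbourhood_def)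
      show "y \<in> C"
      proof (rule ccontr)
        assume "y \<notin> C"
        then obtain r where r: "r > 0" "mball y r \<subseteq> points S - C"
          using C yS unfolding closedin_def topspace_mtopology by (meson DiffI openin_mtopology)
        obtain n where "inverse (real (Suc n)) < r" using reals_Archimedean[OF r(1)] by blast
        moreover obtain x where "x \<in> C" "metr S x y < inverse (real (Suc n))"
          using y by (auto simp: E_def neighbourhood_def)
        ultimately have "x \<in> mball y r" using CS yS by (auto simp: commute)
        then show False using r \<open>x \<in> C\<close> by auto
      qed
    qed
  qed
  moreover have "(\<lambda>n. measure \<nu> (E n)) \<longlonglongrightarrow> measure \<nu> (\<Inter>n. E n)"
  proof (rule N.finite_Lim_measure_decseq)
    show "range E \<subseteq> sets \<nu>" using Cb by (auto simp: E_def prob_measuresD[OF \<nu>])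
    show "decseq E" unfolding E_def
      by (intro antimonoI neighbourhood_mono) (simp add: field_simps)
  qed
  moreover have "(\<lambda>n. inverse (real (Suc n))) \<longlonglongrightarrow> 0" by (rule LIMSEQ_inverse_real_of_nat)
  ultimately have "(\<lambda>n. measure \<nu> (E n) + inverse (real (Suc n))) \<longlonglongrightarrow> measure \<nu> C + 0"
    by (metis tendsto_add)
  moreover have "measure \<mu> C \<le> measure \<nu> (E n) + inverse (real (Suc n))" for n
    using cl[of "inverse (real (Suc n))"] Cb by (auto simp: close_def E_def)
  ultimately show ?thesis by (intro LIMSEQ_le_const[of _ "measure \<nu> C"]) auto
qed

text \<open>Closed sets, hence open sets, get equal measure, and the open sets are an
  intersection-stable generator.\<close>

lemma prob_measures_eqI:
  assumes \<mu>: "\<mu> \<in> prob_measures S" and \<nu>: "\<nu> \<in> prob_measures S"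
    and cl: "\<And>e. e > 0 \<Longrightarrow> close e \<mu> \<nu>"
  shows "\<mu> = \<nu>"
proof -
  interpret M: prob_space \<mu> using prob_measuresD(1)[OF \<mu>] .
  interpret N: prob_space \<nu> using prob_measuresD(1)[OF \<nu>] .
  have eq: "measure \<mu> C = measure \<nu> C" if "closedin mtopology C" for C
    using measure_closed_le[OF cl that \<mu> \<nu>] measure_closed_le[OF close_sym[OF cl \<mu> \<nu>] that \<nu> \<mu>] by simp
  have opn: "emeasure \<mu> U = emeasure \<nu> U" if U: "openin mtopology U" for U
  proof -
    have "measure \<mu> (points S - U) = measure \<nu> (points S - U)"
      using U by (intro eq) (metis closedin_diff closedin_topspace topspace_mtopology)
    then have "measure \<mu> U = measure \<nu> U"
      using M.prob_compl[of U] N.prob_compl[of U] open_in_borel[OF U]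
      by (simp add: prob_measuresD[OF \<mu>] prob_measuresD[OF \<nu>])
    then show ?thesis by (simp add: M.emeasure_eq_measure N.emeasure_eq_measure)
  qed
  show ?thesis
  proof (rule measure_eqI_generator_eq[where E = "{U. openin mtopology U}" and \<Omega> = "points S" and A = "\<lambda>_. points S"])
    show "Int_stable {U. openin mtopology U}" by (auto simp: Int_stable_def)
    show "{U. openin mtopology U} \<subseteq> Pow (points S)" using openin_subset_points by blast
    show "sets \<mu> = sigma_sets (points S) {U. openin mtopology U}"
      "sets \<nu> = sigma_sets (points S) {U. openin mtopology U}"
      using sets_borel_cms by (simp_all add: prob_measuresD[OF \<mu>] prob_measuresD[OF \<nu>] topology_cms)
  qed (auto simp: opn)
qed

lemma metr_prob_cms:
  "\<mu> \<in> prob_measures S \<Longrightarrow> \<nu> \<in> prob_measures S \<Longrightarrow> metr (prob_cms S) \<mu> \<nu> = prokhorov S \<mu> \<nu>"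
  by (simp add: prob_cms_def)

lemma prob_dist_less_imp_close:
  assumes "metr (prob_cms S) \<mu> \<nu> < e" "\<mu> \<in> prob_measures S" "\<nu> \<in> prob_measures S"
  shows "close e \<mu> \<nu>" "close e \<nu> \<mu>"
  using prokhorov_less_imp_close[of \<mu> \<nu> e] close_sym assms by (auto simp: metr_prob_cms)

lemma prob_dist_le:
  assumes "close e \<mu> \<nu>" "e > 0" "\<mu> \<in> prob_measures S" "\<nu> \<in> prob_measures S"
  shows "metr (prob_cms S) \<mu> \<nu> \<le> e"
  using prokhorov_le[OF assms] assms by (simp add: metr_prob_cms)

text \<open>Total variation dominates the Prokhorov distance; this serves where two measures differ
  in weights only, not in the points that carry them.\<close>

lemma prob_dist_le_tv:
  assumes "\<And>A. A \<in> sets (borel_cms S) \<Longrightarrow> measure \<mu> A \<le> measure \<nu> A + e"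
    and "e > 0" "\<mu> \<in> prob_measures S" "\<nu> \<in> prob_measures S"
  shows "metr (prob_cms S) \<mu> \<nu> \<le> e"
proof (rule prob_dist_le[OF _ assms(2-4)])
  show "close e \<mu> \<nu>"
    unfolding close_def
  proof
    fix A assume A: "A \<in> sets (borel_cms S)"
    have "measure \<nu> A \<le> measure \<nu> (neighbourhood S e A)"
      using A assms by (intro measure_mono_prob subset_neighbourhood sets_borel_cms_subset) auto
    then show "measure \<mu> A \<le> measure \<nu> (neighbourhood S e A) + e" using assms(1)[OF A] by simp
  qed
qed

lemma prokhorov_nonneg: "\<mu> \<in> prob_measures S \<Longrightarrow> \<nu> \<in> prob_measures S \<Longrightarrow> prokhorov S \<mu> \<nu> \<ge> 0"
  unfolding prokhorov_eq by (rule cInf_greatest) (auto intro!: exI[of _ 1] close_1)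

lemma metric_prob_cms: "Metric_space (prob_measures S) (metr (prob_cms S))"
proof
  fix \<mu> \<nu> :: "'a measure"
  show "0 \<le> metr (prob_cms S) \<mu> \<nu>" by (auto simp: prob_cms_def prokhorov_nonneg)
  have "prokhorov S \<mu> \<nu> = prokhorov S \<nu> \<mu>" unfolding prokhorov_eq by (rule arg_cong[of _ _ Inf]) blast
  then show "metr (prob_cms S) \<mu> \<nu> = metr (prob_cms S) \<nu> \<mu>" by (simp add: prob_cms_def)
next
  fix \<mu> \<nu> assume \<mu>: "\<mu> \<in> prob_measures S" and \<nu>: "\<nu> \<in> prob_measures S"
  have "close e \<mu> \<mu>" if "e > 0" for e
    unfolding close_def
  proof
    fix A assume A: "A \<in> sets (borel_cms S)"
    have "measure \<mu> A \<le> measure \<mu> (neighbourhood S e A)"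
      using A that by (intro measure_mono_prob \<mu> subset_neighbourhood sets_borel_cms_subset) auto
    then show "measure \<mu> A \<le> measure \<mu> (neighbourhood S e A) + e" using that by simp
  qed
  then have "prokhorov S \<mu> \<mu> \<le> e" if "e > 0" for e by (rule prokhorov_le) (use that \<mu> in auto)
  then have "prokhorov S \<mu> \<mu> \<le> 0" by (rule field_le_epsilon) simp
  moreover have "prokhorov S \<mu> \<mu> \<ge> 0" using prokhorov_nonneg[OF \<mu> \<mu>] .
  moreover have "\<mu> = \<nu>" if "prokhorov S \<mu> \<nu> = 0"
    by (intro prob_measures_eqI[OF \<mu> \<nu>] prokhorov_less_imp_close(1)[OF _ \<mu> \<nu>]) (simp add: that)
  ultimately show "metr (prob_cms S) \<mu> \<nu> = 0 \<longleftrightarrow> \<mu> = \<nu>"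
    unfolding metr_prob_cms[OF \<mu> \<nu>] by (metis order_antisym)
next
  fix \<mu> \<nu> \<rho> assume m: "\<mu> \<in> prob_measures S" "\<nu> \<in> prob_measures S" "\<rho> \<in> prob_measures S"
  have "prokhorov S \<mu> \<rho> \<le> prokhorov S \<mu> \<nu> + prokhorov S \<nu> \<rho>"
  proof (rule field_le_epsilon)
    \<comment> \<open>The infimum need not be attained, so each of the two distances is exceeded by
      \<open>e/2\<close>.\<close>
    fix e :: real assume e: "e > 0"
    have "prokhorov S \<mu> \<nu> < prokhorov S \<mu> \<nu> + e/2" using e by simp
    note 1 = prokhorov_less_imp_close[OF this m(1,2)]
    have "prokhorov S \<nu> \<rho> < prokhorov S \<nu> \<rho> + e/2" using e by simp
    note 2 = prokhorov_less_imp_close[OF this m(2,3)]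
    have "prokhorov S \<mu> \<rho> \<le> (prokhorov S \<mu> \<nu> + e/2) + (prokhorov S \<nu> \<rho> + e/2)"
      by (intro prokhorov_le close_trans[OF 1(1) 2(1)] m) (use 1(2) 2(2) in linarith)
    then show "prokhorov S \<mu> \<rho> \<le> prokhorov S \<mu> \<nu> + prokhorov S \<nu> \<rho> + e" by simp
  qed
  then show "metr (prob_cms S) \<mu> \<rho> \<le> metr (prob_cms S) \<mu> \<nu> + metr (prob_cms S) \<nu> \<rho>"
    using m by (simp add: prob_cms_def)
qed

subsection \<open>The Cauchy representation\<close>

lemma cauchy_rep_eq_Some_iff:
  "cauchy_rep S p = Some x \<longleftrightarrow>
    (\<forall>n. metr S (dense S (p n)) (dense S (p (Suc n))) < (1/2) ^ n) \<and>
    limitin mtopology (\<lambda>n. dense S (p n)) x sequentially"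
  unfolding cauchy_rep_def topology_cms
  by (rule pfun_eq_Some_iff) (metis limitin_metric_unique trivial_limit_sequentially)

text \<open>The factor two is the sum of the geometric series that bounds the steps from
  \<open>n\<close> on.\<close>

lemma cauchy_repD:
  assumes "cauchy_rep S p = Some x"
  shows "x \<in> points S" "metr S (dense S (p n)) x \<le> 2 * (1/2) ^ n"
proof -
  have lim: "limitin mtopology (\<lambda>n. dense S (p n)) x sequentially"
    and fast: "metr S (dense S (p n)) (dense S (p (Suc n))) < (1/2) ^ n" for n
    using assms by (auto simp: cauchy_rep_eq_Some_iff)
  show x: "x \<in> points S" using lim by (rule limitin_mspace)
  have part: "metr S (dense S (p n)) (dense S (p (n + k))) \<le> 2 * (1/2) ^ n - 2 * (1/2) ^ (n + k)" for k
  proof (induction k)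
    case (Suc k)
    have "metr S (dense S (p n)) (dense S (p (n + Suc k))) \<le>
        metr S (dense S (p n)) (dense S (p (n + k))) + metr S (dense S (p (n + k))) (dense S (p (Suc (n + k))))"
      using triangle[of "dense S (p n)" "dense S (p (n + k))" "dense S (p (Suc (n + k)))"] by simp
    then show ?case using Suc fast[of "n + k"] by simp
  qed simp
  show "metr S (dense S (p n)) x \<le> 2 * (1/2) ^ n"
  proof (rule field_le_epsilon)
    fix e :: real assume "e > 0"
    then obtain N where N: "\<And>m. m \<ge> N \<Longrightarrow> metr S (dense S (p m)) x < e"
      using lim unfolding limit_metric_sequentially by meson
    have "metr S (dense S (p n)) x \<le> metr S (dense S (p n)) (dense S (p (n + N))) + metr S (dense S (p (n + N))) x"
      using x by (intro triangle) auto
    also have "\<dots> \<le> 2 * (1/2) ^ n + e" using part[of N] N[of "n + N"] by (smt (verit) le_add2 zero_le_power divide_nonneg_nonneg)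
    finally show "metr S (dense S (p n)) x \<le> 2 * (1/2) ^ n + e" .
  qed
qed

text \<open>Errors below \<open>(1/2) ^ (n + 1)\<close> and \<open>(1/2) ^ (n + 2)\<close> add up to
  less than three quarters of the admissible step.\<close>

lemma cauchy_repI:
  assumes x: "x \<in> points S" and p: "\<And>n. metr S (dense S (p n)) x < (1/2) ^ Suc n"
  shows "cauchy_rep S p = Some x"
  unfolding cauchy_rep_eq_Some_iff
proof (intro conjI allI)
  fix n
  have "metr S (dense S (p n)) (dense S (p (Suc n))) \<le> metr S (dense S (p n)) x + metr S (dense S (p (Suc n))) x"
    using x by (metis commute dense_points triangle)
  also have "\<dots> < (1/2) ^ n" using p[of n] p[of "Suc n"] 
      nonneg[of "dense S (p (Suc n))" x] by (simp add: field_simps)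
  finally show "metr S (dense S (p n)) (dense S (p (Suc n))) < (1/2) ^ n" .
next
  show "limitin mtopology (\<lambda>n. dense S (p n)) x sequentially"
    unfolding limit_metric_sequentially
  proof (intro conjI x allI impI)
    fix e :: real assume "e > 0"
    then obtain N where N: "(1/2) ^ N < e" using real_arch_pow_inv[of e "1/2"] by auto
    have "metr S (dense S (p n)) x < e" if "n \<ge> N" for n
    proof -
      have "(1/2 :: real) ^ Suc n \<le> (1/2) ^ N" using that by (intro power_decreasing) auto
      then show ?thesis using p[of n] N by linarith
    qed
    then show "\<exists>N. \<forall>n\<ge>N. dense S (p n) \<in> points S \<and> metr S (dense S (p n)) x < e" by auto
  qed
qed

lemma ex_cauchy_rep:
  assumes "x \<in> points S" shows "\<exists>p. cauchy_rep S p = Some x"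
proof -
  have "\<exists>i. metr S (dense S i) x < (1/2) ^ Suc n" for n
    using ex_dense[OF assms, of "(1/2) ^ Suc n"] by (auto simp: commute)
  then obtain p where "\<And>n. metr S (dense S (p n)) x < (1/2) ^ Suc n" by metis
  then show ?thesis using cauchy_repI[OF assms] by blast
qed

lemma ran_cauchy_rep: "ran (cauchy_rep S) = points S"
  using cauchy_repD(1) ex_cauchy_rep by (auto simp: ran_def)

end

subsection \<open>Approximation by means of Dirac measures\<close>

definition freq :: "nat list \<Rightarrow> nat set \<Rightarrow> real" where
  "freq xs J = real (card {j. j < length xs \<and> xs ! j \<in> J}) / real (length xs)"

text \<open>A one-sided total variation distance between the weights \<open>w\<close> and the frequencies in \<open>xs\<close>, in
  which the mass beyond \<open>M\<close> is counted in full.\<close>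

definition deficit :: "(nat \<Rightarrow> real) \<Rightarrow> nat \<Rightarrow> nat list \<Rightarrow> real" where
  "deficit w M xs = (\<Sum>i<M. max 0 (w i - freq xs {i})) + (1 - (\<Sum>i<M. w i))"

lemma freq_mono: "I \<subseteq> J \<Longrightarrow> freq xs I \<le> freq xs J"
  unfolding freq_def by (intro divide_right_mono of_nat_mono card_mono) auto

lemma freq_finite:
  assumes "finite J" shows "freq xs J = (\<Sum>i\<in>J. freq xs {i})"
proof -
  have *: "{j. j < length xs \<and> xs ! j \<in> J} = (\<Union>i\<in>J. {j. j < length xs \<and> xs ! j \<in> {i}})" by auto
  have "card {j. j < length xs \<and> xs ! j \<in> J} = (\<Sum>i\<in>J. card {j. j < length xs \<and> xs ! j \<in> {i}})"
    unfolding * using assms by (intro card_UN_disjoint) auto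
  then show ?thesis by (simp add: freq_def sum_divide_distrib)
qed

text \<open>Each index below \<open>M\<close> has weight at most its frequency plus its excess;
  everything beyond \<open>M\<close> is conceded to \<open>J\<close>.\<close>

lemma sum_le_freq_deficit:
  "(\<Sum>i\<in>J \<inter> {..<M}. w i) + (1 - (\<Sum>i<M. w i)) \<le> freq xs J + deficit w M xs"
proof -
  have "(\<Sum>i\<in>J \<inter> {..<M}. w i) \<le> (\<Sum>i\<in>J \<inter> {..<M}. freq xs {i} + max 0 (w i - freq xs {i}))"
    by (intro sum_mono) auto
  also have "\<dots> = freq xs (J \<inter> {..<M}) + (\<Sum>i\<in>J \<inter> {..<M}. max 0 (w i - freq xs {i}))"
    by (subst freq_finite[of "J \<inter> {..<M}"]) (simp_all add: sum.distrib)
  also have "\<dots> \<le> freq xs J + (\<Sum>i<M. max 0 (w i - freq xs {i}))"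
    by (intro add_mono freq_mono sum_mono2) auto
  finally show ?thesis by (simp add: deficit_def)
qed

text \<open>Weights are rounded down to multiples of \<open>1 / L\<close>, which costs at most
  \<open>1 / L\<close> per index.\<close>

lemma ex_list_deficit_less:
  assumes w: "\<And>i. w i \<ge> 0" "\<And>M. (\<Sum>i<M. w i) \<le> 1" and tail: "1 - (\<Sum>i<M. w i) < e"
  obtains xs where "xs \<noteq> []" "deficit w M xs < e"
proof -
  \<comment> \<open>Large enough for the \<open>M\<close> rounding errors to fit into the slack that
    the tail leaves.\<close>
  obtain L where L: "real M / (e - (1 - (\<Sum>i<M. w i))) < real L" by (rule reals_Archimedean2[THEN exE])
  have "L > 0" using L tail by (cases L) (auto simp: divide_less_0_iff)
  define c where "c i = nat \<lfloor>w i * real L\<rfloor>" for i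
  have c: "real (c i) \<le> w i * real L" "w i * real L < real (c i) + 1" for i
    using w(1)[of i] unfolding c_def by (auto simp: nat_less_real_le le_nat_floor intro: of_nat_floor)
  have "real (\<Sum>i<M. c i) \<le> real L"
  proof -
    have "real (\<Sum>i<M. c i) \<le> (\<Sum>i<M. w i * real L)" by (simp add: sum_mono c)
    also have "\<dots> = (\<Sum>i<M. w i) * real L" by (simp add: sum_distrib_right)
    also have "\<dots> \<le> 1 * real L" by (intro mult_right_mono w) auto
    finally show ?thesis by simp
  qed
  then have cL: "(\<Sum>i<M. c i) \<le> L" by (simp only: of_nat_le_iff)
  define ys where "ys = concat (map (\<lambda>i. replicate (c i) i) [0..<M])"
  \<comment> \<open>Padding with the index \<open>0\<close> brings the length to exactly
    \<open>L\<close> and does not lower any of the counts.\<close>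
  define xs where "xs = ys @ replicate (L - (\<Sum>i<M. c i)) 0"
  have "length ys = (\<Sum>i<M. c i)"
    by (simp add: ys_def length_concat comp_def interv_sum_list_conv_sum_set_nat atLeast0LessThan)
  then have len: "length xs = L" using cL by (simp add: xs_def)
  have count: "c i \<le> card {j. j < length xs \<and> xs ! j = i}" if "i < M" for i
  proof -
    have "length (filter (\<lambda>x. x = i) ys) = (\<Sum>k<M. if k = i then c i else 0)"
      unfolding ys_def filter_concat length_concat map_map comp_def filter_replicate
      by (simp add: interv_sum_list_conv_sum_set_nat atLeast0LessThan if_distrib cong: if_cong)
    also have "\<dots> = c i" using that by simp
    finally have "c i \<le> length (filter (\<lambda>x. x = i) xs)" by (simp add: xs_def)
    then show ?thesis by (simp add: length_filter_conv_card)
  qed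
  have freq: "max 0 (w i - freq xs {i}) \<le> 1 / real L" if "i < M" for i
  proof -
    have "w i \<le> (real (c i) + 1) / real L" using c(2)[of i] \<open>L > 0\<close> by (simp add: field_simps)
    also have "\<dots> \<le> freq xs {i} + 1 / real L"
      using count[OF that] \<open>L > 0\<close> by (simp add: freq_def len add_divide_distrib divide_right_mono)
    finally show ?thesis by simp
  qed
  have "(\<Sum>i<M. max 0 (w i - freq xs {i})) \<le> (\<Sum>i<M. 1 / real L)"
    using freq by (intro sum_mono) auto
  also have "\<dots> = real M / real L" by simp
  also have "\<dots> < e - (1 - (\<Sum>i<M. w i))"
    using L tail \<open>L > 0\<close> by (simp add: field_simps)
  finally have "deficit w M xs < e" by (simp add: deficit_def)
  moreover have "xs \<noteq> []" using len \<open>L > 0\<close> by auto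
  ultimately show thesis using that by blast
qed

context separable_cms
begin

lemma measurable_dense [measurable]: "(\<lambda>j. dense S (xs ! j)) \<in> uniform_count_measure A \<rightarrow>\<^sub>M borel_cms S"
  by (simp add: measurable_def uniform_count_measure_def space_point_measure sets_point_measure)

lemma dirac_mean_prob_measures:
  assumes "xs \<noteq> []" shows "dirac_mean S xs \<in> prob_measures S"
proof -
  interpret prob_space "uniform_count_measure {..<length xs}"
    using assms by (intro prob_space_uniform_count_measure) auto
  show ?thesis
    unfolding prob_measures_def dirac_mean_def
    by (auto intro!: prob_space_distr)
qed

lemma measure_dirac_mean:
  assumes "xs \<noteq> []" "A \<in> sets (borel_cms S)"
  shows "measure (dirac_mean S xs) A = freq xs {i. dense S i \<in> A}"
proof -
  let ?U = "uniform_count_measure {..<length xs}"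
  have "measure (dirac_mean S xs) A = measure ?U ((\<lambda>j. dense S (xs ! j)) -` A \<inter> space ?U)"
    unfolding dirac_mean_def using assms by (intro measure_distr) auto
  also have "\<dots> = real (card ((\<lambda>j. dense S (xs ! j)) -` A \<inter> space ?U)) / real (card {..<length xs})"
    by (rule measure_uniform_count_measure) (auto simp: space_uniform_count_measure)
  also have "(\<lambda>j. dense S (xs ! j)) -` A \<inter> space ?U = {j. j < length xs \<and> xs ! j \<in> {i. dense S i \<in> A}}"
    by (auto simp: space_uniform_count_measure)
  finally show ?thesis by (simp add: freq_def)
qed

lemma dense_prob_cms: "dense (prob_cms S) n = dirac_mean S (list_decode (Suc n))"
  by (simp add: prob_cms_def split: prod.split)

text \<open>Cut the space into disjoint cells \<open>E i\<close> inside balls around the dense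
  points. Moving the mass of a cell to its centre costs distance less than \<open>e\<close>;
  restricting to finitely many cells with rational weights costs mass less than
  \<open>e\<close>.\<close>

lemma ex_dirac_mean_close:
  assumes \<mu>: "\<mu> \<in> prob_measures S" and e: "e > 0"
  shows "\<exists>xs. xs \<noteq> [] \<and> metr (prob_cms S) \<mu> (dirac_mean S xs) \<le> e"
proof -
  interpret prob_space \<mu> using prob_measuresD(1)[OF \<mu>] .
  define E where "E i = mball (dense S i) e - (\<Union>k<i. mball (dense S k) e)" for i
  have Eb: "E i \<in> sets (borel_cms S)" for i
    unfolding E_def by (intro sets.Diff sets.finite_UN open_in_borel) auto
  then have E: "E i \<in> sets \<mu>" for i by (simp add: prob_measuresD[OF \<mu>])
  have disj: "disjoint_family E"
    unfolding disjoint_family_on_def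
  proof (intro ballI impI)
    fix m n :: nat assume "m \<noteq> n"
    then show "E m \<inter> E n = {}" by (cases m n rule: linorder_cases) (auto simp: E_def)
  qed
  have union: "(\<Union>i. E i) = points S"
  proof
    show "points S \<subseteq> (\<Union>i. E i)"
    proof
      fix x assume x: "x \<in> points S"
      have "\<exists>i. x \<in> mball (dense S i) e" using ex_dense[OF x e] x by (auto simp: commute)
      then have "x \<in> E (LEAST i. x \<in> mball (dense S i) e)"
        unfolding E_def by (auto dest: not_less_Least intro: LeastI2_ex)
      then show "x \<in> (\<Union>i. E i)" by blast
    qed
  qed (auto simp: E_def)
  define w where "w i = measure \<mu> (E i)" for i
  have sums: "w sums 1"
    using finite_measure_UNION[OF _ disj] E prob_space unfolding w_def union
    by (auto simp: prob_measuresD[OF \<mu>])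
  have w0: "w i \<ge> 0" for i by (simp add: w_def)
  have w1: "(\<Sum>i<M. w i) \<le> 1" for M
    using sum_le_suminf[of w "{..<M}"] sums w0 by (auto simp: sums_iff)
  have "(\<lambda>M. \<Sum>i<M. w i) \<longlonglongrightarrow> 1" using sums by (simp add: sums_def)
  then have "eventually (\<lambda>M. (\<Sum>i<M. w i) > 1 - e) sequentially"
    by (rule order_tendstoD) (use e in simp)
  from eventually_happens'[OF sequentially_bot this]
  obtain M where "1 - e < (\<Sum>i<M. w i)" by (rule exE)
  then have "1 - (\<Sum>i<M. w i) < e" by simp
  then obtain xs where xs: "xs \<noteq> []" "deficit w M xs < e"
    using ex_list_deficit_less[of w M e] w0 w1 by blast
  have "close e \<mu> (dirac_mean S xs)"
    unfolding close_def
  proof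
    fix A assume A: "A \<in> sets (borel_cms S)"
    \<comment> \<open>Cells that meet \<open>A\<close> have their centres in its
      \<open>e\<close>-neighbourhood.\<close>
    define J where "J = {i. E i \<inter> A \<noteq> {}}"
    have AS: "A \<subseteq> points S" using sets_borel_cms_subset[OF A] .
    have UJ: "(\<Union>i\<in>J \<inter> {..<M}. E i) \<in> sets (borel_cms S)"
      using Eb by (intro sets.finite_UN) auto
    have UM: "(\<Union>i<M. E i) \<in> sets (borel_cms S)" "points S - (\<Union>i<M. E i) \<in> sets (borel_cms S)"
    proof -
      show "(\<Union>i<M. E i) \<in> sets (borel_cms S)" using Eb by (intro sets.finite_UN) auto
      then show "points S - (\<Union>i<M. E i) \<in> sets (borel_cms S)"
        using sets.compl_sets[of "\<Union>i<M. E i" "borel_cms S"] by simp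
    qed
    have "measure \<mu> A \<le> measure \<mu> ((\<Union>i\<in>J \<inter> {..<M}. E i) \<union> (points S - (\<Union>i<M. E i)))"
      using AS union UM UJ by (intro finite_measure_mono) (auto simp: J_def prob_measuresD[OF \<mu>])
    also have "\<dots> \<le> measure \<mu> (\<Union>i\<in>J \<inter> {..<M}. E i) + measure \<mu> (points S - (\<Union>i<M. E i))"
      using UM UJ by (intro measure_Un_le) (auto simp: prob_measuresD[OF \<mu>])
    also have "measure \<mu> (points S - (\<Union>i<M. E i)) = 1 - measure \<mu> (\<Union>i<M. E i)"
      using prob_compl[of "\<Union>i<M. E i"] UM by (simp add: prob_measuresD[OF \<mu>])
    also have "measure \<mu> (\<Union>i\<in>J \<inter> {..<M}. E i) = (\<Sum>i\<in>J \<inter> {..<M}. w i)"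
      unfolding w_def using E disj by (intro finite_measure_finite_Union) (auto simp: disjoint_family_on_def)
    also have "measure \<mu> (\<Union>i<M. E i) = (\<Sum>i<M. w i)"
      unfolding w_def using E disj by (intro finite_measure_finite_Union) (auto simp: disjoint_family_on_def)
    also have "(\<Sum>i\<in>J \<inter> {..<M}. w i) + (1 - (\<Sum>i<M. w i)) \<le> freq xs J + e"
      using sum_le_freq_deficit[of w J M xs] xs by simp
    also have "freq xs J \<le> freq xs {i. dense S i \<in> neighbourhood S e A}"
      by (intro freq_mono) (auto simp: J_def E_def neighbourhood_def commute)
    also have "\<dots> = measure (dirac_mean S xs) (neighbourhood S e A)"
      using xs A by (simp add: measure_dirac_mean)
    finally show "measure \<mu> A \<le> measure (dirac_mean S xs) (neighbourhood S e A) + e" by simp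
  qed
  then show ?thesis
    using xs \<mu> e by (intro exI[of _ xs]) (auto intro!: prob_dist_le dirac_mean_prob_measures)
qed

lemma points_prob_cms: "points (prob_cms S) = prob_measures S"
  by (simp add: prob_cms_def)

lemma separable_prob_cms: "separable_cms (prob_cms S)"
proof (rule separable_cms.intro)
  show "Metric_space (points (prob_cms S)) (metr (prob_cms S))"
    using metric_prob_cms by (simp only: points_prob_cms)
  show "dense (prob_cms S) i \<in> points (prob_cms S)" for i
    unfolding dense_prob_cms points_prob_cms
    by (rule dirac_mean_prob_measures[OF list_decode_Suc_neq_Nil])
  show "\<exists>i. metr (prob_cms S) \<mu> (dense (prob_cms S) i) < e"
    if \<mu>: "\<mu> \<in> points (prob_cms S)" and e: "e > 0" for \<mu> e
  proof -
    obtain xs where xs: "xs \<noteq> []" "metr (prob_cms S) \<mu> (dirac_mean S xs) \<le> e / 2"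
      using ex_dirac_mean_close[of \<mu> "e/2"] \<mu> e by (auto simp: points_prob_cms)
    obtain n where "list_encode xs = Suc n" using xs(1) by (cases xs) auto
    then have n: "list_decode (Suc n) = xs" by (metis list_encode_inverse)
    have "metr (prob_cms S) \<mu> (dense (prob_cms S) n) < e"
      unfolding dense_prob_cms n using xs(2) e by linarith
    then show ?thesis ..
  qed
qed

end

lemma points_prod_cms: "points (S \<times>\<^sub>m T) = points S \<times> points T"
  and metr_prod_cms: "metr (S \<times>\<^sub>m T) = prod_dist (metr S) (metr T)"
  and dense_prod_cms: "dense (S \<times>\<^sub>m T) i = (dense S (pfst i), dense T (psnd i))"
  by (simp_all add: prod_cms_def map_prod_def case_prod_unfold)

lemma separable_prod_cms:
  assumes "separable_cms S" "separable_cms T"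
  shows "separable_cms (S \<times>\<^sub>m T)"
proof -
  interpret S: separable_cms S by fact
  interpret T: separable_cms T by fact
  interpret ST: Metric_space12 "points S" "metr S" "points T" "metr T" ..
  show ?thesis
  proof (rule separable_cms.intro)
    show "Metric_space (points (S \<times>\<^sub>m T)) (metr (S \<times>\<^sub>m T))"
      using ST.prod_metric by (simp only: points_prod_cms metr_prod_cms)
    show "dense (S \<times>\<^sub>m T) i \<in> points (S \<times>\<^sub>m T)" for i
      by (simp add: points_prod_cms dense_prod_cms)
    show "\<exists>i. metr (S \<times>\<^sub>m T) x (dense (S \<times>\<^sub>m T) i) < e"
      if xp: "x \<in> points (S \<times>\<^sub>m T)" and e: "e > 0" for x e
    proof -
      obtain a b where x: "x = (a, b)" "a \<in> points S" "b \<in> points T"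
        using xp by (auto simp: points_prod_cms)
      obtain i j where "metr S a (dense S i) < e/2" "metr T b (dense T j) < e/2"
        using S.ex_dense[OF x(2), of "e/2"] T.ex_dense[OF x(3), of "e/2"] e by auto
      moreover have "metr (S \<times>\<^sub>m T) x (dense (S \<times>\<^sub>m T) (prod_encode (i, j))) \<le>
          metr S a (dense S i) + metr T b (dense T j)"
        unfolding x(1) metr_prod_cms dense_prod_cms prod_encode_inverse fst_conv snd_conv
        by (rule ST.prod_metric_le_components) (use x in auto)
      ultimately have "metr (S \<times>\<^sub>m T) x (dense (S \<times>\<^sub>m T) (prod_encode (i, j))) < e" by linarith
      then show ?thesis by (rule exI)
    qed
  qed
qed

section \<open>The spaces of the theorem\<close>

lemma separable_nat_cms: "separable_cms nat_cms"
proof (rule separable_cms.intro)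
  show "Metric_space (points nat_cms) (metr nat_cms)"
    by unfold_locales (auto simp: nat_cms_def)
qed (auto simp: nat_cms_def)

lemma points_unit_interval: "points unit_interval_cms = {0..1}"
  and metr_unit_interval: "metr unit_interval_cms x y = \<bar>x - y\<bar>"
  and dense_unit_interval: "dense unit_interval_cms n = min 1 (real (pfst n) / real (Suc (psnd n)))"
  by (simp_all add: unit_interval_cms_def dist_real_def case_prod_unfold)

lemma separable_unit_interval_cms: "separable_cms unit_interval_cms"
proof (rule separable_cms.intro)
  show "Metric_space (points unit_interval_cms) (metr unit_interval_cms)"
    unfolding unit_interval_cms_def by simp (rule Met_TC.subspace, simp)
  show "dense unit_interval_cms i \<in> points unit_interval_cms" for i
    by (simp add: dense_unit_interval points_unit_interval)
  show "\<exists>i. metr unit_interval_cms x (dense unit_interval_cms i) < e"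
    if x: "x \<in> points unit_interval_cms" and e: "e > 0" for x e
  proof -
    obtain b where b: "inverse (real (Suc b)) < e" using reals_Archimedean[OF e] by auto
    define a where "a = nat \<lfloor>x * real (Suc b)\<rfloor>"
    have x01: "0 \<le> x" "x \<le> 1" using x by (auto simp: points_unit_interval)
    have "real a \<le> x * real (Suc b)" "x * real (Suc b) < real a + 1"
      using x01 unfolding a_def by (auto simp del: of_nat_Suc)
    then have 1: "real a / real (Suc b) \<le> x" "x < (real a + 1) / real (Suc b)"
      by (auto simp: divide_simps mult.commute simp del: of_nat_Suc)
    then have "dense unit_interval_cms (prod_encode (a, b)) = real a / real (Suc b)"
      using x01 by (simp add: dense_unit_interval del: of_nat_Suc)
    moreover have "(real a + 1) / real (Suc b) = real a / real (Suc b) + inverse (real (Suc b))"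
      by (simp add: add_divide_distrib inverse_eq_divide del: of_nat_Suc)
    ultimately have "metr unit_interval_cms x (dense unit_interval_cms (prod_encode (a, b))) < e"
      using 1 b by (simp add: metr_unit_interval del: of_nat_Suc)
    then show ?thesis ..
  qed
qed

lemma metr_cantor: "metr cantor_cms x y = (if x = y then 0 else (1/2) ^ (LEAST n. x n \<noteq> y n))"
  and points_cantor: "points cantor_cms = UNIV" and dense_cantor: "dense cantor_cms = bit"
  by (simp_all add: cantor_cms_def)

text \<open>The exponent of the distance is the first place of difference, so the strict inequality
  means agreement up to and including \<open>n\<close>.\<close>

lemma metr_cantor_less_iff: "metr cantor_cms x y < (1/2) ^ n \<longleftrightarrow> (\<forall>i\<le>n. x i = y i)"
proof (cases "x = y")
  case False
  then have ex: "\<exists>i. x i \<noteq> y i" by auto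
  define k where "k = (LEAST n. x n \<noteq> y n)"
  have k: "x k \<noteq> y k" unfolding k_def using ex by (rule LeastI_ex)
  have "(1/2 :: real) ^ k < (1/2) ^ n \<longleftrightarrow> n < k" by (rule power_strict_decreasing_iff) auto
  moreover have "n < k \<longleftrightarrow> (\<forall>i\<le>n. x i = y i)"
    using k not_less_Least[of _ "\<lambda>n. x n \<noteq> y n"] unfolding k_def by (meson le_less_trans not_le)
  ultimately show ?thesis using False by (simp add: metr_cantor k_def)
qed (simp add: metr_cantor)

lemma metr_cantor_le: "x k \<noteq> y k \<Longrightarrow> (1/2) ^ k \<le> metr cantor_cms x y"
  using metr_cantor_less_iff[of x y k] by (meson not_le order_refl)

lemma nat_bit_horner_sum: "bit (horner_sum of_bool 2 bs :: nat) n \<longleftrightarrow> n < length bs \<and> bs ! n"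
  by (simp add: bit_horner_sum_bit_iff)

text \<open>The index of the dense point that agrees with \<open>x\<close> below \<open>n\<close>
  and vanishes from there on. It also codes finite sets of positions.\<close>

definition cantor_code :: "(nat \<Rightarrow> bool) \<Rightarrow> nat \<Rightarrow> nat" where
  "cantor_code x n = (\<Sum>i<n. of_bool (x i) * 2 ^ i)"

lemma bit_cantor_code: "bit (cantor_code x n) i \<longleftrightarrow> i < n \<and> x i"
proof -
  have "cantor_code x n = horner_sum of_bool 2 (map x [0..<n])"
    by (simp add: cantor_code_def horner_sum_eq_sum atLeast0LessThan)
  then show ?thesis by (auto simp: nat_bit_horner_sum)
qed

lemma separable_cantor_cms: "separable_cms cantor_cms"
proof (rule separable_cms.intro)
  show "Metric_space (points cantor_cms) (metr cantor_cms)"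
  proof
    fix x y z :: "nat \<Rightarrow> bool"
    show "0 \<le> metr cantor_cms x y" by (simp add: metr_cantor)
    show "metr cantor_cms x y = metr cantor_cms y x" unfolding metr_cantor by (simp only: eq_commute[of "x _" "y _"] eq_commute[of x y])
    show "metr cantor_cms x y = 0 \<longleftrightarrow> x = y" by (simp add: metr_cantor)
    show "metr cantor_cms x z \<le> metr cantor_cms x y + metr cantor_cms y z"
    proof (cases "x = z")
      case False
      define k where "k = (LEAST n. x n \<noteq> z n)"
      obtain i where "x i \<noteq> z i" using False by (auto simp: fun_eq_iff)
      then have "x k \<noteq> z k" unfolding k_def by (rule LeastI)
      then have "x k \<noteq> y k \<or> y k \<noteq> z k" by auto
      then have "(1/2) ^ k \<le> metr cantor_cms x y \<or> (1/2) ^ k \<le> metr cantor_cms y z"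
        using metr_cantor_le[of x k y] metr_cantor_le[of y k z] by argo
      moreover have "metr cantor_cms x y \<ge> 0" "metr cantor_cms y z \<ge> 0" by (simp_all add: metr_cantor)
      moreover have "metr cantor_cms x z = (1/2) ^ k" using False by (simp add: metr_cantor k_def)
      ultimately show ?thesis by linarith
    qed (simp add: metr_cantor)
  qed
  show "dense cantor_cms i \<in> points cantor_cms" for i by (simp add: points_cantor)
  show "\<exists>i. metr cantor_cms x (dense cantor_cms i) < e" if e: "e > 0" for x e
  proof -
    obtain n where "(1/2) ^ n < e" using real_arch_pow_inv[OF e, of "1/2"] by auto
    moreover have "metr cantor_cms x (dense cantor_cms (cantor_code x (Suc n))) < (1/2) ^ n"
      by (simp add: metr_cantor_less_iff dense_cantor bit_cantor_code)
    ultimately show ?thesis by (intro exI[of _ "cantor_code x (Suc n)"]) linarith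
  qed
qed

lemma limitin_cantor_iff:
  "limitin (topology_cms cantor_cms) X x sequentially \<longleftrightarrow> (\<forall>i. eventually (\<lambda>n. X n i = x i) sequentially)"
proof -
  interpret separable_cms cantor_cms by (rule separable_cantor_cms)
  show ?thesis
  proof
    assume L: "limitin (topology_cms cantor_cms) X x sequentially"
    show "\<forall>i. eventually (\<lambda>n. X n i = x i) sequentially"
    proof
      fix i
      have "\<exists>N. \<forall>n\<ge>N. metr cantor_cms (X n) x < (1/2) ^ i"
      proof -
        have "(1/2 :: real) ^ i > 0" by simp
        then show ?thesis using L unfolding topology_cms limit_metric_sequentially by blast
      qed
      then show "eventually (\<lambda>n. X n i = x i) sequentially"
        unfolding eventually_sequentially metr_cantor_less_iff by blast
    qed
  next
    assume ev: "\<forall>i. eventually (\<lambda>n. X n i = x i) sequentially"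
    show "limitin (topology_cms cantor_cms) X x sequentially"
      unfolding topology_cms limit_metric_sequentially
    proof (intro conjI allI impI)
      show "x \<in> points cantor_cms" by (simp add: points_cantor)
    next
      fix e :: real assume "e > 0"
      then obtain k where k: "(1/2) ^ k < e" using real_arch_pow_inv[of e "1/2"] by auto
      have "eventually (\<lambda>n. \<forall>i\<in>{..k}. X n i = x i) sequentially"
        using ev by (intro eventually_ball_finite) auto
      then obtain N where "\<And>n. n \<ge> N \<Longrightarrow> \<forall>i\<le>k. X n i = x i"
        by (auto simp: eventually_sequentially)
      then show "\<exists>N. \<forall>n\<ge>N. X n \<in> points cantor_cms \<and> metr cantor_cms (X n) x < e"
        using k by (intro exI[of _ N]) (auto simp: points_cantor simp flip: metr_cantor_less_iff intro: less_trans)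
    qed
  qed
qed

text \<open>At entry \<open>i + 2\<close> the error is at most \<open>(1/2) ^ (i + 1)\<close>, small
  enough to fix digit \<open>i\<close>.\<close>

lemma cauchy_rep_cantorD:
  assumes "cauchy_rep cantor_cms q = Some x" shows "x i \<longleftrightarrow> bit (q (i + 2)) i"
proof -
  have "metr cantor_cms (dense cantor_cms (q (i + 2))) x \<le> 2 * (1/2) ^ (i + 2)"
    by (rule separable_cms.cauchy_repD(2)[OF separable_cantor_cms assms])
  also have "\<dots> < (1/2) ^ i" by simp
  finally show ?thesis by (auto simp: metr_cantor_less_iff dense_cantor)
qed

lemma cauchy_rep_cantor_code: "cauchy_rep cantor_cms (\<lambda>n. cantor_code x (n + 2)) = Some x"
  by (rule separable_cms.cauchy_repI[OF separable_cantor_cms])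
    (simp_all only: points_cantor UNIV_I metr_cantor_less_iff dense_cantor bit_cantor_code, auto)

subsection \<open>Names of functions\<close>

lemma tagged_inject: "tagged n p = tagged n' p' \<longleftrightarrow> n = n' \<and> p = p'"
proof
  assume eq: "tagged n p = tagged n' p'"
  have "(LEAST j. tagged n p j \<noteq> 0) = n" for n p
    by (rule Least_equality) (auto simp: tagged_def not_less[symmetric])
  then have n: "n = n'" using eq by metis
  have tail: "p j = tagged n p (Suc (n + j))" for n p and j :: nat by (simp add: tagged_def)
  have "p j = p' j" for j using tail[of p j n] tail[of p' j n'] eq n by simp
  with n show "n = n' \<and> p = p'" by blast
qed simp

lemma nat_rep_eq_Some_iff: "nat_rep p = Some n \<longleftrightarrow> p = tagged n (\<lambda>_. 0)"
  unfolding nat_rep_def by (rule pfun_eq_Some_iff) (simp add: tagged_inject)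

lemma ran_nat_rep: "ran nat_rep = UNIV"
  by (auto simp: ran_def nat_rep_eq_Some_iff)

lemma realizer_single_valued_iff:
  "F \<turnstile>\<^sub>r \<lparr>src = X, tgt = Y, val = (\<lambda>x. {\<phi> x})\<rparr> \<longleftrightarrow>
    (\<forall>q x. X q = Some x \<longrightarrow> (\<exists>q'. F q = Some q' \<and> Y q' = Some (\<phi> x)))"
  by (auto simp: realizer_def)

text \<open>A name determines machine and oracle, hence the values on the underlying set, and
  extensional functions with equal values there coincide.\<close>

lemma fun_rep_eq_Some_iff:
  "fun_rep X Y r = Some \<phi> \<longleftrightarrow> \<phi> \<in> extensional (ran X) \<and>
    (\<exists>n p. r = tagged n p \<and>
      (\<forall>q x. X q = Some x \<longrightarrow> (\<exists>q'. machine n (interleave p q) = Some q' \<and> Y q' = Some (\<phi> x))))"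
proof -
  let ?R = "\<lambda>r \<phi>. \<phi> \<in> ran X \<rightarrow>\<^sub>E ran Y \<and> (\<exists>n p. r = tagged n p \<and>
      (\<forall>q x. X q = Some x \<longrightarrow> (\<exists>q'. machine n (interleave p q) = Some q' \<and> Y q' = Some (\<phi> x))))"
  have "fun_rep X Y r = Some \<phi> \<longleftrightarrow> ?R r \<phi>"
    unfolding fun_rep_def realizer_single_valued_iff
  proof (rule pfun_eq_Some_iff)
    fix \<phi> \<psi> assume \<phi>: "?R r \<phi>" and \<psi>: "?R r \<psi>"
    from \<phi> obtain n p where r: "r = tagged n p" and
      1: "\<And>q x. X q = Some x \<Longrightarrow> \<exists>q'. machine n (interleave p q) = Some q' \<and> Y q' = Some (\<phi> x)" by blast
    from \<psi> have 2: "\<And>q x. X q = Some x \<Longrightarrow> \<exists>q'. machine n (interleave p q) = Some q' \<and> Y q' = Some (\<psi> x)"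
      unfolding r tagged_inject by blast
    have "\<phi> x = \<psi> x" if "X q = Some x" for q x using 1[OF that] 2[OF that] by auto
    then show "\<phi> = \<psi>" using \<phi> \<psi> by (intro PiE_ext[of \<phi> "ran X" "\<lambda>_. ran Y" \<psi>]) (auto simp: ran_def)
  qed
  also have "\<dots> \<longleftrightarrow> \<phi> \<in> extensional (ran X) \<and>
    (\<exists>n p. r = tagged n p \<and>
      (\<forall>q x. X q = Some x \<longrightarrow> (\<exists>q'. machine n (interleave p q) = Some q' \<and> Y q' = Some (\<phi> x))))"
    (is "_ \<longleftrightarrow> _ \<and> ?E")
  proof -
    have "\<phi> x \<in> ran Y" if E: ?E and x: "x \<in> ran X" for x
    proof -
      obtain q where "X q = Some x" using x by (auto simp: ran_def)
      with E obtain q' where "Y q' = Some (\<phi> x)" by blast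
      then show ?thesis by (auto simp: ran_def)
    qed
    then show ?thesis unfolding PiE_def by blast
  qed
  finally show ?thesis .
qed

lemma fun_repI:
  assumes "\<phi> \<in> extensional (ran X)"
    and "\<And>q x. X q = Some x \<Longrightarrow> \<exists>q'. machine n (interleave p q) = Some q' \<and> Y q' = Some (\<phi> x)"
  shows "fun_rep X Y (tagged n p) = Some \<phi>"
  using assms unfolding fun_rep_eq_Some_iff by blast

lemma recf_tagged [recf_intros]:
  assumes "recf (\<lambda>p z. Q p (pfst z) (psnd z))" "recf N" "recf F"
  shows "recf (\<lambda>p x. tagged (N p x) (Q p x) (F p x))"
  unfolding tagged_def by (intro recf_intros recf_comp2[OF assms(1)] assms)

section \<open>Continuous disintegrations\<close>

lemma lipschitz_measurable:
  assumes "separable_cms X" "separable_cms Y" and f: "f \<in> points X \<rightarrow> points Y"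
    and lip: "\<And>x y. x \<in> points X \<Longrightarrow> y \<in> points X \<Longrightarrow> metr Y (f x) (f y) \<le> metr X x y"
  shows "f \<in> borel_cms X \<rightarrow>\<^sub>M borel_cms Y"
proof -
  interpret X: separable_cms X by fact
  interpret Y: separable_cms Y by fact
  show ?thesis
  proof (rule Y.measurable_borel_cms)
    fix U assume U: "openin Y.mtopology U"
    have "openin X.mtopology (f -` U \<inter> points X)"
      unfolding X.openin_mtopology
    proof (intro conjI allI impI)
      fix x assume x: "x \<in> f -` U \<inter> points X"
      then obtain r where r: "r > 0" "Y.mball (f x) r \<subseteq> U"
        using U unfolding Y.openin_mtopology by blast
      have "X.mball x r \<subseteq> f -` U \<inter> points X"
      proof
        fix y assume y: "y \<in> X.mball x r"
        then have "f y \<in> Y.mball (f x) r"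
          using x f lip[of x y] by auto
        then show "y \<in> f -` U \<inter> points X" using r y by auto
      qed
      then show "\<exists>r>0. X.mball x r \<subseteq> f -` U \<inter> points X" using r by blast
    qed simp
    then show "f -` U \<inter> space (borel_cms X) \<in> sets (borel_cms X)"
      by (simp add: X.open_in_borel)
  qed (use f in simp)
qed

lemma distr_prob_measures:
  assumes "separable_cms X" and \<mu>: "\<mu> \<in> prob_measures X" and f: "f \<in> borel_cms X \<rightarrow>\<^sub>M borel_cms Y"
  shows "distr \<mu> (borel_cms Y) f \<in> prob_measures Y"
proof -
  interpret X: separable_cms X by fact
  interpret prob_space \<mu> using X.prob_measuresD[OF \<mu>] by simp
  have "f \<in> \<mu> \<rightarrow>\<^sub>M borel_cms Y"
    using f by (simp add: X.prob_measuresD[OF \<mu>] cong: measurable_cong_sets)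
  then show ?thesis by (simp add: prob_measures_def prob_space_distr)
qed

text \<open>The preimage of an \<open>e\<close>-neighbourhood contains the
  \<open>e\<close>-neighbourhood of the preimage. Applied to the first projection, this passes the
  continuity of \<open>\<kappa>\<close> on to the fibres.\<close>

lemma close_distr:
  assumes X: "separable_cms X" and Y: "separable_cms Y" and f: "f \<in> points X \<rightarrow> points Y"
    and lip: "\<And>x y. x \<in> points X \<Longrightarrow> y \<in> points X \<Longrightarrow> metr Y (f x) (f y) \<le> metr X x y"
    and m: "\<mu> \<in> prob_measures X" "\<nu> \<in> prob_measures X"
    and cl: "separable_cms.close X e \<mu> \<nu>"
  shows "separable_cms.close Y e (distr \<mu> (borel_cms Y) f) (distr \<nu> (borel_cms Y) f)"
proof -
  interpret X: separable_cms X by fact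
  interpret Y: separable_cms Y by fact
  have fm: "f \<in> borel_cms X \<rightarrow>\<^sub>M borel_cms Y" by (rule lipschitz_measurable[OF X Y f lip])
  have distr: "measure (distr \<mu> (borel_cms Y) f) A = measure \<mu> (f -` A \<inter> points X)"
    if "\<mu> \<in> prob_measures X" "A \<in> sets (borel_cms Y)" for \<mu> A
    using that fm by (subst measure_distr)
      (auto simp: X.prob_measuresD[OF that(1)] cong: measurable_cong_sets)
  show ?thesis
    unfolding Y.close_def
  proof
    fix A assume A: "A \<in> sets (borel_cms Y)"
    have fA: "f -` A \<inter> points X \<in> sets (borel_cms X)"
      using measurable_sets[OF fm A] by simp
    have fN: "f -` neighbourhood Y e A \<inter> points X \<in> sets (borel_cms X)"
      using measurable_sets[OF fm Y.neighbourhood_borel[OF A]] by simp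
    have sub: "neighbourhood X e (f -` A \<inter> points X) \<subseteq> f -` neighbourhood Y e A \<inter> points X"
    proof
      fix y assume "y \<in> neighbourhood X e (f -` A \<inter> points X)"
      then obtain x where "y \<in> points X" "x \<in> points X" "f x \<in> A" "metr X x y < e"
        by (auto simp: neighbourhood_def)
      moreover have "metr Y (f x) (f y) < e" using calculation lip[of x y] by simp
      ultimately show "y \<in> f -` neighbourhood Y e A \<inter> points X"
        using f by (auto simp: neighbourhood_def)
    qed
    have "measure \<mu> (f -` A \<inter> points X) \<le> measure \<nu> (neighbourhood X e (f -` A \<inter> points X)) + e"
      using cl fA by (auto simp: X.close_def)
    also have "measure \<nu> (neighbourhood X e (f -` A \<inter> points X)) \<le> measure \<nu> (f -` neighbourhood Y e A \<inter> points X)"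
      by (rule X.measure_mono_prob[OF m(2) sub fN])
    finally show "measure (distr \<mu> (borel_cms Y) f) A \<le> measure (distr \<nu> (borel_cms Y) f) (neighbourhood Y e A) + e"
      using A m by (simp add: distr)
  qed
qed

lemma metr_prod_ge: "metr S a b \<le> metr (S \<times>\<^sub>m T) (a, s) (b, t)" "metr T s t \<le> metr (S \<times>\<^sub>m T) (a, s) (b, t)"
  if "separable_cms S" "separable_cms T"
proof -
  interpret S: separable_cms S by fact
  interpret T: separable_cms T by fact
  interpret ST: Metric_space12 "points S" "metr S" "points T" "metr T" ..
  show "metr S a b \<le> metr (S \<times>\<^sub>m T) (a, s) (b, t)" "metr T s t \<le> metr (S \<times>\<^sub>m T) (a, s) (b, t)"
    unfolding metr_prod_cms by (rule ST.component_le_prod_metric)+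
qed

text \<open>The bits of \<open>F\<close> select positions in \<open>xs\<close>, hence a part of the support of the mean of the
  Dirac measures at the points listed by \<open>xs\<close>.\<close>

definition selected :: "'a cms \<Rightarrow> nat list \<Rightarrow> nat \<Rightarrow> 'a set" where
  "selected S xs F = {dense S (xs ! h) | h. h < length xs \<and> bit F h}"

definition weight :: "nat list \<Rightarrow> nat \<Rightarrow> real" where
  "weight xs F = real (card {h. h < length xs \<and> bit F h}) / real (length xs)"

lemma weight_le_1: "weight xs F \<le> 1"
proof -
  have "card {h. h < length xs \<and> bit F h} \<le> card {..<length xs}" by (intro card_mono) auto
  then show ?thesis by (simp add: weight_def divide_le_eq_1)
qed

lemma (in separable_cms) selected_points: "selected S xs F \<subseteq> points S"
  by (auto simp: selected_def)

text \<open>Only an inequality, since positions outside \<open>F\<close> may list points of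
  \<open>A\<close> as well.\<close>

lemma (in separable_cms) weight_le_measure:
  assumes "xs \<noteq> []" "A \<in> sets (borel_cms S)" "selected S xs F \<subseteq> A"
  shows "weight xs F \<le> measure (dirac_mean S xs) A"
  unfolding measure_dirac_mean[OF assms(1,2)] freq_def weight_def
  using assms(3) by (intro divide_right_mono of_nat_mono card_mono) (auto simp: selected_def)

section \<open>Masses of rectangles in a product\<close>

locale cms_pair = S: separable_cms S + T: separable_cms T
  for S :: "'a cms" and T :: "'b cms"
begin

sublocale ST: separable_cms "S \<times>\<^sub>m T"
  by (rule separable_prod_cms) unfold_locales

sublocale PS: separable_cms "prob_cms S"
  by (rule S.separable_prob_cms)

sublocale PST: separable_cms "prob_cms (S \<times>\<^sub>m T)"
  by (rule ST.separable_prob_cms)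

lemma fst_lipschitz:
  "fst \<in> points (S \<times>\<^sub>m T) \<rightarrow> points S" "metr S (fst x) (fst y) \<le> metr (S \<times>\<^sub>m T) x y"
  using metr_prod_ge(1)[OF S.separable_cms_axioms T.separable_cms_axioms, of "fst x" "fst y" "snd x" "snd y"]
  by (auto simp: points_prod_cms)

lemma snd_lipschitz:
  "snd \<in> points (S \<times>\<^sub>m T) \<rightarrow> points T" "metr T (snd x) (snd y) \<le> metr (S \<times>\<^sub>m T) x y"
  using metr_prod_ge(2)[OF S.separable_cms_axioms T.separable_cms_axioms, where t = "snd y" and s = "snd x"
      and a = "fst x" and b = "fst y"]
  by (auto simp: points_prod_cms)

lemma measurable_fst: "fst \<in> borel_cms (S \<times>\<^sub>m T) \<rightarrow>\<^sub>M borel_cms S"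
  by (rule lipschitz_measurable[OF ST.separable_cms_axioms S.separable_cms_axioms fst_lipschitz])

lemma measurable_snd: "snd \<in> borel_cms (S \<times>\<^sub>m T) \<rightarrow>\<^sub>M borel_cms T"
  by (rule lipschitz_measurable[OF ST.separable_cms_axioms T.separable_cms_axioms snd_lipschitz])

lemma rectangle_eq:
  assumes "A \<subseteq> points S" "B \<subseteq> points T"
  shows "A \<times> B = (fst -` A \<inter> points (S \<times>\<^sub>m T)) \<inter> (snd -` B \<inter> points (S \<times>\<^sub>m T))"
  using assms by (auto simp: points_prod_cms)

lemma rectangle_borel:
  assumes "A \<in> sets (borel_cms S)" "B \<in> sets (borel_cms T)"
  shows "A \<times> B \<in> sets (borel_cms (S \<times>\<^sub>m T))"
  using measurable_sets[OF measurable_fst assms(1)] measurable_sets[OF measurable_snd assms(2)] assms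
  by (subst rectangle_eq) (auto dest: S.sets_borel_cms_subset T.sets_borel_cms_subset)

text \<open>The product metric dominates both component metrics; for the ball, the triangle
  inequality adds the radii.\<close>

lemma neighbourhood_rectangle:
  "neighbourhood (S \<times>\<^sub>m T) d (A \<times> T.mball c r) \<subseteq> neighbourhood S d A \<times> T.mball c (r + d)"
proof
  fix z assume "z \<in> neighbourhood (S \<times>\<^sub>m T) d (A \<times> T.mball c r)"
  then obtain a s b t where z: "z = (b, t)" "b \<in> points S" "t \<in> points T" "a \<in> A" "s \<in> T.mball c r"
      and d: "metr (S \<times>\<^sub>m T) (a, s) (b, t) < d"
    by (auto simp: neighbourhood_def points_prod_cms)
  have "metr S a b < d" "metr T s t < d"
    using fst_lipschitz(2)[of "(a, s)" "(b, t)"] snd_lipschitz(2)[of "(a, s)" "(b, t)"] d by auto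
  moreover have "metr T c t \<le> metr T c s + metr T s t"
    using z by (intro T.triangle) auto
  ultimately show "z \<in> neighbourhood S d A \<times> T.mball c (r + d)"
    using z by (auto simp: neighbourhood_def)
qed

text \<open>The step by which averages pass between a measure and its approximations, at the price
  of enlarging both sides of the rectangle and of the mass \<open>d\<close>.\<close>

lemma measure_rectangle_le:
  assumes cl: "ST.close d m m'" and m': "m' \<in> prob_measures (S \<times>\<^sub>m T)"
    and A: "A \<in> sets (borel_cms S)" and B: "B \<in> sets (borel_cms S)" "neighbourhood S d A \<subseteq> B"
  shows "measure m (A \<times> T.mball c r) \<le> measure m' (B \<times> T.mball c (r + d)) + d"
proof -
  have "measure m (A \<times> T.mball c r) \<le> measure m' (neighbourhood (S \<times>\<^sub>m T) d (A \<times> T.mball c r)) + d"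
    using cl rectangle_borel[OF A T.open_in_borel[OF T.openin_mball]] by (auto simp: ST.close_def)
  also have "measure m' (neighbourhood (S \<times>\<^sub>m T) d (A \<times> T.mball c r)) \<le> measure m' (B \<times> T.mball c (r + d))"
    using neighbourhood_rectangle[of d A c r] B
    by (intro ST.measure_mono_prob[OF m'] rectangle_borel T.open_in_borel T.openin_mball) auto
  finally show ?thesis by simp
qed

end

section \<open>Averages of a continuous disintegration over balls of the base\<close>

locale continuous_disintegration = cms_pair S T
  for S :: "'a cms" and T :: "'b cms" +
  fixes \<mu> :: "('a \<times> 'b) measure" and \<kappa> :: "'b \<Rightarrow> ('a \<times> 'b) measure"
  assumes \<mu>: "\<mu> \<in> prob_measures (S \<times>\<^sub>m T)"
    and support: "measure_support T (distr \<mu> (borel_cms T) snd) = points T"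
    and disint: "disintegration (S \<times>\<^sub>m T) T snd \<mu> \<kappa>"
    and continuous: "continuous_map (topology_cms T) (topology_cms (prob_cms (S \<times>\<^sub>m T))) \<kappa>"
begin

definition fibre :: "'b \<Rightarrow> 'a measure" where
  "fibre t = distr (\<kappa> t) (borel_cms S) fst"

definition base :: "'b measure" where
  "base = distr \<mu> (borel_cms T) snd"

lemma base: "base \<in> prob_measures T"
  unfolding base_def by (rule distr_prob_measures[OF ST.separable_cms_axioms \<mu> measurable_snd])

lemma kappa: "t \<in> points T \<Longrightarrow> \<kappa> t \<in> prob_measures (S \<times>\<^sub>m T)"
  using disint measurable_space[of \<kappa> "borel_cms T" "borel_cms (prob_cms (S \<times>\<^sub>m T))" t]
  by (simp add: disintegration_def ST.points_prob_cms)

lemma fibre: "t \<in> points T \<Longrightarrow> fibre t \<in> prob_measures S"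
  unfolding fibre_def by (rule distr_prob_measures[OF ST.separable_cms_axioms kappa measurable_fst])

text \<open>Disintegrate over \<open>A \<times> points T\<close>: there the kernel is seen through
  its first marginal, which is what the operator returns.\<close>

lemma emeasure_rectangle:
  assumes A: "A \<in> sets (borel_cms S)" and B: "B \<in> sets (borel_cms T)"
  shows "emeasure \<mu> (A \<times> B) = (\<integral>\<^sup>+t\<in>B. ennreal (measure (fibre t) A) \<partial>base)"
proof -
  have BT: "B \<subseteq> points T" using B by (rule T.sets_borel_cms_subset)
  have A1: "A \<times> points T \<in> sets (borel_cms (S \<times>\<^sub>m T))"
    using rectangle_borel[OF A sets.top[of "borel_cms T"]] by simp
  have "A \<times> B = snd -` B \<inter> (A \<times> points T)" using BT by auto
  then have "emeasure \<mu> (A \<times> B) = emeasure \<mu> (snd -` B \<inter> (A \<times> points T))" by (rule arg_cong)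
  also have "\<dots> = (\<integral>\<^sup>+t\<in>B. emeasure (\<kappa> t) (A \<times> points T) \<partial>base)"
    using disint A1 B unfolding disintegration_def base_def by blast
  also have "\<dots> = (\<integral>\<^sup>+t\<in>B. ennreal (measure (fibre t) A) \<partial>base)"
  proof (rule nn_integral_cong)
    fix t assume "t \<in> space base"
    then have t: "t \<in> points T" by (simp add: base_def)
    interpret F: prob_space "fibre t" using S.prob_measuresD(1)[OF fibre[OF t]] .
    have "fst \<in> \<kappa> t \<rightarrow>\<^sub>M borel_cms S"
      using measurable_fst by (simp add: ST.prob_measuresD[OF kappa[OF t]] cong: measurable_cong_sets)
    then have "emeasure (fibre t) A = emeasure (\<kappa> t) (fst -` A \<inter> space (\<kappa> t))"
      unfolding fibre_def using A by (rule emeasure_distr)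
    also have "fst -` A \<inter> space (\<kappa> t) = A \<times> points T"
      using S.sets_borel_cms_subset[OF A] by (auto simp: ST.prob_measuresD[OF kappa[OF t]] points_prod_cms)
    finally show "emeasure (\<kappa> t) (A \<times> points T) * indicator B t =
        ennreal (measure (fibre t) A) * indicator B t"
      by (simp add: F.emeasure_eq_measure)
  qed
  finally show ?thesis .
qed

lemma measure_rectangle_ge:
  assumes A: "A \<in> sets (borel_cms S)" and B: "B \<in> sets (borel_cms T)"
    and le: "\<And>t. t \<in> B \<Longrightarrow> v \<le> measure (fibre t) A" and v: "v \<ge> 0"
  shows "v * measure base B \<le> measure \<mu> (A \<times> B)"
proof -
  interpret M: prob_space \<mu> using ST.prob_measuresD(1)[OF \<mu>] .
  interpret N: prob_space base using T.prob_measuresD(1)[OF base] .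
  have "ennreal (v * measure base B) = (\<integral>\<^sup>+t. ennreal v * indicator B t \<partial>base)"
    using nn_integral_cmult_indicator[of B base "ennreal v"] B v
    by (simp add: T.prob_measuresD[OF base] N.emeasure_eq_measure ennreal_mult)
  also have "\<dots> \<le> (\<integral>\<^sup>+t\<in>B. ennreal (measure (fibre t) A) \<partial>base)"
    using le by (intro nn_integral_mono) (auto simp: indicator_def intro: ennreal_leI)
  also have "\<dots> = ennreal (measure \<mu> (A \<times> B))"
    using emeasure_rectangle[OF A B] by (simp add: M.emeasure_eq_measure)
  finally show ?thesis by simp
qed

lemma measure_rectangle_le_base:
  assumes A: "A \<in> sets (borel_cms S)" and B: "B \<in> sets (borel_cms T)"
    and le: "\<And>t. t \<in> B \<Longrightarrow> measure (fibre t) A \<le> v" and v: "v \<ge> 0"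
  shows "measure \<mu> (A \<times> B) \<le> v * measure base B"
proof -
  interpret M: prob_space \<mu> using ST.prob_measuresD(1)[OF \<mu>] .
  interpret N: prob_space base using T.prob_measuresD(1)[OF base] .
  have "ennreal (measure \<mu> (A \<times> B)) = (\<integral>\<^sup>+t\<in>B. ennreal (measure (fibre t) A) \<partial>base)"
    using emeasure_rectangle[OF A B] by (simp add: M.emeasure_eq_measure)
  also have "\<dots> \<le> (\<integral>\<^sup>+t. ennreal v * indicator B t \<partial>base)"
    using le by (intro nn_integral_mono) (auto simp: indicator_def intro: ennreal_leI)
  also have "\<dots> = ennreal (v * measure base B)"
    using nn_integral_cmult_indicator[of B base "ennreal v"] B v
    by (simp add: T.prob_measuresD[OF base] N.emeasure_eq_measure ennreal_mult)
  finally show ?thesis using v by simp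
qed

lemma measure_points_rectangle:
  assumes B: "B \<in> sets (borel_cms T)"
  shows "measure \<mu> (points S \<times> B) = measure base B"
proof -
  have "snd \<in> \<mu> \<rightarrow>\<^sub>M borel_cms T"
    using measurable_snd by (simp add: ST.prob_measuresD[OF \<mu>] cong: measurable_cong_sets)
  then have "measure base B = measure \<mu> (snd -` B \<inter> space \<mu>)"
    unfolding base_def using B by (rule measure_distr)
  also have "snd -` B \<inter> space \<mu> = points S \<times> B"
    using T.sets_borel_cms_subset[OF B] by (auto simp: ST.prob_measuresD[OF \<mu>] points_prod_cms)
  finally show ?thesis by simp
qed

lemma fibre_continuous:
  assumes t: "t \<in> points T" and e: "e > 0"
  obtains d where "d > 0" "\<And>s. s \<in> T.mball t d \<Longrightarrow> metr (prob_cms S) (fibre t) (fibre s) < e"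
proof -
  have "\<exists>d>0. \<forall>s. s \<in> points T \<and> metr T t s < d \<longrightarrow> metr (prob_cms (S \<times>\<^sub>m T)) (\<kappa> t) (\<kappa> s) < e / 2"
    using continuous t half_gt_zero[OF e] unfolding topology_cms_def
    by (subst (asm) T.metric_continuous_map[OF PST.metric]) blast
  then obtain d where d: "d > 0"
    "\<And>s. s \<in> points T \<Longrightarrow> metr T t s < d \<Longrightarrow> metr (prob_cms (S \<times>\<^sub>m T)) (\<kappa> t) (\<kappa> s) < e / 2"
    by blast
  have "metr (prob_cms S) (fibre t) (fibre s) < e" if "s \<in> T.mball t d" for s
  proof -
    have s: "s \<in> points T" "metr T t s < d" using that by auto
    have "ST.close (e/2) (\<kappa> t) (\<kappa> s)"
      using d(2)[OF s] kappa t s by (intro ST.prob_dist_less_imp_close(1)) auto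
    then have "S.close (e/2) (fibre t) (fibre s)"
      unfolding fibre_def using kappa t s
      by (intro close_distr[OF ST.separable_cms_axioms S.separable_cms_axioms fst_lipschitz]) auto
    then have "metr (prob_cms S) (fibre t) (fibre s) \<le> e/2"
      using e fibre t s by (intro S.prob_dist_le) auto
    then show ?thesis using e by simp
  qed
  with d(1) show thesis by (rule that)
qed

lemma base_ball_pos:
  assumes "c \<in> points T" "r > 0"
  shows "measure base (T.mball c r) > 0"
proof -
  interpret N: prob_space base using T.prob_measuresD(1)[OF base] .
  have "emeasure base (T.mball c r) > 0"
    using support assms T.openin_mball[of c r]
    unfolding measure_support_def base_def T.topology_cms by auto
  then show ?thesis by (simp add: N.emeasure_eq_measure)
qed

text \<open>An open ball is the increasing union of smaller concentric ones. Enlarged radii would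
  lead to the closed ball, whose mass may be greater; this is why the tests shrink radii.\<close>

lemma base_ball_tendsto:
  assumes "\<And>n. d (Suc n) \<le> d n" "d \<longlonglongrightarrow> 0" "\<And>n. d n > 0"
  shows "(\<lambda>n. measure base (T.mball c (r - d n))) \<longlonglongrightarrow> measure base (T.mball c r)"
proof -
  interpret N: prob_space base using T.prob_measuresD(1)[OF base] .
  have "(\<lambda>n. measure base (T.mball c (r - d n))) \<longlonglongrightarrow> measure base (\<Union>n. T.mball c (r - d n))"
  proof (rule N.finite_Lim_measure_incseq)
    show "range (\<lambda>n. T.mball c (r - d n)) \<subseteq> sets base"
      by (auto simp: T.prob_measuresD[OF base] intro: T.open_in_borel)
    show "incseq (\<lambda>n. T.mball c (r - d n))"
      using assms(1) by (intro incseq_SucI T.mball_subset_concentric) simp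
  qed
  also have "(\<Union>n. T.mball c (r - d n)) = T.mball c r"
  proof
    show "(\<Union>n. T.mball c (r - d n)) \<subseteq> T.mball c r"
      using T.mball_subset_concentric[of "r - d _" r c] assms(3) by (auto simp: less_imp_le)
    show "T.mball c r \<subseteq> (\<Union>n. T.mball c (r - d n))"
    proof
      fix t assume t: "t \<in> T.mball c r"
      then have "r - metr T c t > 0" by simp
      from order_tendstoD(2)[OF assms(2) this] obtain n where "d n < r - metr T c t"
        by (auto simp: eventually_sequentially)
      then show "t \<in> (\<Union>n. T.mball c (r - d n))" using t by (intro UN_I[of n]) auto
    qed
  qed
  finally show ?thesis .
qed

text \<open>An averaged inequality for \<open>\<mu>\<close> on the ball around \<open>c\<close> survives when \<open>\<mu>\<close> is replaced by a measure \<open>m\<close>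
  at Prokhorov distance less than \<open>d\<close>, provided that the balls are shrunk and the sets enlarged by
  multiples of \<open>d\<close>.\<close>

lemma average_test_complete:
  assumes m: "m \<in> prob_measures (S \<times>\<^sub>m T)" "ST.close d m \<mu>" "ST.close d \<mu> m" and d: "d > 0"
    and xs: "xs \<noteq> []"
    and near: "\<And>t. t \<in> T.mball c r \<Longrightarrow> metr (prob_cms S) (dirac_mean S xs) (fibre t) < e"
  shows "(weight xs F - e) * measure m (points S \<times> T.mball c (r - 3 * d)) \<le>
    measure m (neighbourhood S (e + d) (selected S xs F) \<times> T.mball c (r - d)) + 2 * d"
proof (cases "weight xs F - e \<ge> 0 \<and> T.mball c (r - 2 * d) \<noteq> {}")
  case True
  \<comment> \<open>Both sides are compared with the base mass of the ball of radius
    \<open>r - 2 * d\<close>: closeness leads from \<open>r - 3 * d\<close> up to it, and from it up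
    to \<open>r - d\<close>. Each passage costs the mass \<open>d\<close>, the former multiplied by
    \<open>?v \<le> 1\<close>.\<close>
  let ?v = "weight xs F - e" and ?B = "T.mball c (r - 2 * d)"
  have v1: "?v \<le> 1"
  proof -
    obtain t where t: "t \<in> ?B" using True by blast
    then have "t \<in> T.mball c r" using T.mball_subset_concentric[of "r - 2 * d" r c] d by auto
    then have "0 < e" using near PS.nonneg by (metis le_less_trans)
    then show ?thesis using weight_le_1[of xs F] by simp
  qed
  have nb: "neighbourhood S x (selected S xs F) \<in> sets (borel_cms S)" for x
    by (intro S.open_in_borel S.openin_neighbourhood S.selected_points)
  have "?v * measure base ?B \<le> measure \<mu> (neighbourhood S e (selected S xs F) \<times> ?B)"
  proof (rule measure_rectangle_ge[OF nb])
    fix t assume t: "t \<in> ?B"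
    then have tr: "t \<in> T.mball c r" using T.mball_subset_concentric[of "r - 2 * d" r c] d by auto
    then have tT: "t \<in> points T" by auto
    \<comment> \<open>The strict gap \<open>e - e'\<close> allows the selected points to be replaced
      by an open set around them; the two enlargements add up to \<open>e\<close>.\<close>
    obtain e' where e': "metr (prob_cms S) (dirac_mean S xs) (fibre t) < e'" "e' < e"
      using near[OF tr] dense by blast
    have "S.close e' (dirac_mean S xs) (fibre t)"
      using e'(1) by (rule S.prob_dist_less_imp_close(1)) (intro S.dirac_mean_prob_measures xs fibre tT)+
    then have "measure (dirac_mean S xs) (neighbourhood S (e - e') (selected S xs F)) \<le>
        measure (fibre t) (neighbourhood S e' (neighbourhood S (e - e') (selected S xs F))) + e'"
      using nb by (auto simp: S.close_def)
    moreover have "weight xs F \<le> measure (dirac_mean S xs) (neighbourhood S (e - e') (selected S xs F))"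
      using e' by (intro S.weight_le_measure xs nb S.subset_neighbourhood S.selected_points) simp
    moreover have "measure (fibre t) (neighbourhood S e' (neighbourhood S (e - e') (selected S xs F))) \<le>
        measure (fibre t) (neighbourhood S e (selected S xs F))"
      using S.neighbourhood_add[OF S.selected_points, of e' "e - e'" xs F]
      by (intro S.measure_mono_prob[OF fibre[OF tT]] nb) simp
    ultimately show "?v \<le> measure (fibre t) (neighbourhood S e (selected S xs F))"
      using e' by simp
  qed (use True in \<open>auto intro: T.open_in_borel\<close>)
  also have "\<dots> \<le> measure m (neighbourhood S (e + d) (selected S xs F) \<times> T.mball c (r - 2 * d + d)) + d"
    by (intro measure_rectangle_le m nb S.neighbourhood_add S.selected_points)
  also have "r - 2 * d + d = r - d" by simp
  finally have 1: "?v * measure base ?B \<le>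
    measure m (neighbourhood S (e + d) (selected S xs F) \<times> T.mball c (r - d)) + d" .
  have pS: "points S \<in> sets (borel_cms S)" using sets.top[of "borel_cms S"] by simp
  have "measure m (points S \<times> T.mball c (r - 3 * d)) \<le> measure \<mu> (points S \<times> T.mball c (r - 3 * d + d)) + d"
    by (intro measure_rectangle_le m \<mu> pS) (auto simp: neighbourhood_def)
  also have "r - 3 * d + d = r - 2 * d" by simp
  also have "measure \<mu> (points S \<times> ?B) = measure base ?B"
    by (intro measure_points_rectangle T.open_in_borel) auto
  finally have "?v * measure m (points S \<times> T.mball c (r - 3 * d)) \<le> ?v * (measure base ?B + d)"
    using True by (intro mult_left_mono) auto
  also have "\<dots> \<le> ?v * measure base ?B + d"
    using v1 d mult_right_mono[of ?v 1 d] by (simp add: distrib_left)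
  finally show ?thesis using 1 by simp
next
  case False
  have "measure m (points S \<times> T.mball c (r - 3 * d)) = 0 \<or> weight xs F - e < 0"
  proof (cases "weight xs F - e \<ge> 0")
    case True
    then have "T.mball c (r - 2 * d) = {}" using False by simp
    then have "T.mball c (r - 3 * d) = {}"
      using T.mball_subset_concentric[of "r - 3 * d" "r - 2 * d" c] d by simp
    then show ?thesis by simp
  qed auto
  then have "(weight xs F - e) * measure m (points S \<times> T.mball c (r - 3 * d)) \<le> 0"
    by (auto simp: mult_nonpos_nonneg)
  then show ?thesis using d by (smt (verit) measure_nonneg)
qed

text \<open>If the fibre over \<open>t\<close> violated the Prokhorov condition at
  \<open>2 * e\<close> for the positions in \<open>F\<close>, continuity would spread a violation to
  a small ball around a dense point. The tests on that ball, with \<open>d k\<close> tending to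
  \<open>0\<close>, bound \<open>?v\<close> times its mass by \<open>?v - e / 2\<close> times its
  mass, although the mass is positive. The second \<open>e\<close> pays for the variation of the
  fibres and for the enlargements by \<open>d k\<close>.\<close>

lemma average_test_sound:
  assumes m: "\<And>k. m k \<in> prob_measures (S \<times>\<^sub>m T)" "\<And>k. ST.close (d k) (m k) \<mu>" "\<And>k. ST.close (d k) \<mu> (m k)"
    and d: "\<And>k. d k > 0" "\<And>k. d (Suc k) \<le> d k" "d \<longlonglongrightarrow> 0"
    and xs: "xs \<noteq> []" and e: "e > 0"
    and test: "\<And>k F j b. metr T (dense T j) c + (1/2) ^ b \<le> r \<Longrightarrow>
      (weight xs F - e) * measure (m k) (points S \<times> T.mball (dense T j) ((1/2) ^ b - 3 * d k)) \<le>
      measure (m k) (neighbourhood S (e + d k) (selected S xs F) \<times> T.mball (dense T j) ((1/2) ^ b - d k)) + 2 * d k"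
    and t: "t \<in> T.mball c r"
  shows "metr (prob_cms S) (dirac_mean S xs) (fibre t) \<le> 2 * e"
proof (rule S.prob_dist_le)
  have tT: "t \<in> points T" and cT: "c \<in> points T" and tr: "metr T c t < r" using t by auto
  show "dirac_mean S xs \<in> prob_measures S" "fibre t \<in> prob_measures S" "2 * e > 0"
    using xs e fibre[OF tT] by (auto intro: S.dirac_mean_prob_measures)
  have pS: "points S \<in> sets (borel_cms S)" using sets.top[of "borel_cms S"] by simp
  have nb: "neighbourhood S x (selected S xs F) \<in> sets (borel_cms S)" for x F
    by (intro S.open_in_borel S.openin_neighbourhood S.selected_points)
  have key: "weight xs F - 2 * e \<le> measure (fibre t) (neighbourhood S (2 * e) (selected S xs F))" for F
  proof (rule ccontr)
    let ?N = "\<lambda>x. neighbourhood S x (selected S xs F)" and ?v = "weight xs F - e"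
    assume "\<not> ?thesis"
    then have less: "measure (fibre t) (?N (2 * e)) < ?v - e" by simp
    then have v: "?v > e" using measure_nonneg[of "fibre t" "?N (2 * e)"] by linarith
    obtain h where h: "h > 0" "\<And>s. s \<in> T.mball t h \<Longrightarrow> metr (prob_cms S) (fibre t) (fibre s) < e / 2"
      using fibre_continuous[OF tT, of "e / 2"] e by auto
    \<comment> \<open>Within distance \<open>g\<close> of \<open>t\<close> the fibres vary by less
      than \<open>e / 2\<close>, and the ball around \<open>c\<close> is not left. Half of
      \<open>g\<close> goes to the radius \<open>(1/2) ^ b\<close>, half to the distance of the
      centre.\<close>
    define g where "g = min h (r - metr T c t)"
    have g: "g > 0" using h tr by (simp add: g_def)
    obtain b where b: "(1/2) ^ b < g / 2" using real_arch_pow_inv[of "g / 2" "1/2"] g by auto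
    obtain j where j: "metr T t (dense T j) < g / 2" using T.ex_dense[OF tT, of "g / 2"] g by auto
    let ?c = "dense T j" and ?r = "(1/2 :: real) ^ b"
    let ?J = "T.mball ?c ?r"
    have "metr T ?c c + ?r \<le> metr T c t + metr T t ?c + ?r"
      using T.triangle[of c t ?c] cT tT by (simp add: T.commute)
    also have "\<dots> \<le> r" using j b by (simp add: g_def)
    finally have inside: "metr T ?c c + ?r \<le> r" .
    have J: "metr (prob_cms S) (fibre t) (fibre s) < e / 2" "s \<in> points T" if "s \<in> ?J" for s
    proof -
      have "metr T t s \<le> metr T t ?c + metr T ?c s" using that tT by (intro T.triangle) auto
      also have "\<dots> < h" using that j b by (simp add: g_def)
      finally have "s \<in> T.mball t h" using that tT by simp
      then show "metr (prob_cms S) (fibre t) (fibre s) < e / 2" "s \<in> points T"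
        by (rule h) (use that in simp)
    qed
    \<comment> \<open>Passing from \<open>s\<close> to \<open>t\<close> costs \<open>e / 2\<close>
      both in radius and in mass, whence \<open>3 * e / 2\<close> here and the bound
      \<open>?v - e / 2\<close>.\<close>
    have upper: "measure \<mu> (?N (3 * e / 2) \<times> ?J) \<le> (?v - e / 2) * measure base ?J"
    proof (rule measure_rectangle_le_base[OF nb])
      fix s assume s: "s \<in> ?J"
      have "S.close (e / 2) (fibre s) (fibre t)"
        using J[OF s] fibre tT by (intro S.prob_dist_less_imp_close(2)) auto
      then have "measure (fibre s) (?N (3 * e / 2)) \<le>
          measure (fibre t) (neighbourhood S (e / 2) (?N (3 * e / 2))) + e / 2"
        using nb by (auto simp: S.close_def)
      also have "measure (fibre t) (neighbourhood S (e / 2) (?N (3 * e / 2))) \<le> measure (fibre t) (?N (2 * e))"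
        using S.neighbourhood_add[OF S.selected_points, of "e / 2" "3 * e / 2" xs F]
        by (intro S.measure_mono_prob[OF fibre[OF tT]] nb) simp
      finally show "measure (fibre s) (?N (3 * e / 2)) \<le> ?v - e / 2" using less by simp
    qed (use v e in \<open>auto intro: T.open_in_borel\<close>)
    \<comment> \<open>With \<open>d k \<le> e / 4\<close>, the two enlargements of \<open>e\<close>
      by \<open>d k\<close> stay within \<open>3 * e / 2\<close>. Closeness leads from the radius
      \<open>?r - 4 * d k\<close> to the tested one.\<close>
    have bound: "?v * (measure base (T.mball ?c (?r - 4 * d k)) - d k) \<le> (?v - e / 2) * measure base ?J + 3 * d k"
      if k: "d k \<le> e / 4" for k
    proof -
      have "measure base (T.mball ?c (?r - 4 * d k)) = measure \<mu> (points S \<times> T.mball ?c (?r - 4 * d k))"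
        by (intro measure_points_rectangle[symmetric] T.open_in_borel) auto
      also have "\<dots> \<le> measure (m k) (points S \<times> T.mball ?c (?r - 4 * d k + d k)) + d k"
        by (intro measure_rectangle_le m pS) (auto simp: neighbourhood_def)
      also have "?r - 4 * d k + d k = ?r - 3 * d k" by simp
      finally have "?v * (measure base (T.mball ?c (?r - 4 * d k)) - d k) \<le>
          ?v * measure (m k) (points S \<times> T.mball ?c (?r - 3 * d k))"
        using v e by (intro mult_left_mono) auto
      also have "\<dots> \<le> measure (m k) (?N (e + d k) \<times> T.mball ?c (?r - d k)) + 2 * d k"
        by (rule test[OF inside])
      also have "measure (m k) (?N (e + d k) \<times> T.mball ?c (?r - d k)) \<le>
          measure \<mu> (?N (e + d k + d k) \<times> T.mball ?c (?r - d k + d k)) + d k"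
        by (intro measure_rectangle_le m \<mu> nb S.neighbourhood_add S.selected_points)
      also have "?r - d k + d k = ?r" by simp
      also have "measure \<mu> (?N (e + d k + d k) \<times> ?J) \<le> measure \<mu> (?N (3 * e / 2) \<times> ?J)"
        using k by (intro ST.measure_mono_prob[OF \<mu>] Sigma_mono S.neighbourhood_mono rectangle_borel nb
          T.open_in_borel) auto
      also note upper
      finally show ?thesis by simp
    qed
    have lim: "(\<lambda>k. measure base (T.mball ?c (?r - 4 * d k))) \<longlonglongrightarrow> measure base ?J"
      using d tendsto_mult_right_zero[OF d(3), of 4] by (intro base_ball_tendsto) auto
    have "?v * (measure base ?J - 0) \<le> (?v - e / 2) * measure base ?J + 3 * 0"
    proof (rule tendsto_le)
      show "(\<lambda>k. ?v * (measure base (T.mball ?c (?r - 4 * d k)) - d k)) \<longlonglongrightarrow> ?v * (measure base ?J - 0)"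
        by (intro tendsto_intros lim d)
      show "(\<lambda>k. (?v - e / 2) * measure base ?J + 3 * d k) \<longlonglongrightarrow> (?v - e / 2) * measure base ?J + 3 * 0"
        by (intro tendsto_intros d)
      have "eventually (\<lambda>k. d k < e / 4) sequentially"
        using order_tendstoD(2)[OF d(3), of "e / 4"] e by simp
      then show "eventually (\<lambda>k. ?v * (measure base (T.mball ?c (?r - 4 * d k)) - d k) \<le>
          (?v - e / 2) * measure base ?J + 3 * d k) sequentially"
        by (rule eventually_mono) (intro bound, simp)
    qed simp
    then have "e / 2 * measure base ?J \<le> 0" by (simp add: algebra_simps)
    then show False using base_ball_pos[of ?c ?r] e by (simp add: mult_le_0_iff)
  qed
  show "S.close (2 * e) (dirac_mean S xs) (fibre t)"
    unfolding S.close_def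
  proof
    fix A assume A: "A \<in> sets (borel_cms S)"
    \<comment> \<open>The mean sees the Borel set \<open>A\<close> only through the positions that
      list a point of \<open>A\<close>, so finitely many \<open>F\<close> represent all Borel
      sets.\<close>
    define F where "F = cantor_code (\<lambda>h. dense S (xs ! h) \<in> A) (length xs)"
    have F: "bit F h \<longleftrightarrow> h < length xs \<and> dense S (xs ! h) \<in> A" for h
      by (simp add: F_def bit_cantor_code)
    have "measure (dirac_mean S xs) A = weight xs F"
      unfolding S.measure_dirac_mean[OF xs A] freq_def weight_def by (simp add: F)
    also have "\<dots> \<le> measure (fibre t) (neighbourhood S (2 * e) (selected S xs F)) + 2 * e"
      using key[of F] by simp
    also have "measure (fibre t) (neighbourhood S (2 * e) (selected S xs F)) \<le>
        measure (fibre t) (neighbourhood S (2 * e) A)"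
      by (intro S.measure_mono_prob[OF fibre[OF tT]] S.neighbourhood_borel A)
        (auto simp: neighbourhood_def selected_def F)
    finally show "measure (dirac_mean S xs) A \<le> measure (fibre t) (neighbourhood S (2 * e) A) + 2 * e" by simp
  qed
qed

end

section \<open>Disintegration is reducible to limits\<close>

text \<open>Exact rational distances between dense points make the comparisons in the tests
  decidable; distances known only as reals could not be compared effectively.\<close>

locale rational_cms = separable_cms S for S :: "'a cms" +
  assumes rrec_dense: "rrec (\<lambda>p x. metr S (dense S (pfst x)) (dense S (psnd x)))"
begin

lemma rrec_metr:
  assumes "recf F" "recf G"
  shows "rrec (\<lambda>p x. metr S (dense S (F p x)) (dense S (G p x)))"
  using rrec_comp[OF rrec_dense recf_pair[OF assms]] by simp

end

section \<open>Decidable tests for candidate values\<close>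

lemma freq_code:
  "freq (list_decode c) J =
    real (\<Sum>j<length (list_decode c). of_bool (nth_code c j \<in> J)) / real (length (list_decode c))"
proof -
  have "{j. j < length (list_decode c) \<and> list_decode c ! j \<in> J} =
      {..<length (list_decode c)} \<inter> {j. nth_code c j \<in> J}"
    by (auto simp: nth_code)
  then show ?thesis unfolding freq_def by (simp add: sum.If_cases of_bool_def)
qed

lemma rrec_freq [recf_intros]:
  assumes "recp (\<lambda>p z. P p (pfst z) (psnd z))" "recf C"
  shows "rrec (\<lambda>p x. freq (list_decode (C p x)) {z. P p x z})"
  unfolding freq_code mem_Collect_eq
  by (intro recf_intros assms recp_comp2[OF assms(1)] recf_comp[OF assms(2)])

lemma rrec_weight [recf_intros]:
  assumes "recf C" "recf F"
  shows "rrec (\<lambda>p x. weight (list_decode (C p x)) (F p x))"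
proof -
  have *: "weight (list_decode c) F =
      real (\<Sum>h<length (list_decode c). of_bool (bit F h)) / real (length (list_decode c))" for c F
  proof -
    have "{h. h < length (list_decode c) \<and> bit F h} = {..<length (list_decode c)} \<inter> {h. bit F h}" by auto
    then show ?thesis unfolding weight_def by (simp add: sum.If_cases of_bool_def)
  qed
  show ?thesis unfolding * by (intro recf_intros assms recf_comp[OF assms(1)] recf_comp[OF assms(2)])
qed

lemma recf_cantor_code [recf_intros]:
  assumes "recp (\<lambda>p z. X p (pfst z) (psnd z))" "recf N"
  shows "recf (\<lambda>p x. cantor_code (X p x) (N p x))"
  unfolding cantor_code_def by (intro recf_intros assms recp_comp2[OF assms(1)])

text \<open>The argument \<open>u\<close> is the index of an approximation to \<open>\<mu>\<close> at distance less than \<open>4 / 2 ^ k\<close>,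
  \<open>v\<close> that of a candidate value with error \<open>(1/2) ^ (n + 3)\<close> on the ball of radius \<open>(1/2) ^ a\<close>.\<close>

definition accept :: "'a cms \<Rightarrow> 'b cms \<Rightarrow> nat \<Rightarrow> nat \<Rightarrow> nat \<Rightarrow> nat \<Rightarrow> nat \<Rightarrow> nat \<Rightarrow> nat \<Rightarrow> nat \<Rightarrow> nat \<Rightarrow> bool" where
  "accept S T u n c a v k F j b \<longleftrightarrow>
    (metr T (dense T j) (dense T c) + (1/2) ^ b \<le> (1/2) ^ a \<longrightarrow>
     (weight (list_decode (Suc v)) F - (1/2) ^ (n + 4)) *
       freq (list_decode (Suc u)) {z. metr T (dense T j) (dense T (psnd z)) < (1/2) ^ b - 3 * (4 * (1/2) ^ k)} \<le>
     freq (list_decode (Suc u))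
       {z. (\<exists>h<length (list_decode (Suc v)). bit F h \<and>
             metr S (dense S (nth_code (Suc v) h)) (dense S (pfst z)) < (1/2) ^ (n + 4) + 4 * (1/2) ^ k) \<and>
           metr T (dense T j) (dense T (psnd z)) < (1/2) ^ b - 4 * (1/2) ^ k} + 2 * (4 * (1/2) ^ k))"

text \<open>\<open>i\<close> codes the candidate \<open>n\<close>, \<open>c\<close>,
  \<open>a\<close>, \<open>v\<close>, and \<open>s\<close> codes the instance \<open>k\<close>,
  \<open>F\<close>, \<open>j\<close>, \<open>b\<close> of its test. A candidate is accepted for a
  name \<open>p\<close> if all instances hold with \<open>u = p k\<close>.\<close>

definition accept_code :: "'a cms \<Rightarrow> 'b cms \<Rightarrow> nat \<Rightarrow> nat \<Rightarrow> nat \<Rightarrow> bool" where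
  "accept_code S T u i s = accept S T u (pfst i) (pfst (psnd i)) (pfst (psnd (psnd i))) (psnd (psnd (psnd i)))
     (pfst s) (pfst (psnd s)) (pfst (psnd (psnd s))) (psnd (psnd (psnd s)))"

lemma recp_accept_code:
  assumes "rational_cms S" "rational_cms T" "recf U" "recf I" "recf Q"
  shows "recp (\<lambda>p x. accept_code S T (U p x) (I p x) (Q p x))"
proof -
  interpret S: rational_cms S by fact
  interpret T: rational_cms T by fact
  show ?thesis
    unfolding accept_code_def accept_def
    by (intro recf_intros S.rrec_metr T.rrec_metr recf_comp[OF assms(3)] recf_comp[OF assms(4)]
        recf_comp[OF assms(5)] assms(3-5))
qed

context continuous_disintegration
begin

lemma measure_dense_rectangle:
  assumes "A \<in> sets (borel_cms S)"
  shows "measure (dense (prob_cms (S \<times>\<^sub>m T)) u) (A \<times> T.mball (dense T j) r) =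
    freq (list_decode (Suc u)) {z. dense S (pfst z) \<in> A \<and> metr T (dense T j) (dense T (psnd z)) < r}"
  using rectangle_borel[OF assms T.open_in_borel[OF T.openin_mball]] list_decode_Suc_neq_Nil
  unfolding ST.dense_prob_cms
  by (subst ST.measure_dirac_mean) (auto simp: dense_prod_cms simp del: list_decode.simps)

text \<open>Links the arithmetic on indices with averages of the approximating mean, for which a set
  matters only through the dense points it contains.\<close>

lemma accept_iff:
  "accept S T u n c a v k F j b \<longleftrightarrow>
    (metr T (dense T j) (dense T c) + (1/2) ^ b \<le> (1/2) ^ a \<longrightarrow>
     (weight (list_decode (Suc v)) F - (1/2) ^ (n + 4)) *
       measure (dense (prob_cms (S \<times>\<^sub>m T)) u)
         (points S \<times> T.mball (dense T j) ((1/2) ^ b - 3 * (4 * (1/2) ^ k))) \<le>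
     measure (dense (prob_cms (S \<times>\<^sub>m T)) u)
       (neighbourhood S ((1/2) ^ (n + 4) + 4 * (1/2) ^ k) (selected S (list_decode (Suc v)) F) \<times>
        T.mball (dense T j) ((1/2) ^ b - 4 * (1/2) ^ k)) + 2 * (4 * (1/2) ^ k))"
proof -
  have nb: "neighbourhood S x (selected S xs F) \<in> sets (borel_cms S)" for x xs F
    by (intro S.open_in_borel S.openin_neighbourhood S.selected_points)
  have pS: "points S \<in> sets (borel_cms S)" using sets.top[of "borel_cms S"] by simp
  have sel: "dense S z \<in> neighbourhood S x (selected S (list_decode (Suc v)) F) \<longleftrightarrow>
      (\<exists>h<length (list_decode (Suc v)). bit F h \<and> metr S (dense S (nth_code (Suc v) h)) (dense S z) < x)" for z x
  proof
    assume "dense S z \<in> neighbourhood S x (selected S (list_decode (Suc v)) F)"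
    then obtain h where "h < length (list_decode (Suc v))" "bit F h"
      "metr S (dense S (list_decode (Suc v) ! h)) (dense S z) < x"
      unfolding neighbourhood_def selected_def by blast
    then show "\<exists>h<length (list_decode (Suc v)). bit F h \<and> metr S (dense S (nth_code (Suc v) h)) (dense S z) < x"
      using nth_code[of h "Suc v"] by (intro exI[of _ h]) (simp del: list_decode.simps)
  next
    assume "\<exists>h<length (list_decode (Suc v)). bit F h \<and> metr S (dense S (nth_code (Suc v) h)) (dense S z) < x"
    then obtain h where h: "h < length (list_decode (Suc v))" "bit F h"
      "metr S (dense S (nth_code (Suc v) h)) (dense S z) < x" by blast
    have "dense S (list_decode (Suc v) ! h) \<in> selected S (list_decode (Suc v)) F"
      using h unfolding selected_def by blast
    then show "dense S z \<in> neighbourhood S x (selected S (list_decode (Suc v)) F)"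
      using h(3) nth_code[OF h(1)] unfolding neighbourhood_def by auto
  qed
  show ?thesis
    unfolding accept_def measure_dense_rectangle[OF nb] measure_dense_rectangle[OF pS] sel
    by (simp only: S.dense_points simp_thms)
qed

text \<open>Closeness is obtained from a strict bound on the distance, so the weak bound
  \<open>2 * (1/2) ^ k\<close> is doubled.\<close>

lemma close_name:
  assumes "cauchy_rep (prob_cms (S \<times>\<^sub>m T)) p = Some \<mu>"
  shows "dense (prob_cms (S \<times>\<^sub>m T)) (p k) \<in> prob_measures (S \<times>\<^sub>m T)"
    "ST.close (4 * (1/2) ^ k) (dense (prob_cms (S \<times>\<^sub>m T)) (p k)) \<mu>"
    "ST.close (4 * (1/2) ^ k) \<mu> (dense (prob_cms (S \<times>\<^sub>m T)) (p k))"
proof -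
  show m: "dense (prob_cms (S \<times>\<^sub>m T)) (p k) \<in> prob_measures (S \<times>\<^sub>m T)"
    using PST.dense_points[of "p k"] by (simp only: ST.points_prob_cms)
  have "metr (prob_cms (S \<times>\<^sub>m T)) (dense (prob_cms (S \<times>\<^sub>m T)) (p k)) \<mu> \<le> 2 * (1/2) ^ k"
    by (rule PST.cauchy_repD[OF assms])
  also have "\<dots> < 4 * (1/2) ^ k" by simp
  finally show "ST.close (4 * (1/2) ^ k) (dense (prob_cms (S \<times>\<^sub>m T)) (p k)) \<mu>"
    "ST.close (4 * (1/2) ^ k) \<mu> (dense (prob_cms (S \<times>\<^sub>m T)) (p k))"
    using m \<mu> by (auto intro: ST.prob_dist_less_imp_close)
qed

lemma accept_sound:
  assumes p: "cauchy_rep (prob_cms (S \<times>\<^sub>m T)) p = Some \<mu>"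
    and acc: "\<And>s. accept_code S T (p (pfst s)) (prod_encode (n, prod_encode (c, prod_encode (a, v)))) s"
    and t: "t \<in> T.mball (dense T c) ((1/2) ^ a)"
  shows "metr (prob_cms S) (dense (prob_cms S) v) (fibre t) \<le> (1/2) ^ (n + 3)"
proof -
  have "accept S T (p k) n c a v k F j b" for k F j b
    using acc[of "prod_encode (k, prod_encode (F, prod_encode (j, b)))"] by (simp add: accept_code_def)
  note acc' = this[unfolded accept_iff]
  have "metr (prob_cms S) (dirac_mean S (list_decode (Suc v))) (fibre t) \<le> 2 * (1/2) ^ (n + 4)"
  proof (rule average_test_sound[where d = "\<lambda>k. 4 * (1/2) ^ k" and m = "\<lambda>k. dense (prob_cms (S \<times>\<^sub>m T)) (p k)",
        OF close_name[OF p]])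
    show "(\<lambda>k. 4 * (1/2) ^ k) \<longlonglongrightarrow> (0::real)"
      using tendsto_mult_right_zero[OF LIMSEQ_power_zero[of "1/2::real"], of 4] by simp
  qed (use acc' t list_decode_Suc_neq_Nil in \<open>auto simp del: list_decode.simps\<close>)
  also have "2 * (1/2 :: real) ^ (n + 4) = (1/2) ^ (n + 3)"
    using power_Suc[of "1/2 :: real" "n + 3"] by (simp add: eval_nat_numeral)
  finally show ?thesis by (simp only: S.dense_prob_cms)
qed

lemma accept_complete:
  assumes p: "cauchy_rep (prob_cms (S \<times>\<^sub>m T)) p = Some \<mu>"
    and near: "\<And>t. t \<in> T.mball (dense T c) ((1/2) ^ a) \<Longrightarrow>
      metr (prob_cms S) (dense (prob_cms S) v) (fibre t) < (1/2) ^ (n + 4)"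
  shows "accept_code S T (p (pfst s)) (prod_encode (n, prod_encode (c, prod_encode (a, v)))) s"
proof -
  obtain k F j b where s: "s = prod_encode (k, prod_encode (F, prod_encode (j, b)))"
    by (metis prod.collapse prod_decode_inverse)
  have "accept S T (p k) n c a v k F j b"
    unfolding accept_iff
  proof (intro impI average_test_complete[OF close_name[OF p]] list_decode_Suc_neq_Nil)
    fix t assume inside: "metr T (dense T j) (dense T c) + (1/2) ^ b \<le> (1/2) ^ a"
      and t: "t \<in> T.mball (dense T j) ((1/2) ^ b)"
    have "t \<in> T.mball (dense T c) ((1/2) ^ a)"
      using T.mball_subset[OF inside] t by auto
    from near[OF this] show "metr (prob_cms S) (dirac_mean S (list_decode (Suc v))) (fibre t) < (1/2) ^ (n + 4)"
      by (simp only: S.dense_prob_cms)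
  qed simp
  then show ?thesis by (simp add: accept_code_def s)
qed

text \<open>By continuity the fibres over a small ball near \<open>t\<close> share an approximation
  \<open>v\<close>. The second conjunct certifies, from the single entry \<open>q j\<close>, that
  \<open>t\<close> lies in that ball; both conjuncts together make the search for a value
  terminate.\<close>

lemma ex_accept:
  assumes p: "cauchy_rep (prob_cms (S \<times>\<^sub>m T)) p = Some \<mu>" and q: "cauchy_rep T q = Some t"
  shows "\<exists>c a v j. (\<forall>s. accept_code S T (p (pfst s)) (prod_encode (n, prod_encode (c, prod_encode (a, v)))) s) \<and>
    metr T (dense T (q j)) (dense T c) + 2 * (1/2) ^ j < (1/2) ^ a"
proof -
  have t: "t \<in> points T" by (rule T.cauchy_repD[OF q])
  let ?e = "(1/2 :: real) ^ (n + 4)"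
  have e: "?e / 2 > 0" by simp
  obtain v where v: "metr (prob_cms S) (fibre t) (dense (prob_cms S) v) < ?e / 2"
    using PS.ex_dense[OF _ e] fibre[OF t] by (auto simp: S.points_prob_cms)
  obtain h where h: "h > 0" "\<And>s. s \<in> T.mball t h \<Longrightarrow> metr (prob_cms S) (fibre t) (fibre s) < ?e / 2"
    using fibre_continuous[OF t e] by blast
  obtain a where a: "(1/2) ^ a < h / 2" using real_arch_pow_inv[of "h / 2" "1/2"] h by auto
  obtain c where c: "metr T t (dense T c) < (1/2) ^ a" using T.ex_dense[OF t, of "(1/2) ^ a"] by auto
  have near: "metr (prob_cms S) (dense (prob_cms S) v) (fibre s) < ?e"
    if s: "s \<in> T.mball (dense T c) ((1/2) ^ a)" for s
  proof -
    have "metr T t s \<le> metr T t (dense T c) + metr T (dense T c) s" using s t by (intro T.triangle) auto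
    also have "\<dots> < h" using c a s by simp
    finally have "metr (prob_cms S) (fibre t) (fibre s) < ?e / 2" using s t by (intro h) auto
    moreover have "metr (prob_cms S) (dense (prob_cms S) v) (fibre s) \<le>
        metr (prob_cms S) (dense (prob_cms S) v) (fibre t) + metr (prob_cms S) (fibre t) (fibre s)"
      using s fibre t by (intro PS.triangle PS.dense_points) (auto simp: S.points_prob_cms)
    moreover have "metr (prob_cms S) (dense (prob_cms S) v) (fibre t) < ?e / 2"
      using v by (simp only: PS.commute)
    ultimately show ?thesis by linarith
  qed
  \<comment> \<open>The amount \<open>2 * (1/2) ^ j\<close> is spent twice: on the error of
    \<open>q j\<close> and on the margin in the certificate.\<close>
  obtain j where j: "(1/2) ^ j < ((1/2) ^ a - metr T t (dense T c)) / 4"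
    using real_arch_pow_inv[of "((1/2) ^ a - metr T t (dense T c)) / 4" "1/2"] c by auto
  have "metr T (dense T (q j)) (dense T c) \<le> metr T (dense T (q j)) t + metr T t (dense T c)"
    using t by (intro T.triangle) auto
  then have "metr T (dense T (q j)) (dense T c) + 2 * (1/2) ^ j < (1/2) ^ a"
    using T.cauchy_repD(2)[OF q, of j] j by argo
  then show ?thesis using accept_complete[OF p near] by blast
qed

end

theorem disintegration_op_le_lim_op:
  fixes S :: "'a cms" and T :: "'b cms"
  assumes S: "rational_cms S" and T: "rational_cms T"
  shows "disintegration_op S T \<le>\<^sub>s\<^sub>W lim_op cantor_cms"
proof -
  interpret S: rational_cms S by fact
  interpret T: rational_cms T by fact
  interpret cms_pair S T ..
  \<comment> \<open>Digit \<open>i\<close> stays true until some instance below the stage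
    \<open>s\<close> refutes the candidate. It changes at most once, so the limit exists and is the
    truth value of the universal statement.\<close>
  define X where "X p s = (\<lambda>i. \<forall>s'<s. accept_code S T (p (pfst s')) i s')" for p :: baire and s
  \<comment> \<open>The stage arrives at the odd positions as a string of zeros ended by a one; the
    search recovers it.\<close>
  have "\<exists>n. \<forall>r. (\<forall>k::nat. \<exists>m. r (2 * m + 1) \<noteq> 0) \<longrightarrow>
      machine n r = Some (\<lambda>k. cantor_code (X (\<lambda>l. r (2 * l)) (LEAST m. r (2 * m + 1) \<noteq> 0)) (k + 2))"
    unfolding X_def
    by (rule machine_search[where P = "\<lambda>r k m. r (2 * m + 1) \<noteq> 0" and
          F = "\<lambda>r k m. cantor_code (\<lambda>i. \<forall>s'<m. accept_code S T (r (2 * pfst s')) i s') (k + 2)"])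
      (intro recf_intros recp_accept_code[OF S T])+
  then obtain n1 where n1: "\<forall>r. (\<forall>k::nat. \<exists>m. r (2 * m + 1) \<noteq> 0) \<longrightarrow>
      machine n1 r = Some (\<lambda>k. cantor_code (X (\<lambda>l. r (2 * l)) (LEAST m. r (2 * m + 1) \<noteq> 0)) (k + 2))" ..
  \<comment> \<open>Digit \<open>i\<close> of the limit is read at entry \<open>i + 2\<close> of its
    name, as in \<open>cauchy_rep_cantorD\<close>; the odd positions hold the name of the base
    point. The witness \<open>w\<close> codes \<open>j\<close>, \<open>c\<close>, \<open>a\<close>,
    \<open>v\<close>.\<close>
  define found where "found r n w \<longleftrightarrow> bit (r (2 * (prod_encode (n, psnd w) + 2))) (prod_encode (n, psnd w)) \<and>
      metr T (dense T (r (2 * pfst w + 1))) (dense T (pfst (psnd w))) + 2 * (1/2) ^ pfst w <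
        (1/2) ^ pfst (psnd (psnd w))" for r :: baire and n w
  have "\<exists>n. \<forall>r. (\<forall>k. \<exists>w. found r k w) \<longrightarrow>
      machine n r = Some (\<lambda>k. psnd (psnd (psnd (LEAST w. found r k w))))"
    unfolding found_def by (rule machine_search) (intro recf_intros T.rrec_metr)+
  then obtain n0 where "\<forall>r. (\<forall>k. \<exists>w. found r k w) \<longrightarrow>
      machine n0 r = Some (\<lambda>k. psnd (psnd (psnd (LEAST w. found r k w))))" ..
  note n0 = this[rule_format]
  \<comment> \<open>\<open>H\<close> merely prefixes the answer with a fixed machine number, so it
    depends on nothing but the answer.\<close>
  define H K where "H = (\<lambda>q. Some (tagged n0 q))" and "K = (\<lambda>p. Some (tagged n1 p))"
  have "computable H" "computable K"
    unfolding H_def K_def by (intro computable_recf recf_intros)+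
  moreover have "(H \<circ>\<^sub>m G \<circ>\<^sub>m K) \<turnstile>\<^sub>r disintegration_op S T" if G: "G \<turnstile>\<^sub>r lim_op cantor_cms" for G
    unfolding realizer_def
  proof (intro allI impI, elim conjE)
    fix p \<mu> assume "src (disintegration_op S T) p = Some \<mu>" and "val (disintegration_op S T) \<mu> \<noteq> {}"
    then have p: "cauchy_rep (prob_cms (S \<times>\<^sub>m T)) p = Some \<mu>" and
      "\<exists>\<kappa>. \<mu> \<in> prob_measures (S \<times>\<^sub>m T) \<and>
       measure_support T (distr \<mu> (borel_cms T) snd) = points T \<and>
       disintegration (S \<times>\<^sub>m T) T snd \<mu> \<kappa> \<and>
       continuous_map (topology_cms T) (topology_cms (prob_cms (S \<times>\<^sub>m T))) \<kappa>"
      by (auto simp: disintegration_op_def)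
    then obtain \<kappa> where "continuous_disintegration S T \<mu> \<kappa>"
      by (auto intro!: continuous_disintegration.intro cms_pair_axioms continuous_disintegration_axioms.intro)
    then interpret continuous_disintegration S T \<mu> \<kappa> .
    define x where "x i \<longleftrightarrow> (\<forall>s. accept_code S T (p (pfst s)) i s)" for i
    have Xp: "fun_rep nat_rep (cauchy_rep cantor_cms) (tagged n1 p) = Some (X p)"
    proof (rule fun_repI)
      fix q s assume "nat_rep q = Some s"
      then have q: "q = tagged s (\<lambda>_. 0)" by (simp add: nat_rep_eq_Some_iff)
      have odd: "interleave p q (2 * m + 1) \<noteq> 0 \<longleftrightarrow> m = s" for m
        by (simp add: interleave_def q tagged_def)
      have even: "(\<lambda>l. interleave p q (2 * l)) = p" by (simp add: interleave_def)
      have "machine n1 (interleave p q) = Some (\<lambda>k. cantor_code (X p s) (k + 2))"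
        using n1[rule_format, of "interleave p q"] Least_equality[of "\<lambda>m. m = s" s]
        unfolding odd even by simp
      then show "\<exists>q'. machine n1 (interleave p q) = Some q' \<and> cauchy_rep cantor_cms q' = Some (X p s)"
        using cauchy_rep_cantor_code by blast
    qed (simp add: ran_nat_rep)
    have lim: "limitin (topology_cms cantor_cms) (X p) x sequentially"
      unfolding limitin_cantor_iff
    proof
      fix i
      show "\<forall>\<^sub>F s in sequentially. X p s i = x i"
      proof (cases "x i")
        case False
        then obtain s where "\<not> accept_code S T (p (pfst s)) i s" by (auto simp: x_def)
        then have "\<not> X p s' i" if "s' > s" for s' using that by (auto simp: X_def)
        then show ?thesis using False by (auto simp: eventually_sequentially intro!: exI[of _ "Suc s"])
      qed (auto simp: X_def x_def)
    qed
    have "src (lim_op cantor_cms) (tagged n1 p) = Some (X p) \<and> val (lim_op cantor_cms) (X p) \<noteq> {}"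
      using Xp lim by (auto simp: lim_op_def)
    then obtain q y where q: "G (tagged n1 p) = Some q" "tgt (lim_op cantor_cms) q = Some y"
      "y \<in> val (lim_op cantor_cms) (X p)"
      using G unfolding realizer_def by meson
    then have y: "cauchy_rep cantor_cms q = Some y" "limitin (topology_cms cantor_cms) (X p) y sequentially"
      by (simp_all add: lim_op_def)
    have "y = x"
    proof
      fix i
      have "\<forall>\<^sub>F s in sequentially. X p s i = x i \<and> X p s i = y i"
        using eventually_conj[OF spec[OF lim[unfolded limitin_cantor_iff], of i]
            spec[OF y(2)[unfolded limitin_cantor_iff], of i]] by simp
      from eventually_happens'[OF sequentially_bot this] show "y i = x i" by auto
    qed
    with y have x: "x i \<longleftrightarrow> bit (q (i + 2)) i" for i by (intro cauchy_rep_cantorD) simp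
    define \<phi> where "\<phi> = (\<lambda>t\<in>points T. fibre t)"
    have "(H \<circ>\<^sub>m G \<circ>\<^sub>m K) p = Some (tagged n0 q)"
      by (simp add: H_def K_def q)
    moreover have "fun_rep (cauchy_rep T) (cauchy_rep (prob_cms S)) (tagged n0 q) = Some \<phi>"
    proof (rule fun_repI)
      fix tn t assume tn: "cauchy_rep T tn = Some t"
      have t: "t \<in> points T" by (rule T.cauchy_repD[OF tn])
      let ?r = "interleave q tn"
      have found_iff: "found ?r n w \<longleftrightarrow> x (prod_encode (n, psnd w)) \<and>
          metr T (dense T (tn (pfst w))) (dense T (pfst (psnd w))) + 2 * (1/2) ^ pfst w <
            (1/2) ^ pfst (psnd (psnd w))" for n w
        unfolding found_def x by (simp add: interleave_def)
      have ex: "\<exists>w. found ?r n w" for n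
      proof -
        obtain c a v j where
          "\<forall>s. accept_code S T (p (pfst s)) (prod_encode (n, prod_encode (c, prod_encode (a, v)))) s"
          "metr T (dense T (tn j)) (dense T c) + 2 * (1/2) ^ j < (1/2) ^ a"
          using ex_accept[OF p tn, of n] by blast
        then have "found ?r n (prod_encode (j, prod_encode (c, prod_encode (a, v))))"
          by (simp add: found_iff x_def)
        then show ?thesis ..
      qed
      define w where "w n = (LEAST w. found ?r n w)" for n
      have "metr (prob_cms S) (dense (prob_cms S) (psnd (psnd (psnd (w n))))) (fibre t) < (1/2) ^ Suc n" for n
      proof -
        obtain j c a v where wn: "w n = prod_encode (j, prod_encode (c, prod_encode (a, v)))"
          by (metis prod.collapse prod_decode_inverse)
        have "found ?r n (w n)" unfolding w_def using ex by (rule LeastI_ex)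
        then have acc: "x (prod_encode (n, prod_encode (c, prod_encode (a, v))))"
          and d: "metr T (dense T (tn j)) (dense T c) + 2 * (1/2) ^ j < (1/2) ^ a"
          by (simp_all add: found_iff wn)
        have "metr T (dense T c) t \<le> metr T (dense T (tn j)) (dense T c) + metr T (dense T (tn j)) t"
          using t by (metis T.commute T.dense_points T.triangle)
        then have "t \<in> T.mball (dense T c) ((1/2) ^ a)"
          using t d T.cauchy_repD(2)[OF tn, of j] by simp
        then have "metr (prob_cms S) (dense (prob_cms S) v) (fibre t) \<le> (1/2) ^ (n + 3)"
          using acc by (intro accept_sound[OF p]) (auto simp: x_def)
        also have "\<dots> < (1/2 :: real) ^ Suc n" by (rule power_strict_decreasing) auto
        finally show ?thesis by (simp add: wn)
      qed
      then have "cauchy_rep (prob_cms S) (\<lambda>n. psnd (psnd (psnd (w n)))) = Some (\<phi> t)"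
        using t fibre by (intro PS.cauchy_repI) (auto simp: \<phi>_def S.points_prob_cms)
      then show "\<exists>q'. machine n0 ?r = Some q' \<and> cauchy_rep (prob_cms S) q' = Some (\<phi> t)"
        using n0[of ?r, OF ex] unfolding w_def by blast
    qed (simp add: \<phi>_def T.ran_cauchy_rep)
    moreover have "\<phi> \<in> val (disintegration_op S T) \<mu>"
      using \<mu> support disint continuous
      by (auto simp: disintegration_op_def \<phi>_def fibre_def intro!: exI[of _ \<kappa>])
    ultimately show "\<exists>q y. (H \<circ>\<^sub>m G \<circ>\<^sub>m K) p = Some q \<and> tgt (disintegration_op S T) q = Some y \<and>
        y \<in> val (disintegration_op S T) \<mu>"
      by (intro exI[of _ "tagged n0 q"] exI[of _ \<phi>]) (simp add: disintegration_op_def)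
  qed
  ultimately show ?thesis unfolding sW_reducible_def by blast
qed

section \<open>Limits are reducible to disintegration\<close>

subsection \<open>Base four expansions\<close>

definition enc4 :: "(nat \<Rightarrow> bool) \<Rightarrow> nat \<Rightarrow> real" where
  "enc4 x n = (\<Sum>i<n. of_bool (x i) * (1/4) ^ Suc i)"

lemma enc4_Suc: "enc4 x (Suc n) = enc4 x n + of_bool (x n) * (1/4) ^ Suc n"
  by (simp add: enc4_def)

lemma enc4_cong: "(\<And>i. i < n \<Longrightarrow> x i = y i) \<Longrightarrow> enc4 x n = enc4 y n"
  by (simp add: enc4_def)

lemma enc4_tail: "enc4 x n \<le> enc4 x (n + k) \<and> enc4 x (n + k) \<le> enc4 x n + ((1/4) ^ n - (1/4) ^ (n + k)) / 3"
proof (induction k)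
  case (Suc k)
  define y where "y = (1/4 :: real) ^ (n + k)"
  have y: "y \<ge> 0" by (simp add: y_def)
  have 1: "enc4 x (n + Suc k) = enc4 x (n + k) + of_bool (x (n + k)) * (y / 4)"
    by (simp add: enc4_Suc y_def)
  have 2: "(1/4) ^ (n + Suc k) = y / 4" by (simp add: y_def)
  have "enc4 x n \<le> enc4 x (n + k)" "enc4 x (n + k) \<le> enc4 x n + ((1/4) ^ n - y) / 3"
    using Suc by (auto simp: y_def)
  moreover have "0 \<le> of_bool (x (n + k)) * (y / 4)" "of_bool (x (n + k)) * (y / 4) \<le> y / 4"
    using y by auto
  ultimately show ?case unfolding 1 2 by argo
qed simp

lemma enc4_bounds: "0 \<le> enc4 x n" "enc4 x n \<le> 1"
proof -
  have "(1/4 :: real) ^ n \<ge> 0" "enc4 x 0 = 0" by (simp_all add: enc4_def)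
  then show "0 \<le> enc4 x n" "enc4 x n \<le> 1"
    using enc4_tail[of x 0 n] unfolding add_0 power_0 by argo+
qed

text \<open>Distinct truncations differ by at least one unit in the last place. In the induction,
  dropping the last digits changes the difference by at most \<open>(1/4) ^ Suc n\<close>, and twice
  that is below \<open>(1/4) ^ n\<close>.\<close>

lemma enc4_digits:
  assumes "\<bar>enc4 x n - enc4 y n\<bar> < (1/4) ^ n" "i < n"
  shows "x i = y i"
  using assms
proof (induction n arbitrary: i)
  case (Suc n)
  have "\<bar>enc4 x n - enc4 y n\<bar> < (1/4) ^ n"
    using Suc.prems(1) by (cases "x n"; cases "y n") (auto simp: enc4_Suc abs_if split: if_splits)
  then have IH: "x i = y i" if "i < n" for i using Suc.IH that by blast
  then have "enc4 x n = enc4 y n" by (rule enc4_cong)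
  then have "x n = y n"
    using Suc.prems(1) by (cases "x n"; cases "y n") (auto simp: enc4_Suc)
  then show ?case using IH Suc.prems(2) by (cases "i = n") auto
qed simp

text \<open>Once the first \<open>n\<close> digits have settled, all later values stay within the
  tail bound of \<open>enc4 x n\<close>. Truncation at \<open>k\<close> makes every term a finite
  sum.\<close>

lemma enc4_limit:
  assumes "\<And>i. eventually (\<lambda>k. X k i = x i) sequentially"
  obtains L where "(\<lambda>k. enc4 (X k) k) \<longlonglongrightarrow> L" "\<And>n. \<bar>L - enc4 x n\<bar> \<le> (1/4) ^ n / 3"
proof -
  have ev: "eventually (\<lambda>k. \<bar>enc4 (X k) k - enc4 x n\<bar> \<le> (1/4) ^ n / 3) sequentially" for n
  proof -
    have "eventually (\<lambda>k. \<forall>i\<in>{..<n}. X k i = x i) sequentially"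
      using assms by (intro eventually_ball_finite) auto
    then show ?thesis
      using eventually_ge_at_top[of n]
    proof eventually_elim
      case (elim k)
      have "enc4 (X k) n = enc4 x n" using elim(1) by (intro enc4_cong) auto
      moreover have "(0::real) \<le> (1/4) ^ k" by simp
      ultimately show ?case using enc4_tail[of "X k" n "k - n"] elim(2)
        by (simp only: le_add_diff_inverse abs_le_iff) argo
    qed
  qed
  have "Cauchy (\<lambda>k. enc4 (X k) k)"
    unfolding Cauchy_def
  proof (intro allI impI)
    fix e :: real assume "e > 0"
    then obtain n where n: "(1/4) ^ n < e" using real_arch_pow_inv[of e "1/4"] by auto
    obtain N where N: "\<And>k. k \<ge> N \<Longrightarrow> \<bar>enc4 (X k) k - enc4 x n\<bar> \<le> (1/4) ^ n / 3"
      using ev[of n] by (auto simp: eventually_sequentially)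
    have "dist (enc4 (X k) k) (enc4 (X l) l) < e" if "k \<ge> N" "l \<ge> N" for k l
      using N[OF that(1)] N[OF that(2)] n \<open>e > 0\<close> unfolding dist_real_def by linarith
    then show "\<exists>N. \<forall>k\<ge>N. \<forall>l\<ge>N. dist (enc4 (X k) k) (enc4 (X l) l) < e" by blast
  qed
  then obtain L where L: "(\<lambda>k. enc4 (X k) k) \<longlonglongrightarrow> L"
    using Cauchy_convergent_iff convergentD by blast
  have "\<bar>L - enc4 x n\<bar> \<le> (1/4) ^ n / 3" for n
    by (rule tendsto_upperbound[OF tendsto_rabs[OF tendsto_diff[OF L tendsto_const]] ev]) simp
  then show thesis using that L by blast
qed

subsection \<open>Interpolation\<close>

text \<open>The piecewise linear function through the points \<open>(N, r N)\<close>, written as a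
  sum of ramps and constant beyond \<open>B\<close>. In this form it is rational for rational
  data.\<close>

definition interp :: "(nat \<Rightarrow> real) \<Rightarrow> nat \<Rightarrow> real \<Rightarrow> real" where
  "interp r B u = r 0 + (\<Sum>N<B. (r (Suc N) - r N) * max 0 (min 1 (u - real N)))"

lemma interp_eq:
  assumes "real M \<le> u" "u \<le> real M + 1" "M < B"
  shows "interp r B u = (1 - (u - real M)) * r M + (u - real M) * r (Suc M)"
proof -
  have "Suc M \<le> B" using assms(3) by simp
  then show ?thesis
  proof (induction B rule: dec_induct)
    case base
    have "(\<Sum>N<M. (r (Suc N) - r N) * max 0 (min 1 (u - real N))) = (\<Sum>N<M. r (Suc N) - r N)"
    proof (rule sum.cong)
      fix N assume "N \<in> {..<M}"
      then have "real N + 1 \<le> u" using assms(1) by (simp add: less_eq_real_def) linarith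
      then show "(r (Suc N) - r N) * max 0 (min 1 (u - real N)) = r (Suc N) - r N" by simp
    qed simp
    also have "\<dots> = r M - r 0" by (rule sum_lessThan_telescope)
    finally show ?case using assms(1,2) by (simp add: interp_def algebra_simps)
  next
    case (step B)
    have "u - real B \<le> 0" using assms(2) step.hyps by linarith
    then show ?case using step.IH by (simp add: interp_def)
  qed
qed

locale interpolation =
  fixes r :: "nat \<Rightarrow> real" and L :: real
  assumes r01: "0 \<le> r n" "r n \<le> 1" and lim: "r \<longlonglongrightarrow> L"
begin

definition h :: "real \<Rightarrow> real" where
  "h t = (if t \<le> 0 then L else interp r (Suc (nat \<lfloor>1 / t\<rfloor>)) (1 / t))"

lemma h_0: "h 0 = L"
  by (simp add: h_def)

lemma h_interp:
  assumes "t > 0" "1 / t < real B"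
  shows "h t = interp r B (1 / t)"
proof -
  let ?M = "nat \<lfloor>1 / t\<rfloor>"
  have M: "real ?M \<le> 1 / t" "1 / t \<le> real ?M + 1" using assms(1) by (auto simp: less_imp_le)
  have "?M < B" using M(1) assms(2) by linarith
  then show ?thesis
    using assms(1) interp_eq[OF M] by (simp add: h_def)
qed

lemma h_convex:
  assumes "0 < t" "real M \<le> 1 / t" "1 / t \<le> real M + 1"
  shows "h t \<ge> min (r M) (r (Suc M))" "h t \<le> max (r M) (r (Suc M))"
proof -
  let ?f = "1 / t - real M"
  have f: "0 \<le> ?f" "?f \<le> 1" using assms by auto
  have "h t = interp r (Suc (Suc M)) (1 / t)" using assms by (intro h_interp) auto
  also have "\<dots> = (1 - ?f) * r M + ?f * r (Suc M)" by (rule interp_eq) (use assms in auto)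
  finally have h: "h t = (1 - ?f) * r M + ?f * r (Suc M)" .
  have "(1 - ?f) * min (r M) (r (Suc M)) + ?f * min (r M) (r (Suc M)) \<le> h t"
    unfolding h using f by (intro add_mono mult_left_mono) auto
  then show "h t \<ge> min (r M) (r (Suc M))" by (simp add: algebra_simps)
  have "h t \<le> (1 - ?f) * max (r M) (r (Suc M)) + ?f * max (r M) (r (Suc M))"
    unfolding h using f by (intro add_mono mult_left_mono) auto
  then show "h t \<le> max (r M) (r (Suc M))" by (simp add: algebra_simps)
qed

lemma h01: "0 \<le> h t" "h t \<le> 1"
proof -
  have "0 \<le> h t \<and> h t \<le> 1"
  proof (cases "t \<le> 0")
    case True
    have "0 \<le> L" by (rule LIMSEQ_le_const[OF lim]) (use r01 in auto)
    moreover have "L \<le> 1" by (rule LIMSEQ_le_const2[OF lim]) (use r01 in auto)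
    ultimately show ?thesis using True by (simp add: h_def)
  next
    case False
    have "real (nat \<lfloor>1 / t\<rfloor>) \<le> 1 / t" "1 / t \<le> real (nat \<lfloor>1 / t\<rfloor>) + 1"
      using False by (auto simp: less_imp_le)
    then show ?thesis
      using h_convex[of t "nat \<lfloor>1 / t\<rfloor>"] False r01
        min.boundedI[OF r01(1) r01(1), of "nat \<lfloor>1 / t\<rfloor>" "Suc (nat \<lfloor>1 / t\<rfloor>)"]
        max.boundedI[OF r01(2) r01(2), of "nat \<lfloor>1 / t\<rfloor>" "Suc (nat \<lfloor>1 / t\<rfloor>)"]
      by linarith
  qed
  then show "0 \<le> h t" "h t \<le> 1" by auto
qed

text \<open>Positive arguments below \<open>1 / (N + 1)\<close> see only convex combinations of
  values \<open>r n\<close> with \<open>n \<ge> N\<close>, which settles continuity at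
  \<open>0\<close>. Elsewhere a fixed bound \<open>B\<close> gives one continuous formula on
  \<open>{t/2..}\<close>.\<close>

lemma h_continuous:
  assumes t: "0 \<le> t" and e: "e > 0"
  shows "\<exists>d>0. \<forall>s\<ge>0. \<bar>t - s\<bar> < d \<longrightarrow> \<bar>h t - h s\<bar> < e"
proof (cases "t = 0")
  case True
  have "eventually (\<lambda>n. dist (r n) L < e) sequentially" using lim e by (rule tendstoD)
  then obtain N where N: "\<And>n. n \<ge> N \<Longrightarrow> \<bar>r n - L\<bar> < e"
    by (auto simp: eventually_sequentially dist_real_def)
  have "\<bar>h t - h s\<bar> < e" if s: "s \<ge> 0" "\<bar>t - s\<bar> < 1 / (real N + 1)" for s
  proof (cases "s = 0")
    case False
    then have s0: "s > 0" "s < 1 / (real N + 1)" using s True by auto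
    let ?M = "nat \<lfloor>1 / s\<rfloor>"
    have M: "real ?M \<le> 1 / s" "1 / s \<le> real ?M + 1" using s0 by (auto simp: less_imp_le)
    have "real N + 1 < 1 / s" using s0 by (simp add: field_simps)
    then have "N \<le> ?M" using M(2) by linarith
    then have "\<bar>r ?M - L\<bar> < e" "\<bar>r (Suc ?M) - L\<bar> < e" using N by auto
    then show ?thesis using h_convex[OF s0(1) M] by (simp add: True h_0) linarith
  qed (use e True in simp)
  then show ?thesis by (intro exI[of _ "1 / (real N + 1)"]) auto
next
  case False
  then have t0: "t > 0" using t by simp
  obtain B :: nat where B: "2 / t < real B" by (rule reals_Archimedean2[THEN exE])
  have "continuous_on {t/2..} (\<lambda>s. interp r B (1 / s))"
    unfolding interp_def using t0 by (intro continuous_intros) auto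
  then have "\<exists>d>0. \<forall>s\<in>{t/2..}. dist s t < d \<longrightarrow> dist (interp r B (1 / s)) (interp r B (1 / t)) < e"
    using t0 e unfolding continuous_on_iff by (metis atLeast_iff field_sum_of_halves le_add_same_cancel1 less_eq_real_def half_gt_zero)
  then obtain d where d: "d > 0"
    "\<And>s. s \<ge> t/2 \<Longrightarrow> \<bar>s - t\<bar> < d \<Longrightarrow> \<bar>interp r B (1 / s) - interp r B (1 / t)\<bar> < e"
    by (auto simp: dist_real_def)
  have hB: "h s = interp r B (1 / s)" if "s \<ge> t/2" for s
  proof (rule h_interp)
    show "s > 0" using that t0 by simp
    have "1 / s \<le> 2 / t" using that t0 by (simp add: field_simps)
    then show "1 / s < real B" using B by simp
  qed
  have "\<bar>h t - h s\<bar> < e" if "\<bar>t - s\<bar> < min d (t/2)" for s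
  proof -
    have "s \<ge> t/2" using that by linarith
    then show ?thesis using d(2)[of s] hB[of s] hB[of t] t0 that by (simp add: abs_minus_commute)
  qed
  then show ?thesis using d(1) t0 by (intro exI[of _ "min d (t/2)"]) auto
qed

end

subsection \<open>A measure encoding a limit\<close>

lemma in_unit_interval: "t \<in> points unit_interval_cms \<longleftrightarrow> 0 \<le> t \<and> t \<le> 1"
  by (simp add: points_unit_interval)

lemma rational_unit_interval_cms: "rational_cms unit_interval_cms"
proof (intro rational_cms.intro rational_cms_axioms.intro separable_unit_interval_cms)
  show "rrec (\<lambda>p x. metr unit_interval_cms (dense unit_interval_cms (pfst x)) (dense unit_interval_cms (psnd x)))"
    unfolding metr_unit_interval dense_unit_interval by (intro recf_intros)
qed

lemma rational_nat_cms: "rational_cms nat_cms"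
proof (intro rational_cms.intro rational_cms_axioms.intro separable_nat_cms)
  have "rrec (\<lambda>p x. if pfst x = psnd x then 0 else 1)" by (intro recf_intros)
  then show "rrec (\<lambda>p x. metr nat_cms (dense nat_cms (pfst x)) (dense nat_cms (psnd x)))"
    by (simp add: nat_cms_def)
qed

text \<open>Two dense points at distance one exist in \<open>nat_cms\<close> as well as in
  \<open>unit_interval_cms\<close>, so one construction serves both operators.\<close>

locale two_point_cms = rational_cms S for S :: "'a cms" +
  fixes a b :: nat
  assumes ab: "metr S (dense S a) (dense S b) = 1"
begin

sublocale cms_pair S unit_interval_cms
  by (intro cms_pair.intro separable_cms_axioms separable_unit_interval_cms)

end

definition tau :: "nat \<Rightarrow> nat" where
  "tau k = prod_encode (Suc (pfst k), psnd k)"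

text \<open>The points \<open>atom k\<close> are dense in \<open>[0,1]\<close> and avoid \<open>0\<close>, where the value of
  \<^term>\<open>interpolation.h\<close> is not computable.\<close>

definition atom :: "nat \<Rightarrow> real" where
  "atom k = dense unit_interval_cms (tau k)"

lemma atom_eq: "atom k = min 1 (real (Suc (pfst k)) / real (Suc (psnd k)))"
  by (simp add: atom_def tau_def dense_unit_interval)

lemma atom_bounds: "0 < atom k" "atom k \<le> 1"
  by (simp_all add: atom_eq)

lemma inverse_atom: "1 / atom k = max 1 (real (Suc (psnd k)) / real (Suc (pfst k)))"
  by (auto simp: atom_eq min_def max_def field_simps simp del: of_nat_Suc)

text \<open>Provides a bound for \<open>interp\<close> at \<open>1 / atom k\<close> that is
  computable from \<open>k\<close>.\<close>

lemma inverse_atom_less: "1 / atom k < real (psnd k + 2)"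
proof -
  have "real (Suc (psnd k)) / real (Suc (pfst k)) \<le> real (Suc (psnd k)) / 1"
    by (intro divide_left_mono) auto
  then show ?thesis by (simp add: inverse_atom)
qed

lemma ex_atom:
  assumes "0 \<le> t" "t \<le> 1" "e > 0"
  shows "\<exists>k. \<bar>t - atom k\<bar> < e"
proof -
  \<comment> \<open>A positive substitute for \<open>t\<close> is approximated so closely that the
    dense point found is positive, hence an atom.\<close>
  define t' where "t' = max t (min 1 (e / 2))"
  have t': "t' > 0" "t' \<le> 1" "\<bar>t - t'\<bar> \<le> e / 2" using assms by (auto simp: t'_def)
  obtain i where i: "\<bar>t' - dense unit_interval_cms i\<bar> < min (e / 2) t'"
    using separable_cms.ex_dense[OF separable_unit_interval_cms, of t' "min (e / 2) t'"] t' assms(3)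
    by (auto simp: points_unit_interval metr_unit_interval)
  then have "dense unit_interval_cms i > 0" by linarith
  then have "pfst i \<noteq> 0" by (auto simp: dense_unit_interval intro: ccontr)
  then have "tau (prod_encode (pfst i - 1, psnd i)) = i" by (simp add: tau_def)
  then have "atom (prod_encode (pfst i - 1, psnd i)) = dense unit_interval_cms i"
    by (simp only: atom_def)
  then have "\<bar>t - atom (prod_encode (pfst i - 1, psnd i))\<bar> < e"
    using i t'(3) by linarith
  then show ?thesis ..
qed

text \<open>An index \<open>z\<close> stands for the atom \<open>z div 2\<close> of the base
  together with the point chosen by the parity of \<open>z\<close>. Its probability will be
  \<open>mass r z\<close>, with the factor \<open>(1/2) ^ Suc k\<close> from the geometric
  distribution.\<close>

definition pcode :: "nat \<Rightarrow> nat \<Rightarrow> nat \<Rightarrow> nat" where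
  "pcode a b z = prod_encode (if odd z then b else a, tau (z div 2))"

definition mass :: "(nat \<Rightarrow> real) \<Rightarrow> nat \<Rightarrow> real" where
  "mass r z = (let k = z div 2;
      v = interp r (psnd k + 2) (max 1 (real (Suc (psnd k)) / real (Suc (pfst k))))
    in (1/2) ^ Suc k * (if odd z then v else 1 - v))"

section \<open>The joint measure and its continuous disintegration\<close>

locale coded_measure = two_point_cms S a b + interpolation r L
  for S :: "'a cms" and a b :: nat and r :: "nat \<Rightarrow> real" and L :: real
begin

abbreviation ST :: "('a \<times> real) cms" where "ST \<equiv> S \<times>\<^sub>m unit_interval_cms"

definition kernel :: "real \<Rightarrow> ('a \<times> real) measure" where
  "kernel t = distr (measure_pmf (bernoulli_pmf (h t))) (borel_cms ST)
     (\<lambda>c. (if c then dense S b else dense S a, t))"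

definition index_pmf :: "nat pmf" where
  "index_pmf = bind_pmf (geometric_pmf (1/2))
     (\<lambda>k. map_pmf (\<lambda>c. 2 * k + of_bool c) (bernoulli_pmf (h (atom k))))"

definition joint :: "('a \<times> real) measure" where
  "joint = distr (measure_pmf index_pmf) (borel_cms ST) (\<lambda>z. dense ST (pcode a b z))"

lemma emeasure_kernel:
  assumes "t \<in> points unit_interval_cms" "E \<in> sets (borel_cms ST)"
  shows "emeasure (kernel t) E =
    ennreal (h t * indicator E (dense S b, t) + (1 - h t) * indicator E (dense S a, t))"
proof -
  let ?M = "measure_pmf (bernoulli_pmf (h t))"
  have "emeasure (kernel t) E = emeasure ?M {c. (if c then dense S b else dense S a, t) \<in> E}"
    unfolding kernel_def using assms
    by (subst emeasure_distr) (auto simp: points_prod_cms in_unit_interval vimage_def)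
  also have "\<dots> = ennreal (measure ?M {c. (if c then dense S b else dense S a, t) \<in> E})"
    by (rule measure_pmf.emeasure_eq_measure)
  also have "measure ?M {c. (if c then dense S b else dense S a, t) \<in> E} =
      (\<Sum>c\<in>{c. (if c then dense S b else dense S a, t) \<in> E}. pmf (bernoulli_pmf (h t)) c)"
    by (rule measure_measure_pmf_finite) simp
  also have "\<dots> = (\<Sum>c\<in>UNIV. pmf (bernoulli_pmf (h t)) c * indicator E (if c then dense S b else dense S a, t))"
    by (intro sum.mono_neutral_cong_left) (auto simp: indicator_def)
  also have "\<dots> = h t * indicator E (dense S b, t) + (1 - h t) * indicator E (dense S a, t)"
    using h01[of t] by (simp add: UNIV_bool del: sum_mult_indicator)
  finally show ?thesis .
qed

lemma kernel_prob: "t \<in> points unit_interval_cms \<Longrightarrow> kernel t \<in> prob_measures ST"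
  unfolding prob_measures_def kernel_def
  by (auto intro!: measure_pmf.prob_space_distr simp: points_prod_cms in_unit_interval)

lemma measure_kernel:
  assumes "t \<in> points unit_interval_cms" "E \<in> sets (borel_cms ST)"
  shows "measure (kernel t) E = h t * indicator E (dense S b, t) + (1 - h t) * indicator E (dense S a, t)"
  unfolding measure_def emeasure_kernel[OF assms] using h01[of t] by (intro enn2real_ennreal) auto

lemma joint_prob: "joint \<in> prob_measures ST"
  unfolding prob_measures_def joint_def
  by (auto intro!: measure_pmf.prob_space_distr ST.dense_points)

lemma emeasure_joint:
  assumes E: "E \<in> sets (borel_cms ST)"
  shows "emeasure joint E = (\<integral>\<^sup>+k. emeasure (kernel (atom k)) E \<partial>geometric_pmf (1/2))"
proof -
  have "emeasure joint E = emeasure (measure_pmf index_pmf) {z. dense ST (pcode a b z) \<in> E}"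
    unfolding joint_def using E ST.dense_points by (subst emeasure_distr) (auto simp: vimage_def)
  also have "\<dots> = (\<integral>\<^sup>+k. emeasure (measure_pmf (bernoulli_pmf (h (atom k))))
      {c. (if c then dense S b else dense S a, atom k) \<in> E} \<partial>geometric_pmf (1/2))"
    unfolding index_pmf_def emeasure_bind_pmf
  proof (intro nn_integral_cong)
    fix k
    have "dense ST (pcode a b (2 * k + of_bool c)) = (if c then dense S b else dense S a, atom k)" for c
      by (simp add: pcode_def dense_prod_cms atom_def)
    then show "emeasure (measure_pmf (map_pmf (\<lambda>c. 2 * k + of_bool c) (bernoulli_pmf (h (atom k))))) {z. dense ST (pcode a b z) \<in> E} =
        emeasure (measure_pmf (bernoulli_pmf (h (atom k)))) {c. (if c then dense S b else dense S a, atom k) \<in> E}"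
      by (simp add: emeasure_map_pmf vimage_def)
  qed
  also have "\<dots> = (\<integral>\<^sup>+k. emeasure (kernel (atom k)) E \<partial>geometric_pmf (1/2))"
  proof (intro nn_integral_cong)
    fix k
    show "emeasure (measure_pmf (bernoulli_pmf (h (atom k)))) {c. (if c then dense S b else dense S a, atom k) \<in> E} =
        emeasure (kernel (atom k)) E"
      unfolding kernel_def using E atom_bounds[of k]
      by (subst emeasure_distr) (auto simp: points_prod_cms in_unit_interval vimage_def less_imp_le)
  qed
  finally show ?thesis .
qed

lemma kernel_snd:
  assumes "t \<in> points unit_interval_cms" "E \<in> sets (borel_cms ST)" "B \<in> sets (borel_cms unit_interval_cms)"
  shows "emeasure (kernel t) (snd -` B \<inter> E) = emeasure (kernel t) E * indicator B t"
proof -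
  have "snd -` B \<inter> points ST \<in> sets (borel_cms ST)"
    using measurable_sets[OF measurable_snd assms(3)] by simp
  moreover have "snd -` B \<inter> E = (snd -` B \<inter> points ST) \<inter> E"
    using ST.sets_borel_cms_subset[OF assms(2)] by auto
  ultimately have "snd -` B \<inter> E \<in> sets (borel_cms ST)" using assms(2) by simp
  then show ?thesis
    using assms by (simp add: emeasure_kernel) (auto simp: indicator_def)
qed

lemma atom_measurable: "atom \<in> measure_pmf M \<rightarrow>\<^sub>M borel_cms unit_interval_cms"
  using atom_bounds by (simp add: in_unit_interval less_imp_le)

lemma base_joint: "distr joint (borel_cms unit_interval_cms) snd =
    distr (measure_pmf (geometric_pmf (1/2))) (borel_cms unit_interval_cms) atom"
proof (rule measure_eqI)
  fix B assume "B \<in> sets (distr joint (borel_cms unit_interval_cms) snd)"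
  then have B: "B \<in> sets (borel_cms unit_interval_cms)" by simp
  have snd: "snd \<in> joint \<rightarrow>\<^sub>M borel_cms unit_interval_cms"
    using measurable_snd by (simp add: ST.prob_measuresD[OF joint_prob] cong: measurable_cong_sets)
  have pST: "points ST \<in> sets (borel_cms ST)" using sets.top[of "borel_cms ST"] by simp
  have "emeasure (distr joint (borel_cms unit_interval_cms) snd) B = emeasure joint (snd -` B \<inter> points ST)"
    using B snd by (subst emeasure_distr) (simp_all add: ST.prob_measuresD[OF joint_prob])
  also have "\<dots> = (\<integral>\<^sup>+k. emeasure (kernel (atom k)) (snd -` B \<inter> points ST) \<partial>geometric_pmf (1/2))"
    using measurable_sets[OF measurable_snd B] by (intro emeasure_joint) simp
  also have "\<dots> = (\<integral>\<^sup>+k. indicator (atom -` B) k \<partial>geometric_pmf (1/2))"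
  proof (intro nn_integral_cong)
    fix k
    have t: "atom k \<in> points unit_interval_cms" using atom_bounds[of k] by (simp add: in_unit_interval)
    interpret K: prob_space "kernel (atom k)" using ST.prob_measuresD(1)[OF kernel_prob[OF t]] .
    show "emeasure (kernel (atom k)) (snd -` B \<inter> points ST) = indicator (atom -` B) k"
      using kernel_snd[OF t pST B] K.emeasure_space_1 ST.prob_measuresD[OF kernel_prob[OF t]]
      by (simp add: indicator_def)
  qed
  also have "\<dots> = emeasure (measure_pmf (geometric_pmf (1/2))) (atom -` B)" by simp
  also have "\<dots> = emeasure (distr (measure_pmf (geometric_pmf (1/2))) (borel_cms unit_interval_cms) atom) B"
    using B atom_measurable by (subst emeasure_distr) auto
  finally show "emeasure (distr joint (borel_cms unit_interval_cms) snd) B =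
      emeasure (distr (measure_pmf (geometric_pmf (1/2))) (borel_cms unit_interval_cms) atom) B" .
qed simp

text \<open>Moving from \<open>t\<close> to \<open>s\<close> shifts both atoms by less than
  \<open>e / 2\<close> and changes their weights by at most \<open>e / 2\<close>; the Prokhorov
  condition absorbs both at once.\<close>

lemma kernel_continuous:
  "continuous_map (topology_cms unit_interval_cms) (topology_cms (prob_cms ST)) kernel"
  unfolding topology_cms_def T.metric_continuous_map[OF PST.metric]
proof (intro conjI ballI allI impI)
  show "kernel ` points unit_interval_cms \<subseteq> points (prob_cms ST)"
    using kernel_prob by (auto simp: ST.points_prob_cms)
  fix t e :: real assume t: "t \<in> points unit_interval_cms" and e: "e > 0"
  then obtain d where d: "d > 0" "\<And>s. s \<ge> 0 \<Longrightarrow> \<bar>t - s\<bar> < d \<Longrightarrow> \<bar>h t - h s\<bar> < e / 2"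
    using h_continuous[of t "e / 2"] by (auto simp: in_unit_interval)
  have "metr (prob_cms ST) (kernel t) (kernel s) < e" if s: "s \<in> points unit_interval_cms" "\<bar>t - s\<bar> < min d (e / 2)" for s
  proof -
    have "metr (prob_cms ST) (kernel t) (kernel s) \<le> e / 2"
    proof (rule ST.prob_dist_le)
      show "ST.close (e / 2) (kernel t) (kernel s)"
        unfolding ST.close_def
      proof
        fix E assume E: "E \<in> sets (borel_cms ST)"
        let ?N = "neighbourhood ST (e / 2) E"
        have ind: "indicator E (dense S i, t) \<le> (indicator ?N (dense S i, s) :: real)" for i
        proof -
          have "metr ST (dense S i, t) (dense S i, s) < e / 2"
            using s(2) ST.dense_points T.metric by (simp add: metr_prod_cms prod_dist_def metr_unit_interval)
          then have "(dense S i, t) \<in> E \<Longrightarrow> (dense S i, s) \<in> ?N"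
            using s by (auto simp: neighbourhood_def points_prod_cms in_unit_interval)
          then show ?thesis by (auto simp: indicator_def)
        qed
        have "\<bar>h t - h s\<bar> \<le> e / 2" using d(2)[of s] s by (simp add: in_unit_interval)
        moreover have "h t * indicator E (dense S b, t) + (1 - h t) * indicator E (dense S a, t) \<le>
            h t * indicator ?N (dense S b, s) + (1 - h t) * indicator ?N (dense S a, s)"
          using h01[of t] ind by (intro add_mono mult_left_mono) auto
        \<comment> \<open>The change is \<open>(h t - h s) * (y - z)\<close>, where
          \<open>y - z\<close> is at most one in absolute value.\<close>
        moreover have "h t * y + (1 - h t) * z \<le> h s * y + (1 - h s) * z + \<bar>h t - h s\<bar>"
          if "y \<in> {0, 1}" "z \<in> {0, 1}" for y z :: real
          using that by auto
        from this[of "indicator ?N (dense S b, s)" "indicator ?N (dense S a, s)"]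
        have "h t * indicator ?N (dense S b, s) + (1 - h t) * indicator ?N (dense S a, s) \<le>
            h s * indicator ?N (dense S b, s) + (1 - h s) * indicator ?N (dense S a, s) + \<bar>h t - h s\<bar>"
          by (auto simp: indicator_def)
        ultimately show "measure (kernel t) E \<le> measure (kernel s) ?N + e / 2"
          using t s E by (simp add: measure_kernel)
      qed
    qed (use t s e kernel_prob in auto)
    then show ?thesis using e by simp
  qed
  then show "\<exists>d>0. \<forall>s. s \<in> points unit_interval_cms \<and> metr unit_interval_cms t s < d \<longrightarrow>
      metr (prob_cms ST) (kernel t) (kernel s) < e"
    using d(1) e by (intro exI[of _ "min d (e / 2)"]) (auto simp: metr_unit_interval)
qed

lemma kernel_measurable: "kernel \<in> borel_cms unit_interval_cms \<rightarrow>\<^sub>M borel_cms (prob_cms ST)"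
proof (rule PST.measurable_borel_cms)
  show "kernel \<in> space (borel_cms unit_interval_cms) \<rightarrow> points (prob_cms ST)"
    using kernel_prob by (simp add: in_unit_interval ST.points_prob_cms)
  fix U assume "openin PST.mtopology U"
  then have "openin T.mtopology {x \<in> topspace T.mtopology. kernel x \<in> U}"
    using kernel_continuous unfolding T.topology_cms PST.topology_cms
    by (intro openin_continuous_map_preimage)
  then have "{x \<in> points unit_interval_cms. kernel x \<in> U} \<in> sets (borel_cms unit_interval_cms)"
    by (intro T.open_in_borel) simp
  also have "{x \<in> points unit_interval_cms. kernel x \<in> U} = kernel -` U \<inter> space (borel_cms unit_interval_cms)"
    by auto
  finally show "kernel -` U \<inter> space (borel_cms unit_interval_cms) \<in> sets (borel_cms unit_interval_cms)" .
qed

lemma h_measurable: "h \<in> borel_measurable (borel_cms unit_interval_cms)"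
proof (rule borel_measurableI)
  fix U :: "real set" assume U: "open U"
  have "openin T.mtopology (h -` U \<inter> points unit_interval_cms)"
    unfolding T.openin_mtopology
  proof (intro conjI allI impI)
    fix t assume t: "t \<in> h -` U \<inter> points unit_interval_cms"
    then obtain e where e: "e > 0" "\<And>y. dist y (h t) < e \<Longrightarrow> y \<in> U"
      using U unfolding open_dist by blast
    obtain d where d: "d > 0" "\<And>s. s \<ge> 0 \<Longrightarrow> \<bar>t - s\<bar> < d \<Longrightarrow> \<bar>h t - h s\<bar> < e"
      using h_continuous[of t e] t e(1) by (auto simp: in_unit_interval)
    have "T.mball t d \<subseteq> h -` U \<inter> points unit_interval_cms"
      using e(2) d(2) by (auto simp: in_unit_interval metr_unit_interval dist_real_def abs_minus_commute)
    then show "\<exists>d>0. T.mball t d \<subseteq> h -` U \<inter> points unit_interval_cms" using d(1) by blast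
  qed simp
  then show "h -` U \<inter> space (borel_cms unit_interval_cms) \<in> sets (borel_cms unit_interval_cms)"
    using T.open_in_borel by (simp add: in_unit_interval)
qed

lemma section_measurable:
  assumes "E \<in> sets (borel_cms ST)"
  shows "(\<lambda>t. indicator E (dense S i, t) :: real) \<in> borel_measurable (borel_cms unit_interval_cms)"
proof -
  have "(\<lambda>t. (dense S i, t)) \<in> borel_cms unit_interval_cms \<rightarrow>\<^sub>M borel_cms ST"
    by (rule lipschitz_measurable[OF T.separable_cms_axioms ST.separable_cms_axioms])
      (auto simp: points_prod_cms metr_prod_cms prod_dist_def metr_unit_interval)
  then show ?thesis using assms by (rule measurable_compose[OF _ borel_measurable_indicator])
qed

text \<open>The average over the atoms becomes an integral over the base by change of variables, for
  which \<open>h\<close> and the sections of \<open>E\<close> have to be measurable.\<close>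

lemma joint_disintegration: "disintegration ST unit_interval_cms snd joint kernel"
  unfolding disintegration_def
proof (intro conjI ballI kernel_measurable)
  fix E B assume E: "E \<in> sets (borel_cms ST)" and B: "B \<in> sets (borel_cms unit_interval_cms)"
  have sE: "snd -` B \<inter> E \<in> sets (borel_cms ST)"
  proof -
    have "snd -` B \<inter> E = (snd -` B \<inter> space (borel_cms ST)) \<inter> E"
      using ST.sets_borel_cms_subset[OF E] by auto
    then show ?thesis using measurable_sets[OF measurable_snd B] E by simp
  qed
  have t: "atom k \<in> points unit_interval_cms" for k using atom_bounds[of k] by (simp add: in_unit_interval)
  have "emeasure joint (snd -` B \<inter> E) = (\<integral>\<^sup>+k. emeasure (kernel (atom k)) (snd -` B \<inter> E) \<partial>geometric_pmf (1/2))"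
    by (rule emeasure_joint[OF sE])
  also have "\<dots> = (\<integral>\<^sup>+k. emeasure (kernel (atom k)) E * indicator B (atom k) \<partial>geometric_pmf (1/2))"
    using kernel_snd[OF t E B] by simp
  also have "\<dots> = (\<integral>\<^sup>+x. ennreal (h x * indicator E (dense S b, x) + (1 - h x) * indicator E (dense S a, x)) *
      indicator B x \<partial>distr (measure_pmf (geometric_pmf (1/2))) (borel_cms unit_interval_cms) atom)"
    using B h_measurable section_measurable[OF E]
    by (subst nn_integral_distr[OF atom_measurable]) (auto simp: emeasure_kernel[OF t E])
  also have "\<dots> = (\<integral>\<^sup>+x\<in>B. emeasure (kernel x) E \<partial>distr joint (borel_cms unit_interval_cms) snd)"
    unfolding base_joint by (intro nn_integral_cong) (simp add: emeasure_kernel[OF _ E] in_unit_interval)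
  finally show "emeasure joint (snd -` B \<inter> E) =
      (\<integral>\<^sup>+x\<in>B. emeasure (kernel x) E \<partial>distr joint (borel_cms unit_interval_cms) snd)" .
qed

text \<open>Every atom has positive weight, and the atoms are dense.\<close>

lemma joint_support: "measure_support unit_interval_cms (distr joint (borel_cms unit_interval_cms) snd) =
    points unit_interval_cms"
proof -
  have "emeasure (distr (measure_pmf (geometric_pmf (1/2))) (borel_cms unit_interval_cms) atom) U > 0"
    if t: "t \<in> points unit_interval_cms" "t \<in> U" and U: "openin T.mtopology U" for t U
  proof -
    obtain e where e: "e > 0" "T.mball t e \<subseteq> U" using t U unfolding T.openin_mtopology by blast
    obtain k where "\<bar>t - atom k\<bar> < e" using ex_atom[of t e] t e(1) by (auto simp: in_unit_interval)
    then have "atom k \<in> T.mball t e"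
      using t atom_bounds[of k] by (simp add: in_unit_interval metr_unit_interval)
    then have k: "atom k \<in> U" using e by auto
    have "0 < ennreal (pmf (geometric_pmf (1/2)) k)" by simp
    also have "\<dots> = emeasure (measure_pmf (geometric_pmf (1/2))) {k}" by (simp add: emeasure_pmf_single)
    also have "\<dots> \<le> emeasure (measure_pmf (geometric_pmf (1/2))) (atom -` U)"
      using k by (intro emeasure_mono) auto
    also have "\<dots> = emeasure (distr (measure_pmf (geometric_pmf (1/2))) (borel_cms unit_interval_cms) atom) U"
      using atom_measurable T.open_in_borel[OF U] by (subst emeasure_distr) auto
    finally show ?thesis .
  qed
  then show ?thesis
    unfolding measure_support_def base_joint T.topology_cms by (auto simp: in_unit_interval)
qed

sublocale D: continuous_disintegration S unit_interval_cms joint kernel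
  by unfold_locales (rule joint_prob joint_support joint_disintegration kernel_continuous)+

lemma pmf_index_pmf: "pmf index_pmf z = mass r z"
proof -
  let ?k = "z div 2" and ?v = "h (atom (z div 2))"
  have v: "?v = interp r (psnd ?k + 2) (max 1 (real (Suc (psnd ?k)) / real (Suc (pfst ?k))))"
    using h_interp[OF atom_bounds(1) inverse_atom_less, of ?k] by (simp only: inverse_atom)
  have "ennreal (pmf index_pmf z) = (\<integral>\<^sup>+k. ennreal (if odd z then ?v else 1 - ?v) * indicator {?k} k \<partial>geometric_pmf (1/2))"
    unfolding emeasure_pmf_single[symmetric] index_pmf_def emeasure_bind_pmf
  proof (intro nn_integral_cong)
    fix k
    have "2 * k + of_bool c = z \<longleftrightarrow> k = ?k \<and> c = odd z" for c
      by (cases c) (simp_all, presburger+)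
    then have "(\<lambda>c. 2 * k + of_bool c) -` {z} = (if k = ?k then {odd z} else {})" by auto
    then have "emeasure (measure_pmf (map_pmf (\<lambda>c. 2 * k + of_bool c) (bernoulli_pmf (h (atom k))))) {z} =
        emeasure (measure_pmf (bernoulli_pmf (h (atom k)))) (if k = ?k then {odd z} else {})"
      by (simp add: emeasure_map_pmf del: vimage_singleton_eq)
    also have "\<dots> = ennreal (if odd z then ?v else 1 - ?v) * indicator {?k} k"
      using h01[of "atom ?k"] by (simp add: emeasure_pmf_single)
    finally show "emeasure (measure_pmf (map_pmf (\<lambda>c. 2 * k + of_bool c) (bernoulli_pmf (h (atom k))))) {z} =
        ennreal (if odd z then ?v else 1 - ?v) * indicator {?k} k" .
  qed
  also have "\<dots> = ennreal ((if odd z then ?v else 1 - ?v) * (1/2) ^ Suc ?k)"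
    using h01[of "atom ?k"] by (subst nn_integral_cmult_indicator) (auto simp: emeasure_pmf_single ennreal_mult[symmetric])
  finally have "pmf index_pmf z = (if odd z then ?v else 1 - ?v) * (1/2) ^ Suc ?k"
    using h01[of "atom ?k"] by (subst (asm) ennreal_inj) auto
  then show ?thesis unfolding v mass_def Let_def by (simp only: mult.commute)
qed

lemma sum_mass: "(\<Sum>z\<in>J \<inter> {..<M}. mass r z) = measure (measure_pmf index_pmf) (J \<inter> {..<M})"
  by (subst measure_measure_pmf_finite) (simp_all add: pmf_index_pmf)

section \<open>Approximating the joint measure and reading off the limit\<close>

lemma ex_deficit:
  assumes "e > 0"
  obtains M v where "deficit (mass r) M (list_decode (Suc v)) < e"
proof -
  have "(\<lambda>M. measure (measure_pmf index_pmf) {..<M}) \<longlonglongrightarrow> measure (measure_pmf index_pmf) (\<Union>M. {..<M})"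
    by (rule measure_pmf.finite_Lim_measure_incseq) (auto simp: incseq_def)
  also have "(\<Union>M. {..<M}) = (UNIV :: nat set)" by auto
  finally have "(\<lambda>M. measure (measure_pmf index_pmf) {..<M}) \<longlonglongrightarrow> 1" by simp
  then have "eventually (\<lambda>M. measure (measure_pmf index_pmf) {..<M} > 1 - e) sequentially"
    by (rule order_tendstoD) (use assms in simp)
  from eventually_happens'[OF sequentially_bot this]
  obtain M where "1 - e < measure (measure_pmf index_pmf) {..<M}" by (rule exE)
  then have tail: "1 - (\<Sum>z<M. mass r z) < e" using sum_mass[of UNIV M] by simp
  have "mass r z \<ge> 0" for z unfolding pmf_index_pmf[symmetric] by simp
  moreover have "(\<Sum>z<M. mass r z) \<le> 1" for M using sum_mass[of UNIV M] by simp
  ultimately obtain xs where xs: "xs \<noteq> []" "deficit (mass r) M xs < e"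
    using ex_list_deficit_less[of "mass r" M e] tail by blast
  obtain v where "list_encode xs = Suc v" using xs(1) by (cases xs) auto
  then have "list_decode (Suc v) = xs" by (metis list_encode_inverse)
  then show thesis using that xs(2) by metis
qed

text \<open>Mean and \<open>joint\<close> are carried by the same dense points, so the deficit
  bounds their difference on every Borel set.\<close>

lemma joint_approx:
  assumes xs: "xs \<noteq> []" and e: "deficit (mass r) M xs \<le> e" "e > 0"
  shows "metr (prob_cms ST) (dirac_mean ST (map (pcode a b) xs)) joint \<le> e"
proof -
  have xs': "map (pcode a b) xs \<noteq> []" using xs by simp
  have "metr (prob_cms ST) joint (dirac_mean ST (map (pcode a b) xs)) \<le> e"
  proof (rule ST.prob_dist_le_tv[OF _ e(2) joint_prob ST.dirac_mean_prob_measures[OF xs']])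
    fix E assume E: "E \<in> sets (borel_cms ST)"
    define J where "J = {z. dense ST (pcode a b z) \<in> E}"
    have "measure joint E = measure (measure_pmf index_pmf) J"
      unfolding joint_def J_def using E ST.dense_points
      by (subst measure_distr) (auto simp: vimage_def)
    also have "\<dots> \<le> measure (measure_pmf index_pmf) ((J \<inter> {..<M}) \<union> {M..})"
      by (intro measure_pmf.finite_measure_mono) auto
    also have "\<dots> \<le> measure (measure_pmf index_pmf) (J \<inter> {..<M}) + measure (measure_pmf index_pmf) {M..}"
      by (intro measure_Un_le) auto
    also have "measure (measure_pmf index_pmf) {M..} = 1 - measure (measure_pmf index_pmf) {..<M}"
      using measure_pmf.prob_compl[of "{..<M}" index_pmf] by (simp add: Compl_eq_Diff_UNIV[symmetric])
    also have "measure (measure_pmf index_pmf) (J \<inter> {..<M}) + (1 - measure (measure_pmf index_pmf) {..<M}) =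
        (\<Sum>z\<in>J \<inter> {..<M}. mass r z) + (1 - (\<Sum>z<M. mass r z))"
      using sum_mass[of J M] sum_mass[of UNIV M] by simp
    also have "\<dots> \<le> freq xs J + e"
      using sum_le_freq_deficit[of "mass r" J M xs] e by simp
    also have "freq xs J = measure (dirac_mean ST (map (pcode a b) xs)) E"
      unfolding ST.measure_dirac_mean[OF xs' E] freq_def J_def
      by (intro arg_cong2[of _ _ _ _ "(/)"] arg_cong[of _ _ real] arg_cong[of _ _ card]) auto
    finally show "measure joint E \<le> measure (dirac_mean ST (map (pcode a b) xs)) E + e" .
  qed
  then show ?thesis by (simp only: PST.commute)
qed

lemma measure_fibre_0:
  assumes E: "E \<in> sets (borel_cms S)"
  shows "measure (D.fibre 0) E = L * indicator E (dense S b) + (1 - L) * indicator E (dense S a)"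
proof -
  have 0: "0 \<in> points unit_interval_cms" by (simp add: in_unit_interval)
  have fE: "fst -` E \<inter> points ST \<in> sets (borel_cms ST)"
    using measurable_sets[OF measurable_fst E] by simp
  have "fst \<in> kernel 0 \<rightarrow>\<^sub>M borel_cms S"
    using measurable_fst by (simp add: ST.prob_measuresD[OF kernel_prob[OF 0]] cong: measurable_cong_sets)
  then have "measure (D.fibre 0) E = measure (kernel 0) (fst -` E \<inter> points ST)"
    unfolding D.fibre_def using E by (subst measure_distr) (simp_all add: ST.prob_measuresD[OF kernel_prob[OF 0]])
  also have "\<dots> = L * indicator E (dense S b) + (1 - L) * indicator E (dense S a)"
    unfolding measure_kernel[OF 0 fE] using 0 by (simp add: h_0 indicator_def points_prod_cms)
  finally show ?thesis .
qed

text \<open>The fibre over \<open>0\<close> gives mass \<open>L\<close> to every ball around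
  \<open>dense S b\<close> of radius in \<open>(0, 1]\<close>. So changing the radius
  \<open>1/2\<close> by \<open>d\<close> does not affect its mass, and \<open>k \<ge> 4\<close>
  ensures \<open>d < 1/2\<close>.\<close>

lemma estimate_limit:
  assumes q: "cauchy_rep (prob_cms S) q = Some (D.fibre 0)" and k: "k \<ge> 4"
  shows "\<bar>freq (list_decode (Suc (q k))) {z. metr S (dense S b) (dense S z) < 1/2} - L\<bar> \<le> 4 * (1/2) ^ k"
proof -
  define d :: real where "d = 4 * (1/2) ^ k"
  have "(1/2 :: real) ^ k \<le> (1/2) ^ 4" using k by (intro power_decreasing) auto
  also have "\<dots> = 1 / 16" by (simp add: eval_nat_numeral)
  finally have d: "d < 1/2" "d > 0" by (simp_all add: d_def)
  let ?m = "dense (prob_cms S) (q k)"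
  have 0: "0 \<in> points unit_interval_cms" by (simp add: in_unit_interval)
  have F: "D.fibre 0 \<in> prob_measures S" by (rule D.fibre[OF 0])
  have m: "?m \<in> prob_measures S" using PS.dense_points[of "q k"] by (simp only: points_prob_cms)
  have "metr (prob_cms S) ?m (D.fibre 0) < d"
    using PS.cauchy_repD(2)[OF q, of k] d(2) unfolding d_def by linarith
  note cl = prob_dist_less_imp_close[OF this m F]
  have ball: "mball (dense S b) x \<in> sets (borel_cms S)" for x by (intro open_in_borel openin_mball)
  have nb: "neighbourhood S d (mball (dense S b) x) \<subseteq> mball (dense S b) (x + d)" for x
  proof
    fix z assume "z \<in> neighbourhood S d (mball (dense S b) x)"
    then obtain y where y: "z \<in> points S" "y \<in> points S" "metr S (dense S b) y < x" "metr S y z < d"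
      by (auto simp: neighbourhood_def)
    then show "z \<in> mball (dense S b) (x + d)"
      using triangle[of "dense S b" y z] by simp
  qed
  have fib: "measure (D.fibre 0) (mball (dense S b) x) = L" if "0 < x" "x \<le> 1" for x
  proof -
    have "metr S (dense S b) (dense S a) = 1" using ab by (simp only: commute)
    then show ?thesis using that unfolding measure_fibre_0[OF ball] by simp
  qed
  have freq: "freq (list_decode (Suc (q k))) {z. metr S (dense S b) (dense S z) < 1/2} =
      measure ?m (mball (dense S b) (1/2))"
  proof -
    show ?thesis
      unfolding dense_prob_cms measure_dirac_mean[OF list_decode_Suc_neq_Nil ball] by (simp del: list_decode.simps)
  qed
  have "measure ?m (mball (dense S b) (1/2)) \<le> measure (D.fibre 0) (neighbourhood S d (mball (dense S b) (1/2))) + d"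
    using cl(1) ball by (auto simp: close_def)
  moreover have "measure (D.fibre 0) (neighbourhood S d (mball (dense S b) (1/2))) \<le>
      measure (D.fibre 0) (mball (dense S b) (1/2 + d))"
    by (rule measure_mono_prob[OF F nb ball])
  moreover have "measure (D.fibre 0) (mball (dense S b) (1/2 + d)) = L" using d by (intro fib) auto
  moreover have "measure (D.fibre 0) (mball (dense S b) (1/2 - d)) \<le>
      measure ?m (neighbourhood S d (mball (dense S b) (1/2 - d))) + d"
    using cl(2) ball by (auto simp: close_def)
  moreover have "measure (D.fibre 0) (mball (dense S b) (1/2 - d)) = L" using d by (intro fib) auto
  moreover have "measure ?m (neighbourhood S d (mball (dense S b) (1/2 - d))) \<le> measure ?m (mball (dense S b) (1/2))"
    using nb[of "1/2 - d"] by (intro measure_mono_prob[OF m _ ball]) simp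
  ultimately show ?thesis unfolding freq d_def[symmetric] by argo
qed

end

text \<open>Acceptance depends only on a name of \<open>\<mu>\<close>. A candidate accepted on
  account of \<open>\<kappa>\<close> is therefore sound for \<open>\<kappa>'\<close> too, and both
  fibres are close to it.\<close>

lemma fibre_unique:
  assumes 1: "continuous_disintegration S T \<mu> \<kappa>" and 2: "continuous_disintegration S T \<mu> \<kappa>'"
    and t: "t \<in> points T"
  shows "continuous_disintegration.fibre S \<kappa> t = continuous_disintegration.fibre S \<kappa>' t"
proof -
  interpret D1: continuous_disintegration S T \<mu> \<kappa> by fact
  interpret D2: continuous_disintegration S T \<mu> \<kappa>' by fact
  have F: "D1.fibre t \<in> points (prob_cms S)" "D2.fibre t \<in> points (prob_cms S)"
    using D1.fibre[OF t] D2.fibre[OF t] by (simp_all add: D1.S.points_prob_cms)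
  obtain p where p: "cauchy_rep (prob_cms (S \<times>\<^sub>m T)) p = Some \<mu>"
    using D1.PST.ex_cauchy_rep[of \<mu>] D1.\<mu> by (auto simp: D1.ST.points_prob_cms)
  obtain q where q: "cauchy_rep T q = Some t" using D1.T.ex_cauchy_rep[OF t] by blast
  have "metr (prob_cms S) (D1.fibre t) (D2.fibre t) \<le> (1/2) ^ n" for n
  proof -
    obtain c a v j where acc: "\<And>s. accept_code S T (p (pfst s)) (prod_encode (n, prod_encode (c, prod_encode (a, v)))) s"
      and d: "metr T (dense T (q j)) (dense T c) + 2 * (1/2) ^ j < (1/2) ^ a"
      using D1.ex_accept[OF p q, of n] by blast
    have "metr T (dense T c) t \<le> metr T (dense T (q j)) (dense T c) + metr T (dense T (q j)) t"
      using t by (metis D1.T.commute D1.T.dense_points D1.T.triangle)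
    then have tb: "t \<in> D1.T.mball (dense T c) ((1/2) ^ a)"
      using t d D1.T.cauchy_repD(2)[OF q, of j] by simp
    have "metr (prob_cms S) (D1.fibre t) (D2.fibre t) \<le>
        metr (prob_cms S) (dense (prob_cms S) v) (D1.fibre t) + metr (prob_cms S) (dense (prob_cms S) v) (D2.fibre t)"
      using F by (intro D1.PS.triangle'') auto
    also have "\<dots> \<le> (1/2) ^ (n + 3) + (1/2) ^ (n + 3)"
      by (intro add_mono D1.accept_sound[OF p acc tb] D2.accept_sound[OF p acc tb])
    also have "\<dots> \<le> (1/2) ^ n" by (simp add: power_add eval_nat_numeral)
    finally show ?thesis .
  qed
  then have "metr (prob_cms S) (D1.fibre t) (D2.fibre t) \<le> 0"
    by (intro LIMSEQ_le_const[OF LIMSEQ_power_zero[of "1/2 :: real"]]) auto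
  then show ?thesis using D1.PS.zero[OF F] D1.PS.nonneg[of "D1.fibre t" "D2.fibre t"] by linarith
qed

subsection \<open>The reduction\<close>

lemma rrec_of_bool [recf_intros]: "recp P \<Longrightarrow> rrec (\<lambda>p x. of_bool (P p x))"
  using rrec_of_nat[OF recf_of_bool, of P] by simp

text \<open>\<open>g\<close> tabulates names of all members of a sequence, the \<open>k\<close>-th
  at the codes \<open>prod_encode (k, x)\<close>; digit \<open>i\<close> is certain at entry
  \<open>i + 2\<close>.\<close>

definition bits :: "baire \<Rightarrow> nat \<Rightarrow> nat \<Rightarrow> bool" where
  "bits g k = (\<lambda>i. bit (g (prod_encode (k, i + 2))) i)"

definition approx :: "baire \<Rightarrow> nat \<Rightarrow> real" where
  "approx g k = enc4 (bits g k) k"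

lemma rrec_mass_approx:
  assumes "recf Z" shows "rrec (\<lambda>p x. mass (approx p) (Z p x))"
proof -
  have "rrec (\<lambda>p z. mass (approx p) z)"
    unfolding mass_def Let_def interp_def approx_def enc4_def bits_def by (intro recf_intros)
  from rrec_comp[OF this assms] show ?thesis .
qed

text \<open>Collects the values at all \<open>Q k\<close> into one element \<open>g\<close> of Baire
  space, on which further machines can work.\<close>

lemma evaluation_machine:
  assumes "recf (\<lambda>_ z. Q (pfst z) (psnd z))"
  obtains e where "\<And>n p g. (\<And>k. machine n (interleave p (Q k)) = Some (\<lambda>x. g (prod_encode (k, x)))) \<Longrightarrow>
    machine e (tagged n p) = Some g"
proof -
  obtain c where c: "\<And>n p k q x. machine n (interleave p (Q k)) = Some q \<Longrightarrow>
      run (tagged n p) c (prod_encode (k, x)) (q x)"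
    using run_evaluation[OF assms] by blast
  obtain e where "prog_of e = c" using surj_prog_of by (metis surjD)
  then have "machine e (tagged n p) = Some g"
    if "\<And>k. machine n (interleave p (Q k)) = Some (\<lambda>x. g (prod_encode (k, x)))" for n p g
    unfolding machine_eq_Some_iff
  proof (intro allI)
    fix z
    have "run (tagged n p) c (prod_encode (pfst z, psnd z)) (g (prod_encode (pfst z, psnd z)))"
      by (rule c[OF that])
    then show "run (tagged n p) (prog_of e) z (g z)" by (simp add: \<open>prog_of e = c\<close>)
  qed
  then show thesis by (rule that)
qed

lemma computable_machine: "computable (machine n)"
  unfolding computable_def by (rule exI[of _ n]) simp

lemma zero_name: "cauchy_rep unit_interval_cms (\<lambda>_. 0) = Some 0"
  by (rule separable_cms.cauchy_repI[OF separable_unit_interval_cms])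
    (simp_all add: points_unit_interval metr_unit_interval dense_unit_interval)

context two_point_cms
begin

lemma joint_name_machine:
  obtains e where "\<And>g L. coded_measure S a b (approx g) L \<Longrightarrow>
    \<exists>q. machine e g = Some q \<and>
      cauchy_rep (prob_cms (S \<times>\<^sub>m unit_interval_cms)) q = Some (coded_measure.joint S a b (approx g) L)"
proof -
  define P where "P g n w \<longleftrightarrow> deficit (mass (approx g)) (pfst w) (list_decode (Suc (psnd w))) < (1/2) ^ (n + 2)"
    for g :: baire and n w
  \<comment> \<open>An index of \<open>prob_cms\<close> stands for the list coded by its successor,
    hence the predecessor here.\<close>
  define F where "F w = list_encode (map (\<lambda>j. pcode a b (nth_code (Suc (psnd w)) j))
      [0..<length (list_decode (Suc (psnd w)))]) - 1" for w
  \<comment> \<open>As a comprehension the singleton has the shape to which \<open>rrec_freq\<close>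
    applies.\<close>
  have freq1: "freq xs {i} = freq xs {z. z = i}" for xs i by simp
  have "recp (\<lambda>g z. P g (pfst z) (psnd z))"
    unfolding P_def deficit_def freq1 by (intro recf_intros rrec_mass_approx)
  moreover have "recf (\<lambda>g z. F (psnd z))"
    unfolding F_def pcode_def tau_def by (intro recf_intros)
  ultimately have "\<exists>e. \<forall>g. (\<forall>n. \<exists>w. P g n w) \<longrightarrow> machine e g = Some (\<lambda>n. F (LEAST w. P g n w))"
    by (rule machine_search)
  then obtain e where "\<forall>g. (\<forall>n. \<exists>w. P g n w) \<longrightarrow> machine e g = Some (\<lambda>n. F (LEAST w. P g n w))" ..
  note e = this[rule_format]
  show thesis
  proof (rule that[of e])
    fix g L assume "coded_measure S a b (approx g) L"
    then interpret C: coded_measure S a b "approx g" L .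
    have ex: "\<exists>w. P g n w" for n
    proof -
      have "(0::real) < (1/2) ^ (n + 2)" by simp
      then obtain M v where "deficit (mass (approx g)) M (list_decode (Suc v)) < (1/2) ^ (n + 2)"
        by (rule C.ex_deficit)
      then have "P g n (prod_encode (M, v))" by (simp add: P_def del: list_decode.simps)
      then show ?thesis by (rule exI)
    qed
    define w where "w n = (LEAST w. P g n w)" for n
    have near: "metr (prob_cms C.ST) (dense (prob_cms C.ST) (F (w n))) C.joint < (1/2) ^ Suc n" for n
    proof -
      let ?xs = "list_decode (Suc (psnd (w n)))"
      have ne: "?xs \<noteq> []" by (rule list_decode_Suc_neq_Nil)
      have "map (\<lambda>j. pcode a b (nth_code (Suc (psnd (w n))) j)) [0..<length ?xs] = map (pcode a b) ?xs"
        by (rule nth_equalityI) (simp_all add: nth_code del: list_decode.simps)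
      then have "F (w n) = list_encode (map (pcode a b) ?xs) - 1" by (simp only: F_def)
      moreover have "list_encode (map (pcode a b) ?xs) \<noteq> 0"
        using ne by (metis list_decode_eq_Nil_iff list_encode_inverse map_is_Nil_conv)
      ultimately have "list_decode (Suc (F (w n))) = map (pcode a b) ?xs"
        by (metis Suc_pred' list_encode_inverse neq0_conv One_nat_def)
      then have d: "dense (prob_cms C.ST) (F (w n)) = dirac_mean C.ST (map (pcode a b) ?xs)"
        by (simp only: ST.dense_prob_cms)
      have "P g n (w n)" unfolding w_def using ex by (rule LeastI_ex)
      then have "metr (prob_cms C.ST) (dense (prob_cms C.ST) (F (w n))) C.joint \<le> (1/2) ^ (n + 2)"
        unfolding d P_def using ne by (intro C.joint_approx[OF _ less_imp_le]) auto
      also have "\<dots> < (1/2 :: real) ^ Suc n" by (rule power_strict_decreasing) auto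
      finally show ?thesis .
    qed
    have "cauchy_rep (prob_cms C.ST) (\<lambda>n. F (w n)) = Some C.joint"
      by (intro PST.cauchy_repI near) (simp add: ST.points_prob_cms C.joint_prob)
    moreover have "machine e g = Some (\<lambda>n. F (w n))" unfolding w_def by (rule e[OF ex])
    ultimately show "\<exists>q. machine e g = Some q \<and> cauchy_rep (prob_cms C.ST) q = Some C.joint" by blast
  qed
qed

lemma digits_machine:
  obtains e where "\<And>q r L x. coded_measure S a b r L \<Longrightarrow> (\<And>n. \<bar>L - enc4 x n\<bar> \<le> (1/4) ^ n / 3) \<Longrightarrow>
      cauchy_rep (prob_cms S) q = Some (continuous_disintegration.fibre S (coded_measure.kernel S a b r L) 0) \<Longrightarrow>
    \<exists>y. machine e (\<lambda>z. q (psnd z)) = Some y \<and> cauchy_rep cantor_cms y = Some x"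
proof -
  \<comment> \<open>At entry \<open>2 * N + 6\<close> the error is at most
    \<open>4 * (1/2) ^ (2 * N + 6)\<close>, that is \<open>(1/4) ^ N / 16\<close>.\<close>
  define R where "R g N = freq (list_decode (Suc (g (prod_encode (0, 2 * N + 6)))))
      {z. metr S (dense S b) (dense S z) < 1/2}" for g :: baire and N
  \<comment> \<open>In units of \<open>(1/4) ^ (n + 2)\<close>: the true digits pass since
    \<open>1/3 + 1/16 \<le> 5/12\<close>, and digits that pass are correct since
    \<open>5/12 + 1/16 + 1/3 < 1\<close>.\<close>
  define P where "P g n v \<longleftrightarrow> 12 * \<bar>enc4 (bit v) (n + 2) - R g (n + 2)\<bar> \<le> 5 * (1/4) ^ (n + 2)"
    for g :: baire and n and v :: nat
  have half: "rrec (\<lambda>p x. 1/2)" using rrec_inverse_power[OF recf_const[of 1], of "num.Bit0 num.One"] by simp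
  have "recp (\<lambda>g z. P g (pfst z) (psnd z))"
    unfolding P_def R_def enc4_def by (intro recf_intros rrec_metr half)
  moreover have "recf (\<lambda>g z. psnd z)" by (intro recf_intros)
  ultimately have "\<exists>e. \<forall>g. (\<forall>n. \<exists>v. P g n v) \<longrightarrow> machine e g = Some (\<lambda>n. (LEAST v. P g n v))"
    by (rule machine_search[where F = "\<lambda>g n v. v"])
  then obtain e where "\<forall>g. (\<forall>n. \<exists>v. P g n v) \<longrightarrow> machine e g = Some (\<lambda>n. (LEAST v. P g n v))" ..
  note e = this[rule_format]
  show thesis
  proof (rule that[of e])
    fix q r L x assume "coded_measure S a b r L" and L: "\<And>n. \<bar>L - enc4 x n\<bar> \<le> (1/4) ^ n / 3"
      and q: "cauchy_rep (prob_cms S) q = Some (continuous_disintegration.fibre S (coded_measure.kernel S a b r L) 0)"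
    then interpret C: coded_measure S a b r L by simp
    let ?g = "\<lambda>z. q (psnd z)"
    have R: "\<bar>R ?g N - L\<bar> \<le> (1/4) ^ N / 16" for N
    proof -
      have "\<bar>R ?g N - L\<bar> \<le> 4 * (1/2) ^ (2 * N + 6)"
        using C.estimate_limit[OF q, of "2 * N + 6"] by (simp add: R_def del: list_decode.simps)
      also have "(1/2 :: real) ^ (2 * N + 6) = (1/4) ^ N / 64"
        by (simp only: power_add power_mult) (simp add: power_divide)
      finally show ?thesis by simp
    qed
    have ex: "\<exists>v. P ?g n v" for n
    proof
      have "enc4 (bit (cantor_code x (n + 2))) (n + 2) = enc4 x (n + 2)"
        by (rule enc4_cong) (simp add: bit_cantor_code)
      moreover have "(0::real) \<le> (1/4) ^ (n + 2)" by simp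
      ultimately show "P ?g n (cantor_code x (n + 2))"
        using L[of "n + 2"] R[of "n + 2"] unfolding P_def by argo
    qed
    define v where "v n = (LEAST v. P ?g n v)" for n
    have "metr cantor_cms (dense cantor_cms (v n)) x < (1/2) ^ Suc n" for n
      unfolding metr_cantor_less_iff dense_cantor
    proof (intro allI impI)
      fix i assume "i \<le> Suc n"
      then have i: "i < n + 2" by simp
      have "P ?g n (v n)" unfolding v_def using ex by (rule LeastI_ex)
      moreover have "(0::real) < (1/4) ^ (n + 2)" by simp
      ultimately have "\<bar>enc4 (bit (v n)) (n + 2) - enc4 x (n + 2)\<bar> < (1/4) ^ (n + 2)"
        using L[of "n + 2"] R[of "n + 2"] unfolding P_def by argo
      then show "bit (v n) i = x i" using i by (rule enc4_digits)
    qed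
    then have "cauchy_rep cantor_cms v = Some x"
      by (intro separable_cms.cauchy_repI[OF separable_cantor_cms]) (simp_all add: points_cantor)
    moreover have "machine e ?g = Some v" unfolding v_def by (rule e[OF ex])
    ultimately show "\<exists>y. machine e ?g = Some y \<and> cauchy_rep cantor_cms y = Some x" by blast
  qed
qed

theorem lim_op_le_disintegration_op: "lim_op cantor_cms \<le>\<^sub>s\<^sub>W disintegration_op S unit_interval_cms"
proof -
  let ?T = unit_interval_cms
  have "recf (\<lambda>_ z. tagged (pfst z) (\<lambda>_. 0) (psnd z))" by (intro recf_intros)
  then obtain e1 where e1: "\<And>n p g. (\<And>k. machine n (interleave p (tagged k (\<lambda>_. 0))) = Some (\<lambda>x. g (prod_encode (k, x)))) \<Longrightarrow>
      machine e1 (tagged n p) = Some g"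
    by (rule evaluation_machine) blast
  obtain e2 where e2: "\<And>g L. coded_measure S a b (approx g) L \<Longrightarrow>
    \<exists>q. machine e2 g = Some q \<and> cauchy_rep (prob_cms (S \<times>\<^sub>m ?T)) q = Some (coded_measure.joint S a b (approx g) L)"
    by (rule joint_name_machine) blast
  have "recf (\<lambda>_ z. 0)" by (intro recf_intros)
  then obtain e3 where e3: "\<And>n p g. (\<And>k. machine n (interleave p (\<lambda>_. 0)) = Some (\<lambda>x. g (prod_encode (k, x)))) \<Longrightarrow>
      machine e3 (tagged n p) = Some g"
    by (rule evaluation_machine[of "\<lambda>_ _. 0"]) blast
  obtain e4 where e4: "\<And>q r L x. coded_measure S a b r L \<Longrightarrow> (\<And>n. \<bar>L - enc4 x n\<bar> \<le> (1/4) ^ n / 3) \<Longrightarrow>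
      cauchy_rep (prob_cms S) q = Some (continuous_disintegration.fibre S (coded_measure.kernel S a b r L) 0) \<Longrightarrow>
    \<exists>y. machine e4 (\<lambda>z. q (psnd z)) = Some y \<and> cauchy_rep cantor_cms y = Some x"
    by (rule digits_machine) blast
  \<comment> \<open>\<open>e1\<close> tabulates the sequence and \<open>e2\<close> names the joint
    measure; \<open>e3\<close> evaluates the answer at \<open>0\<close>, whose name is constantly
    zero, and \<open>e4\<close> decodes the digits.\<close>
  define H K where "H = machine e4 \<circ>\<^sub>m machine e3" and "K = machine e2 \<circ>\<^sub>m machine e1"
  have "computable H" "computable K"
    unfolding H_def K_def by (intro computable_comp computable_machine)+
  moreover have "(H \<circ>\<^sub>m G \<circ>\<^sub>m K) \<turnstile>\<^sub>r lim_op cantor_cms" if G: "G \<turnstile>\<^sub>r disintegration_op S ?T" for G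
    unfolding realizer_def
  proof (intro allI impI, elim conjE)
    fix p0 X assume "src (lim_op cantor_cms) p0 = Some X" and "val (lim_op cantor_cms) X \<noteq> {}"
    then obtain x where p0: "fun_rep nat_rep (cauchy_rep cantor_cms) p0 = Some X"
      and x: "limitin (topology_cms cantor_cms) X x sequentially"
      by (auto simp: lim_op_def)
    obtain n p where p: "p0 = tagged n p" and "\<forall>q k. nat_rep q = Some k \<longrightarrow>
        (\<exists>q'. machine n (interleave p q) = Some q' \<and> cauchy_rep cantor_cms q' = Some (X k))"
      using p0 unfolding fun_rep_eq_Some_iff by blast
    then have "\<forall>k. \<exists>q'. machine n (interleave p (tagged k (\<lambda>_. 0))) = Some q' \<and> cauchy_rep cantor_cms q' = Some (X k)"
      by (simp add: nat_rep_eq_Some_iff)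
    from choice[OF this] obtain f where f: "\<And>k. machine n (interleave p (tagged k (\<lambda>_. 0))) = Some (f k)"
      "\<And>k. cauchy_rep cantor_cms (f k) = Some (X k)" by blast
    define g where "g z = f (pfst z) (psnd z)" for z
    have g: "machine e1 p0 = Some g" unfolding p by (rule e1) (simp add: f g_def)
    have bits: "bits g k = X k" for k
      using cauchy_rep_cantorD[OF f(2)[of k]] by (auto simp: bits_def g_def)
    obtain L where L: "(\<lambda>k. enc4 (X k) k) \<longlonglongrightarrow> L" "\<And>n. \<bar>L - enc4 x n\<bar> \<le> (1/4) ^ n / 3"
      using enc4_limit[of X x] x unfolding limitin_cantor_iff by blast
    have "coded_measure S a b (approx g) L"
      by unfold_locales (use L(1) enc4_bounds in \<open>simp_all add: approx_def[abs_def] bits\<close>)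
    then interpret C: coded_measure S a b "approx g" L .
    obtain q where q: "machine e2 g = Some q" "cauchy_rep (prob_cms C.ST) q = Some C.joint"
      using e2[OF C.coded_measure_axioms] by blast
    have "src (disintegration_op S ?T) q = Some C.joint \<and> val (disintegration_op S ?T) C.joint \<noteq> {}"
      using q(2) C.joint_prob C.joint_support C.joint_disintegration C.kernel_continuous
      by (auto simp: disintegration_op_def)
    then obtain q' y where q': "G q = Some q'" "tgt (disintegration_op S ?T) q' = Some y"
        "y \<in> val (disintegration_op S ?T) C.joint"
      using G unfolding realizer_def by meson
    obtain \<kappa> where y: "y = (\<lambda>t\<in>points ?T. distr (\<kappa> t) (borel_cms S) fst)"
      and \<kappa>: "continuous_disintegration S ?T C.joint \<kappa>"
      using q'(3) C.joint_prob
      by (auto simp: disintegration_op_def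
          intro!: continuous_disintegration.intro cms_pair_axioms continuous_disintegration_axioms.intro)
    have 0: "0 \<in> points ?T" by (simp add: in_unit_interval)
    \<comment> \<open>The answer is only known to come from some continuous disintegration
      \<open>\<kappa>\<close>; uniqueness identifies its fibre over \<open>0\<close>.\<close>
    have y0: "y 0 = C.D.fibre 0"
      using fibre_unique[OF \<kappa> C.D.continuous_disintegration_axioms 0] 0
      by (simp add: y continuous_disintegration.fibre_def[OF \<kappa>])
    have "fun_rep (cauchy_rep ?T) (cauchy_rep (prob_cms S)) q' = Some y"
      using q'(2) by (simp add: disintegration_op_def)
    then obtain m s where s: "q' = tagged m s" and "\<forall>q t. cauchy_rep ?T q = Some t \<longrightarrow>
        (\<exists>q'. machine m (interleave s q) = Some q' \<and> cauchy_rep (prob_cms S) q' = Some (y t))"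
      unfolding fun_rep_eq_Some_iff by blast
    then obtain o' where o': "machine m (interleave s (\<lambda>_. 0)) = Some o'"
      "cauchy_rep (prob_cms S) o' = Some (C.D.fibre 0)"
      using zero_name y0 by metis
    have "machine e3 q' = Some (\<lambda>z. o' (psnd z))" unfolding s by (rule e3) (simp add: o')
    moreover obtain yn where "machine e4 (\<lambda>z. o' (psnd z)) = Some yn" "cauchy_rep cantor_cms yn = Some x"
      using e4[OF C.coded_measure_axioms L(2) o'(2)] by blast
    ultimately have "(H \<circ>\<^sub>m G \<circ>\<^sub>m K) p0 = Some yn" "tgt (lim_op cantor_cms) yn = Some x" "x \<in> val (lim_op cantor_cms) X"
      using g q(1) q'(1) x by (simp_all add: H_def K_def lim_op_def)
    then show "\<exists>q y. (H \<circ>\<^sub>m G \<circ>\<^sub>m K) p0 = Some q \<and> tgt (lim_op cantor_cms) q = Some y \<and> y \<in> val (lim_op cantor_cms) X"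
      by blast
  qed
  ultimately show ?thesis unfolding sW_reducible_def by blast
qed

end

theorem theorem4p7:
  shows "disintegration_op unit_interval_cms unit_interval_cms
           \<equiv>\<^sub>s\<^sub>W disintegration_op nat_cms unit_interval_cms \<and>
         disintegration_op nat_cms unit_interval_cms \<equiv>\<^sub>s\<^sub>W lim_op cantor_cms"
proof -
  \<comment> \<open>\<open>prod_encode (1, 0)\<close> codes the fraction \<open>1 / 1\<close>, and
    \<open>0\<close> codes \<open>0 / 1\<close>.\<close>
  have U: "two_point_cms unit_interval_cms 0 (prod_encode (1, 0))"
    by (intro two_point_cms.intro two_point_cms_axioms.intro rational_unit_interval_cms)
      (simp add: metr_unit_interval dense_unit_interval)
  have N: "two_point_cms nat_cms 0 1"
    by (intro two_point_cms.intro two_point_cms_axioms.intro rational_nat_cms) (simp add: nat_cms_def)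
  note le = disintegration_op_le_lim_op[OF rational_unit_interval_cms rational_unit_interval_cms]
    disintegration_op_le_lim_op[OF rational_nat_cms rational_unit_interval_cms]
  note ge = two_point_cms.lim_op_le_disintegration_op[OF U] two_point_cms.lim_op_le_disintegration_op[OF N]
  show ?thesis
    unfolding sW_equivalent_def
    using le ge sW_reducible_trans[OF le(1) ge(2)] sW_reducible_trans[OF le(2) ge(1)] by blast
qed

end
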